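(* Let $(M,\omega,H)$ be an ergodically regular Hamiltonian system with functionally independent conserved quantities $H=H_1,H_2,\dots,H_k$, and let $A\in L^1_\beta(M)\cap L^2_\beta(M)$ be an observable. Then for every positive integer $d$, $$\mathcal C(A)\ \ge\ \sum_{|\mathbf l|\le d,\ |\mathbf n|\le d}\langle A,H_1^{l_1}H_2^{l_2}\cdots H_k^{l_k}\rangle_\beta\ (\mathbf H^{-1})_{\mathbf l,\mathbf n}\ \langle A,H_1^{n_1}H_2^{n_2}\cdots H_k^{n_k}\rangle_\beta ,$$ where the sum is over multi-indices $\mathbf l=(l_1,\dots,l_k)$, $\mathbf n=(n_1,\dots,n_k)$ of nonnegative integers and $\mathbf H$ is the Gram matrix of the monomials $H_1^{n_1}\cdots H_k^{n_k}$ with $|\mathbf n|\le d$.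
   Context: $(M,\omega,H)$ is a Hamiltonian system: $(M,\omega)$ is a symplectic manifold of finite dimension $2r$, $H:M\to\mathbb R$ is the Hamiltonian, and $\gamma_m:\mathbb R\to M$ is the solution of Hamilton's equations with $\gamma_m(0)=m$. The measure $dm$ on $M$ is given by $\omega^r$ (locally $dq_1\cdots dq_r\,dp_1\cdots dp_r$). The partition function $\mathcal Z(\beta)=\int_M e^{-\beta H(m)}\,dm$ is assumed finite for all $\beta>0$; fix $\beta>0$. $L^p_\beta(M)$ is the space of measurable $f:M\to\mathbb R$ with $\int_M|f|^p e^{-\beta H}\,dm<\infty$, and $$\langle F,G\rangle_\beta=\frac1{\mathcal Z(\beta)}\int_M F(m)G(m)e^{-\beta H(m)}\,dm .$$ For an observable $A:M\to\mathbb R$ put $A^t(m)=A(\gamma_m(t))$ and $\mathcal C(A)=\lim_{T\to\infty}\frac1T\int_0^T\langle A^0,A^t\rangle_\beta\,dt$. Conserved quantities: $H=H_1,H_2,\dots,H_k:M\to\mathbb R$, $k<2r$, are functionally independent functions constant along the flow (not necessarily in involution). The moment map is $\mathcal H=(H_1,\dots,H_k):M\to D\subset\mathbb R^k$, and $\mathcal L_\alpha=\mathcal H^{-1}(\alpha)$ for $\alpha\in D$. Each $\mathcal L_\alpha$ carries the generalized microcanonical measure $dm_\alpha$ induced by $dm$, so that $\int_M F\,dm=\int_D\left(\int_{\mathcal L_\alpha}F(m_\alpha)\,dm_\alpha\right)d\alpha$; $\mathrm{Vol}(\mathcal L_\alpha)$ is the total mass of $dm_\alpha$ (finite for almost every $\alpha$,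 since $\mathcal Z(\beta)<\infty$). The system is ergodically regular if for every $B\in L^1_\beta(M)$, for almost every $\alpha\in D$ and almost every $m\in\mathcal L_\alpha$, $\lim_{T\to\infty}\frac1T\int_0^T B(\gamma_m(t))\,dt=\frac1{\mathrm{Vol}(\mathcal L_\alpha)}\int_{\mathcal L_\alpha}B(m_\alpha)\,dm_\alpha$. For a multi-index, $|\mathbf n|=n_1+\dots+n_k$. All monomials $H_1^{n_1}\cdots H_k^{n_k}$ are assumed to lie in $L^2_\beta(M)$. The matrix $\mathbf H$ (for given $d$), indexed by multi-indices of degree at most $d$ (in any fixed order), has entries $\mathbf H_{\mathbf l,\mathbf n}=\langle H_1^{l_1}\cdots H_k^{l_k},H_1^{n_1}\cdots H_k^{n_k}\rangle_\beta$; it is invertible because functional independence of the $H_i$ makes the monomials linearly independent. *)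

theory Defs
  imports "HOL-Analysis.Analysis"
begin

section \<open>Smooth manifolds\<close>

text \<open>
  The manifold is the whole type \<open>'m\<close>; a chart is a pair of its domain and its coordinate map,
  whose values outside the domain are irrelevant.
\<close>

type_synonym ('m, 'n) chart = "'m set \<times> ('m \<Rightarrow> real ^ 'n)"

text \<open>\<open>C_k_on k f S\<close> is meant for open \<open>S\<close> only, where it says that \<open>f\<close> is of class $C^k$.\<close>

primrec C_k_on :: "nat \<Rightarrow> ('a::real_normed_vector \<Rightarrow> 'b::real_normed_vector) \<Rightarrow> 'a set \<Rightarrow> bool" where
  "C_k_on 0 f S \<longleftrightarrow> continuous_on S f"
| "C_k_on (Suc k) f S \<longleftrightarrow>
     f differentiable_on S \<and> (\<forall>v. C_k_on k (\<lambda>x. frechet_derivative f (at x) v) S)"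

definition smooth_on :: "'a::real_normed_vector set \<Rightarrow> ('a \<Rightarrow> 'b::real_normed_vector) \<Rightarrow> bool" where
  "smooth_on S f \<longleftrightarrow> (\<forall>k. C_k_on k f S)"

definition chart_inv :: "('m, 'n) chart \<Rightarrow> real ^ 'n \<Rightarrow> 'm" where
  "chart_inv c = inv_into (fst c) (snd c)"

definition chart_image :: "('m, 'n) chart \<Rightarrow> (real ^ 'n) set" where
  "chart_image c = snd c ` fst c"

locale smooth_manifold =
  fixes atlas :: "('m::{t2_space, second_countable_topology}, 'n::finite) chart set"
  assumes open_domain: "c \<in> atlas \<Longrightarrow> open (fst c)"
    and open_image: "c \<in> atlas \<Longrightarrow> open (chart_image c)"
    and homeo: "c \<in> atlas \<Longrightarrow> homeomorphism (fst c) (chart_image c) (snd c) (chart_inv c)"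
    and cover: "(\<Union>c\<in>atlas. fst c) = UNIV"
    and compatible: "c \<in> atlas \<Longrightarrow> c' \<in> atlas \<Longrightarrow>
          smooth_on (snd c ` (fst c \<inter> fst c')) (snd c' \<circ> chart_inv c)"

definition smooth_fun :: "('m, 'n::finite) chart set \<Rightarrow> ('m \<Rightarrow> real) \<Rightarrow> bool" where
  "smooth_fun atlas f \<longleftrightarrow> (\<forall>c\<in>atlas. smooth_on (chart_image c) (f \<circ> chart_inv c))"

text \<open>The coordinate expression, in the chart \<open>c\<close>, of the differential of \<open>f\<close> at \<open>p\<close>.\<close>

definition differential :: "('m, 'n::finite) chart \<Rightarrow> ('m \<Rightarrow> real) \<Rightarrow> 'm \<Rightarrow> real ^ 'n \<Rightarrow> real" where
  "differential c f p = frechet_derivative (f \<circ> chart_inv c) (at (snd c p))"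


section \<open>Symplectic manifolds and Hamiltonian systems\<close>

text \<open>
  A 2-form \<open>\<omega>\<close> is given by its coordinate expressions: \<open>\<omega> c x u v\<close> is its value, in the chart
  \<open>c\<close>, at the point with coordinates \<open>x\<close> on the tangent vectors with components \<open>u\<close> and \<open>v\<close>.
\<close>

type_synonym ('m, 'n) two_form =
  "('m, 'n) chart \<Rightarrow> real ^ 'n \<Rightarrow> real ^ 'n \<Rightarrow> real ^ 'n \<Rightarrow> real"

locale symplectic_manifold = smooth_manifold atlas
  for atlas :: "('m::{t2_space, second_countable_topology}, 'n::finite) chart set" +
  fixes \<omega> :: "('m, 'n) two_form" and r :: nat
  assumes dimension: "CARD('n) = 2 * r"
    and form_bilinear: "c \<in> atlas \<Longrightarrow> x \<in> chart_image c \<Longrightarrow> bilinear (\<omega> c x)"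
    and form_antisym: "c \<in> atlas \<Longrightarrow> x \<in> chart_image c \<Longrightarrow> \<omega> c x u v = - \<omega> c x v u"
    and form_nondegenerate: "c \<in> atlas \<Longrightarrow> x \<in> chart_image c \<Longrightarrow> (\<And>v. \<omega> c x u v = 0) \<Longrightarrow> u = 0"
    and form_smooth: "c \<in> atlas \<Longrightarrow> smooth_on (chart_image c) (\<lambda>x. \<omega> c x u v)"
    and form_closed: "c \<in> atlas \<Longrightarrow> x \<in> chart_image c \<Longrightarrow>
          frechet_derivative (\<lambda>y. \<omega> c y v w) (at x) u
        + frechet_derivative (\<lambda>y. \<omega> c y w u) (at x) v
        + frechet_derivative (\<lambda>y. \<omega> c y u v) (at x) w = 0"
    and form_compatible: "c \<in> atlas \<Longrightarrow> c' \<in> atlas \<Longrightarrow> p \<in> fst c \<inter> fst c' \<Longrightarrow>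
          D = frechet_derivative (snd c' \<circ> chart_inv c) (at (snd c p)) \<Longrightarrow>
          \<omega> c (snd c p) u v = \<omega> c' (snd c' p) (D u) (D v)"

text \<open>
  The value of $b \wedge \dots \wedge b$ (\<open>r\<close> factors) on the vectors \<open>v 0, \<dots>, v (2 * r - 1)\<close>.
\<close>

definition wedge_power :: "nat \<Rightarrow> ('v \<Rightarrow> 'v \<Rightarrow> real) \<Rightarrow> (nat \<Rightarrow> 'v) \<Rightarrow> real" where
  "wedge_power r b v =
     (\<Sum>\<sigma> | \<sigma> permutes {..<2 * r}.
        of_int (sign \<sigma>) * (\<Prod>i<r. b (v (\<sigma> (2 * i))) (v (\<sigma> (2 * i + 1))))) / 2 ^ r"

text \<open>
  The density of the volume form $\omega^r$ with respect to Lebesgue measure in a chart. The factor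
  $1/r!$ is the normalisation that gives $dq_1 \cdots dq_r\, dp_1 \cdots dp_r$ in canonical
  coordinates. The absolute value makes the choice of the enumeration of the basis irrelevant.
\<close>

definition liouville_density :: "nat \<Rightarrow> ('m, 'n::finite) two_form \<Rightarrow> ('m, 'n) chart \<Rightarrow> real ^ 'n \<Rightarrow> real" where
  "liouville_density r \<omega> c x =
     \<bar>wedge_power r (\<omega> c x) (\<lambda>i. axis (from_nat_into (UNIV :: 'n set) i) 1)\<bar> / fact r"

text \<open>There is exactly one such measure on a given symplectic manifold.\<close>

definition is_liouville_measure ::
    "('m::topological_space, 'n::finite) chart set \<Rightarrow> ('m, 'n) two_form \<Rightarrow> nat \<Rightarrow> 'm measure \<Rightarrow> bool" where
  "is_liouville_measure atlas \<omega> r dm \<longleftrightarrow> sets dm = sets borel \<and>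
     (\<forall>c\<in>atlas. \<forall>B\<in>sets borel. B \<subseteq> fst c \<longrightarrow>
        emeasure dm B = (\<integral>\<^sup>+x\<in>snd c ` B. ennreal (liouville_density r \<omega> c x) \<partial>lborel))"

text \<open>
  Hamilton's equations $\omega(\dot\gamma, \cdot) = dH$. For $\omega = \sum_i dq_i \wedge dp_i$ they
  read $\dot q_i = \partial H / \partial p_i$, $\dot p_i = - \partial H / \partial q_i$. Continuity
  is required separately, because coordinate maps are meaningless outside their domains.
\<close>

definition solves_hamilton ::
    "('m::topological_space, 'n::finite) chart set \<Rightarrow> ('m, 'n) two_form \<Rightarrow> ('m \<Rightarrow> real) \<Rightarrow> (real \<Rightarrow> 'm) \<Rightarrow> bool" where
  "solves_hamilton atlas \<omega> H \<gamma> \<longleftrightarrow> continuous_on UNIV \<gamma> \<and>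
     (\<forall>t. \<forall>c\<in>atlas. \<gamma> t \<in> fst c \<longrightarrow>
        (\<exists>X. ((\<lambda>s. snd c (\<gamma> s)) has_vector_derivative X) (at t) \<and>
             (\<forall>v. \<omega> c (snd c (\<gamma> t)) X v = differential c H (\<gamma> t) v)))"

locale hamiltonian_system = symplectic_manifold atlas \<omega> r
  for atlas :: "('m::{t2_space, second_countable_topology}, 'n::finite) chart set"
    and \<omega> :: "('m, 'n) two_form" and r :: nat +
  fixes H :: "'m \<Rightarrow> real" and \<gamma> :: "'m \<Rightarrow> real \<Rightarrow> 'm" and dm :: "'m measure"
  assumes hamiltonian_smooth: "smooth_fun atlas H"
    and flow_init: "\<gamma> m 0 = m"
    and flow_solves: "solves_hamilton atlas \<omega> H (\<gamma> m)"
    and liouville: "is_liouville_measure atlas \<omega> r dm"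


section \<open>Conserved quantities and microcanonical measures\<close>

text \<open>Functional independence: the differentials are linearly independent on a dense set.\<close>

definition functionally_independent ::
    "('m::topological_space, 'n::finite) chart set \<Rightarrow> ('k::finite \<Rightarrow> 'm \<Rightarrow> real) \<Rightarrow> bool" where
  "functionally_independent atlas Hs \<longleftrightarrow>
     closure {p. \<forall>c\<in>atlas. p \<in> fst c \<longrightarrow>
       (\<forall>a::'k \<Rightarrow> real. (\<forall>v. (\<Sum>i\<in>UNIV. a i * differential c (Hs i) p v) = 0) \<longrightarrow> (\<forall>i. a i = 0))} = UNIV"

text \<open>
  The index type \<open>'k\<close> plays the role of $\{1, \dots, k\}$, and \<open>i\<^sub>1\<close> that of the index $1$.
\<close>

definition conserved_quantities ::
    "('m::topological_space, 'n::finite) chart set \<Rightarrow> ('m \<Rightarrow> real) \<Rightarrow> ('m \<Rightarrow> real \<Rightarrow> 'm)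
      \<Rightarrow> 'k::finite \<Rightarrow> ('k \<Rightarrow> 'm \<Rightarrow> real) \<Rightarrow> bool" where
  "conserved_quantities atlas H \<gamma> i\<^sub>1 Hs \<longleftrightarrow>
     Hs i\<^sub>1 = H \<and> CARD('k) < CARD('n) \<and> (\<forall>i. smooth_fun atlas (Hs i)) \<and>
     (\<forall>i m t. Hs i (\<gamma> m t) = Hs i m) \<and> functionally_independent atlas Hs"

definition moment_map :: "('k::finite \<Rightarrow> 'm \<Rightarrow> real) \<Rightarrow> 'm \<Rightarrow> real ^ 'k" where
  "moment_map Hs m = (\<chi> i. Hs i m)"

definition level_set :: "('k::finite \<Rightarrow> 'm \<Rightarrow> real) \<Rightarrow> real ^ 'k \<Rightarrow> 'm set" where
  "level_set Hs \<alpha> = {m. moment_map Hs m = \<alpha>}"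

text \<open>
  \<open>mc \<alpha>\<close> is the generalised microcanonical measure on the level set of \<open>\<alpha>\<close>; the set $D$ is the
  image of the moment map. These conditions determine \<open>mc \<alpha>\<close> for almost every \<open>\<alpha>\<close>.
\<close>

definition microcanonical_measures ::
    "'m::topological_space measure \<Rightarrow> ('k::finite \<Rightarrow> 'm \<Rightarrow> real) \<Rightarrow> (real ^ 'k \<Rightarrow> 'm measure) \<Rightarrow> bool" where
  "microcanonical_measures dm Hs mc \<longleftrightarrow>
     (\<forall>\<alpha>\<in>range (moment_map Hs). sets (mc \<alpha>) = sets (restrict_space borel (level_set Hs \<alpha>))) \<and>
     (\<forall>F\<in>borel_measurable borel.
        (\<lambda>\<alpha>. (\<integral>\<^sup>+m. F m \<partial>mc \<alpha>) * indicator (range (moment_map Hs)) \<alpha>) \<in> borel_measurable lborel \<and>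
        (\<integral>\<^sup>+m. F m \<partial>dm) = (\<integral>\<^sup>+\<alpha>\<in>range (moment_map Hs). (\<integral>\<^sup>+m. F m \<partial>mc \<alpha>) \<partial>lborel))"


section \<open>Gibbs averages and time averages\<close>

definition partition_function :: "'m measure \<Rightarrow> ('m \<Rightarrow> real) \<Rightarrow> real \<Rightarrow> real" where
  "partition_function dm H \<beta> = (LINT m|dm. exp (- \<beta> * H m))"

definition Lp_gibbs :: "'m measure \<Rightarrow> ('m \<Rightarrow> real) \<Rightarrow> real \<Rightarrow> real \<Rightarrow> ('m \<Rightarrow> real) set" where
  "Lp_gibbs dm H \<beta> p =
     {f \<in> borel_measurable dm. integrable dm (\<lambda>m. \<bar>f m\<bar> powr p * exp (- \<beta> * H m))}"

definition gibbs_inner ::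
    "'m measure \<Rightarrow> ('m \<Rightarrow> real) \<Rightarrow> real \<Rightarrow> ('m \<Rightarrow> real) \<Rightarrow> ('m \<Rightarrow> real) \<Rightarrow> real" where
  "gibbs_inner dm H \<beta> F G =
     1 / partition_function dm H \<beta> * (LINT m|dm. F m * G m * exp (- \<beta> * H m))"

definition time_average :: "(real \<Rightarrow> real) \<Rightarrow> real \<Rightarrow> real" where
  "time_average f T = 1 / T * (LINT t:{0..T}|lborel. f t)"

definition ergodically_regular ::
    "'m measure \<Rightarrow> ('m \<Rightarrow> real) \<Rightarrow> real \<Rightarrow> ('m \<Rightarrow> real \<Rightarrow> 'm)
      \<Rightarrow> ('k::finite \<Rightarrow> 'm \<Rightarrow> real) \<Rightarrow> (real ^ 'k \<Rightarrow> 'm measure) \<Rightarrow> bool" where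
  "ergodically_regular dm H \<beta> \<gamma> Hs mc \<longleftrightarrow>
     (\<forall>B\<in>Lp_gibbs dm H \<beta> 1. AE \<alpha> in lborel. \<alpha> \<in> range (moment_map Hs) \<longrightarrow>
        (AE m in mc \<alpha>.
          (time_average (\<lambda>t. B (\<gamma> m t)) \<longlongrightarrow>
             1 / measure (mc \<alpha>) (level_set Hs \<alpha>) * (LINT m'|mc \<alpha>. B m')) at_top))"

definition autocorrelation ::
    "'m measure \<Rightarrow> ('m \<Rightarrow> real) \<Rightarrow> real \<Rightarrow> ('m \<Rightarrow> real \<Rightarrow> 'm) \<Rightarrow> ('m \<Rightarrow> real) \<Rightarrow> real \<Rightarrow> real" where
  "autocorrelation dm H \<beta> \<gamma> A t = gibbs_inner dm H \<beta> A (\<lambda>m. A (\<gamma> m t))"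


section \<open>Monomials in the conserved quantities and their Gram matrix\<close>

definition multi_indices :: "nat \<Rightarrow> ('k::finite \<Rightarrow> nat) set" where
  "multi_indices d = {n. (\<Sum>i\<in>UNIV. n i) \<le> d}"

definition monomial :: "('k::finite \<Rightarrow> 'm \<Rightarrow> real) \<Rightarrow> ('k \<Rightarrow> nat) \<Rightarrow> 'm \<Rightarrow> real" where
  "monomial Hs n m = (\<Prod>i\<in>UNIV. Hs i m ^ n i)"

definition gram ::
    "'m measure \<Rightarrow> ('m \<Rightarrow> real) \<Rightarrow> real \<Rightarrow> ('k::finite \<Rightarrow> 'm \<Rightarrow> real) \<Rightarrow> ('k \<Rightarrow> nat) \<Rightarrow> ('k \<Rightarrow> nat) \<Rightarrow> real" where
  "gram dm H \<beta> Hs l n = gibbs_inner dm H \<beta> (monomial Hs l) (monomial Hs n)"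

text \<open>
  \<open>inverse_on I G\<close> is the inverse of the square matrix \<open>G\<close> with rows and columns indexed by the
  finite set \<open>I\<close>, extended by 0; it is unspecified if that matrix is singular.
\<close>

definition is_inverse_on :: "'i set \<Rightarrow> ('i \<Rightarrow> 'i \<Rightarrow> real) \<Rightarrow> ('i \<Rightarrow> 'i \<Rightarrow> real) \<Rightarrow> bool" where
  "is_inverse_on I G K \<longleftrightarrow>
     (\<forall>l\<in>I. \<forall>n\<in>I. (\<Sum>j\<in>I. G l j * K j n) = (if l = n then 1 else 0)) \<and>
     (\<forall>l\<in>I. \<forall>n\<in>I. (\<Sum>j\<in>I. K l j * G j n) = (if l = n then 1 else 0)) \<and>
     (\<forall>l n. l \<notin> I \<or> n \<notin> I \<longrightarrow> K l n = 0)"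

definition inverse_on :: "'i set \<Rightarrow> ('i \<Rightarrow> 'i \<Rightarrow> real) \<Rightarrow> 'i \<Rightarrow> 'i \<Rightarrow> real" where
  "inverse_on I G = (THE K. is_inverse_on I G K)"

end

theory Submission
  imports Defs "HOL-Real_Asymp.Real_Asymp"
begin

text \<open>
  The Hamiltonian flow preserves the Liouville measure: an Euler step of size \<open>s\<close> changes the symplectic
  form, hence its top exterior power, by \<open>o(s)\<close> only, because the Lie derivative of the form along the
  Hamiltonian vector field vanishes; the errors of \<open>n\<close> steps of size \<open>T / n\<close> disappear as \<open>n\<close> tends to
  infinity, and the Euler scheme converges to the flow. No differentiability of the flow with respect
  to the initial point is needed.

  The Gibbs measure is therefore invariant. Ergodic regularity provides pointwise limits of time
  averages of bounded observables, and by truncation the averaged autocorrelation of every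
  square-integrable observable converges to a nonnegative limit. Subtracting from \<open>A\<close> a polynomial \<open>P\<close>
  in the conserved quantities changes this limit by \<open>\<langle>P, P\<rangle> - 2 \<langle>A, P\<rangle>\<close>, and the best choice of \<open>P\<close> is
  the orthogonal projection of \<open>A\<close>. The Gram matrix is positive definite because the zeros of a
  nonzero polynomial form a null set and the Liouville measure disintegrates over the moment map; if
  the Liouville measure vanished, both sides would be 0.
\<close>

section \<open>Determinants and top exterior powers\<close>

text \<open>A Hamiltonian system comes with one solution curve through each point and with nothing
  about its dependence on the starting point. Uniqueness, continuity and measurability of
  \<open>\<gamma>\<close> and the group law therefore have to be derived before Liouville's theorem
  makes sense for it; all of them are read off from the Euler scheme or from flow boxes built with
  it.

  The scheme runs in a chart ball: points start within radius \<open>R\<close>, move by at most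
  \<open>R\<close> up to time \<open>R / M\<close>, where \<open>M\<close> bounds the speed, and one
  further step stays within \<open>3 * R\<close>. On a noncompact manifold such times may have no
  common lower bound, so local facts reach all times by a connectedness argument: the times at which
  they hold form an open and closed set.

  Only a one-sided estimate is carried through the limit: the points that flow into \<open>B\<close>
  have at most the measure of \<open>B\<close>. Equality comes from using it for \<open>t\<close>
  and for \<open>- t\<close>, and negative times come from replacing \<open>H\<close> by
  \<open>- H\<close>.\<close>

definition nat_det :: "nat \<Rightarrow> (nat \<Rightarrow> nat \<Rightarrow> real) \<Rightarrow> real" where
  "nat_det N d = (\<Sum>\<sigma> | \<sigma> permutes {..<N}. of_int (sign \<sigma>) * (\<Prod>i<N. d (\<sigma> i) i))"

lemma prod_pairs: "(\<Prod>i<r. f (2 * i) * f (2 * i + 1)) = (\<Prod>j<2 * r. f j)" for f :: "nat \<Rightarrow> real"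
  by (induction r) (simp_all add: mult.assoc)

text \<open>Replacing \<sigma> by its inverse and then by \<sigma> \<circ> inv \<tau> turns the
  Leibniz sum into this one up to the factor sign \<tau>, which changes sides because its square is
  1.\<close>

lemma sum_sign_permutes:
  assumes "\<tau> permutes {..<N}"
  shows "(\<Sum>\<sigma> | \<sigma> permutes {..<N}. of_int (sign \<sigma>) * (\<Prod>j<N. d (\<tau> j) (\<sigma> j))) = of_int (sign \<tau>) * nat_det N d"
proof -
  have "nat_det N d = (\<Sum>\<sigma> | \<sigma> permutes {..<N}. of_int (sign (inv \<sigma>)) * (\<Prod>i<N. d (inv \<sigma> i) i))"
    unfolding nat_det_def by (rule sum_permutations_inverse)
  also have "\<dots> = (\<Sum>\<sigma> | \<sigma> permutes {..<N}. of_int (sign (inv (\<sigma> \<circ> inv \<tau>))) * (\<Prod>i<N. d (inv (\<sigma> \<circ> inv \<tau>) i) i))"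
    by (rule sum_permutations_compose_right) (rule permutes_inv[OF assms])
  also have "\<dots> = (\<Sum>\<sigma> | \<sigma> permutes {..<N}. of_int (sign \<tau>) * (of_int (sign \<sigma>) * (\<Prod>j<N. d (\<tau> j) (\<sigma> j))))"
  proof (rule sum.cong[OF refl])
    fix \<sigma> assume "\<sigma> \<in> {\<sigma>. \<sigma> permutes {..<N}}"
    then have s: "\<sigma> permutes {..<N}" by simp
    have inv: "inv (\<sigma> \<circ> inv \<tau>) = \<tau> \<circ> inv \<sigma>"
      using permutes_bij[OF s] permutes_bij[OF assms]
      by (subst o_inv_distrib) (auto simp: bij_imp_bij_inv inv_inv_eq)
    have perm: "permutation \<sigma>" "permutation \<tau>"
      unfolding permutation_permutes using s assms by blast+
    have sgn: "sign (inv (\<sigma> \<circ> inv \<tau>)) = sign \<tau> * sign \<sigma>"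
      unfolding inv using perm by (simp add: sign_compose sign_inverse permutation_inverse)
    have "(\<Prod>i<N. d (inv (\<sigma> \<circ> inv \<tau>) i) i) = (\<Prod>j<N. d ((\<tau> \<circ> inv \<sigma>) (\<sigma> j)) (\<sigma> j))"
      unfolding inv by (rule prod.permute[OF s, unfolded comp_def])
    also have "\<dots> = (\<Prod>j<N. d (\<tau> j) (\<sigma> j))"
      using permutes_inverses(2)[OF s] by simp
    finally show "of_int (sign (inv (\<sigma> \<circ> inv \<tau>))) * (\<Prod>i<N. d (inv (\<sigma> \<circ> inv \<tau>) i) i) =
       of_int (sign \<tau>) * (of_int (sign \<sigma>) * (\<Prod>j<N. d (\<tau> j) (\<sigma> j)))"
      using sgn by simp
  qed
  finally have "nat_det N d = of_int (sign \<tau>) * (\<Sum>\<sigma> | \<sigma> permutes {..<N}. of_int (sign \<sigma>) * (\<Prod>j<N. d (\<tau> j) (\<sigma> j)))"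
    by (simp add: sum_distrib_left)
  moreover have "of_int (sign \<tau>) * of_int (sign \<tau>) = (1::real)"
    by (metis of_int_1 of_int_mult sign_idempotent)
  ultimately show ?thesis by (simp flip: mult.assoc)
qed

text \<open>Composition with the transposition of two arguments with equal values of
  \<open>g\<close> keeps every product and flips every sign, so the sum equals its own
  negative.\<close>

lemma sum_sign_non_inj:
  fixes N :: nat and d :: "nat \<Rightarrow> nat \<Rightarrow> real"
  assumes "\<not> inj_on g {..<N}"
  shows "(\<Sum>\<sigma> | \<sigma> permutes {..<N}. of_int (sign \<sigma>) * (\<Prod>j<N. d (g j) (\<sigma> j))) = (0::real)"
proof -
  obtain a c where ac: "a < N" "c < N" "a \<noteq> c" "g a = g c"
    using assms unfolding inj_on_def by blast
  define t where "t = Transposition.transpose a c"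
  have t: "t permutes {..<N}" using ac by (simp add: t_def permutes_swap_id)
  have gt: "g (t j) = g j" for j
    unfolding t_def Transposition.transpose_def using ac(4) by presburger
  have tt: "t (t j) = j" for j by (simp add: t_def)
  let ?D = "\<Sum>\<sigma> | \<sigma> permutes {..<N}. of_int (sign \<sigma>) * (\<Prod>j<N. d (g j) (\<sigma> j))"
  have "?D = (\<Sum>\<sigma> | \<sigma> permutes {..<N}. of_int (sign (\<sigma> \<circ> t)) * (\<Prod>j<N. d (g j) ((\<sigma> \<circ> t) j)))"
    by (rule sum_permutations_compose_right[OF t])
  also have "\<dots> = (\<Sum>\<sigma> | \<sigma> permutes {..<N}. - (of_int (sign \<sigma>) * (\<Prod>j<N. d (g j) (\<sigma> j))))"
  proof (rule sum.cong[OF refl])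
    fix \<sigma> assume "\<sigma> \<in> {\<sigma>. \<sigma> permutes {..<N}}"
    then have "permutation \<sigma>" unfolding permutation_permutes by blast
    then have sgn: "sign (\<sigma> \<circ> t) = - sign \<sigma>"
      using sign_compose[of \<sigma> t] ac(3) by (simp add: t_def sign_swap_id permutation_swap_id)
    have "(\<Prod>j<N. d (g j) ((\<sigma> \<circ> t) j)) = (\<Prod>j<N. d (g (t j)) ((\<sigma> \<circ> t) (t j)))"
      by (rule prod.permute[OF t, unfolded comp_def])
    then have "(\<Prod>j<N. d (g j) ((\<sigma> \<circ> t) j)) = (\<Prod>j<N. d (g j) (\<sigma> j))"
      by (simp only: gt tt comp_apply)
    then show "of_int (sign (\<sigma> \<circ> t)) * (\<Prod>j<N. d (g j) ((\<sigma> \<circ> t) j)) = - (of_int (sign \<sigma>) * (\<Prod>j<N. d (g j) (\<sigma> j)))"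
      by (simp only: sgn of_int_minus mult_minus_left)
  qed
  also have "\<dots> = - ?D" by (rule sum_negf)
  finally show ?thesis by linarith
qed

text \<open>Pulling back a top-degree form multiplies it by the determinant. Bilinear expansion of
  every factor gives a sum over all choices of \<open>2 * r\<close> basis indices; choices with a
  repetition cancel by \<open>sum_sign_non_inj\<close>, and the others are permutations, each
  contributing its sign times the determinant.\<close>

lemma wedge_power_linear_image:
  fixes b :: "'v::real_vector \<Rightarrow> 'v \<Rightarrow> real"
  assumes b: "bilinear b" and v: "\<And>j. j < 2 * r \<Longrightarrow> v j = (\<Sum>i<2 * r. d i j *\<^sub>R e i)"
  shows "wedge_power r b v = nat_det (2 * r) d * wedge_power r b e"
proof -
  let ?N = "2 * r" and ?P = "{\<sigma>. \<sigma> permutes {..<2 * r}}"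
  let ?F = "PiE {..<r} (\<lambda>_. {..<2 * r} \<times> {..<2 * r})"
  \<comment> \<open>\<open>g \<phi>\<close> lists the \<open>r\<close> index pairs of
    \<open>\<phi>\<close> as one sequence of \<open>2 * r\<close> indices, the first members at even
    places.\<close>
  define g :: "(nat \<Rightarrow> nat \<times> nat) \<Rightarrow> nat \<Rightarrow> nat"
    where "g \<phi> j = (if even j then fst (\<phi> (j div 2)) else snd (\<phi> (j div 2)))" for \<phi> j
  have g0: "g \<phi> (2 * i) = fst (\<phi> i)" "g \<phi> (Suc (2 * i)) = snd (\<phi> i)" for \<phi> i
    by (simp_all add: g_def)
  let ?B = "\<lambda>\<phi>. \<Prod>i<r. b (e (fst (\<phi> i))) (e (snd (\<phi> i)))"
  let ?S = "\<lambda>g. \<Sum>\<sigma>\<in>?P. of_int (sign \<sigma>) * (\<Prod>j<?N. d (g j) (\<sigma> j))"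
  have bb: "b (v x) (v y) = (\<Sum>pq\<in>{..<?N} \<times> {..<?N}. d (fst pq) x * d (snd pq) y * b (e (fst pq)) (e (snd pq)))"
    if "x < ?N" "y < ?N" for x y
    unfolding v[OF that(1)] v[OF that(2)] bilinear_sum[OF b]
    by (rule sum.cong) (auto simp: bilinear_lmul[OF b] bilinear_rmul[OF b] mult_ac)
  have prod: "(\<Prod>i<r. b (v (\<sigma> (2 * i))) (v (\<sigma> (2 * i + 1)))) = (\<Sum>\<phi>\<in>?F. (\<Prod>j<?N. d (g \<phi> j) (\<sigma> j)) * ?B \<phi>)"
    if s: "\<sigma> \<in> ?P" for \<sigma>
  proof -
    have lt: "\<sigma> j < ?N" if "j < ?N" for j using s that permutes_in_image[of \<sigma> "{..<?N}" j] by auto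
    have "(\<Prod>i<r. b (v (\<sigma> (2 * i))) (v (\<sigma> (2 * i + 1)))) =
      (\<Prod>i<r. \<Sum>pq\<in>{..<?N} \<times> {..<?N}. d (fst pq) (\<sigma> (2 * i)) * d (snd pq) (\<sigma> (2 * i + 1)) * b (e (fst pq)) (e (snd pq)))"
      by (intro prod.cong refl bb lt) auto
    also have "\<dots> = (\<Sum>\<phi>\<in>?F. \<Prod>i<r. d (fst (\<phi> i)) (\<sigma> (2 * i)) * d (snd (\<phi> i)) (\<sigma> (2 * i + 1)) * b (e (fst (\<phi> i))) (e (snd (\<phi> i))))"
      by (subst prod_sum_PiE) auto
    also have "\<dots> = (\<Sum>\<phi>\<in>?F. (\<Prod>j<?N. d (g \<phi> j) (\<sigma> j)) * ?B \<phi>)"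
      by (subst prod_pairs[symmetric]) (simp add: prod.distrib g0)
    finally show ?thesis .
  qed
  have "wedge_power r b v * 2 ^ r = (\<Sum>\<sigma>\<in>?P. of_int (sign \<sigma>) * (\<Sum>\<phi>\<in>?F. (\<Prod>j<?N. d (g \<phi> j) (\<sigma> j)) * ?B \<phi>))"
    unfolding wedge_power_def using prod by simp
  also have "\<dots> = (\<Sum>\<phi>\<in>?F. ?S (g \<phi>) * ?B \<phi>)"
    unfolding sum_distrib_left sum_distrib_right by (subst sum.swap) (simp add: mult_ac)
  also have "\<dots> = (\<Sum>\<phi> | \<phi> \<in> ?F \<and> inj_on (g \<phi>) {..<?N}. ?S (g \<phi>) * ?B \<phi>)"
    by (rule sum.mono_neutral_right) (auto simp: finite_PiE sum_sign_non_inj)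
  \<comment> \<open>Sequences without repetition correspond to permutations. Beyond their ranges
    \<open>\<tau>\<close> is continued by the identity and \<open>\<phi>\<close> by
    \<open>undefined\<close>, as membership in \<open>?P\<close> and \<open>?F\<close>
    demands.\<close>
  also have "\<dots> = (\<Sum>\<tau>\<in>?P. of_int (sign \<tau>) * nat_det ?N d * (\<Prod>i<r. b (e (\<tau> (2 * i))) (e (\<tau> (2 * i + 1)))))"
  proof (rule sum.reindex_bij_witness[where i = "\<lambda>\<tau>. \<lambda>i\<in>{..<r}. (\<tau> (2 * i), \<tau> (2 * i + 1))"
          and j = "\<lambda>\<phi> j. if j < ?N then g \<phi> j else j"])
    fix \<phi> assume "\<phi> \<in> {\<phi> \<in> ?F. inj_on (g \<phi>) {..<?N}}"
    then have F: "\<phi> \<in> ?F" and inj: "inj_on (g \<phi>) {..<?N}" by auto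
    let ?\<tau> = "\<lambda>j. if j < ?N then g \<phi> j else j"
    show "(\<lambda>i\<in>{..<r}. (?\<tau> (2 * i), ?\<tau> (2 * i + 1))) = \<phi>"
      using F by (auto simp: fun_eq_iff restrict_def g0 PiE_def extensional_def)
    have into: "g \<phi> j < ?N" if "j < ?N" for j
    proof -
      have "j div 2 < r" using that by auto
      then have "\<phi> (j div 2) \<in> {..<?N} \<times> {..<?N}" using F by (auto simp: PiE_iff)
      then show ?thesis by (auto simp: g_def)
    qed
    have perm: "?\<tau> permutes {..<?N}"
    proof (rule bij_imp_permutes)
      have "g \<phi> ` {..<?N} = {..<?N}"
        by (rule endo_inj_surj[OF finite_lessThan _ inj]) (use into in \<open>simp add: image_subset_iff\<close>)
      with inj have "bij_betw (g \<phi>) {..<?N} {..<?N}" by (simp add: bij_betw_def)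
      then show "bij_betw ?\<tau> {..<?N} {..<?N}" by (rule bij_betw_cong[THEN iffD1, rotated]) auto
    qed auto
    then show "?\<tau> \<in> ?P" by simp
    have "?S (g \<phi>) = ?S ?\<tau>" by (intro sum.cong refl arg_cong2[where f="(*)"] prod.cong) auto
    also have "\<dots> = of_int (sign ?\<tau>) * nat_det ?N d" by (rule sum_sign_permutes[OF perm])
    finally show "of_int (sign ?\<tau>) * nat_det ?N d * (\<Prod>i<r. b (e (?\<tau> (2 * i))) (e (?\<tau> (2 * i + 1)))) =
      ?S (g \<phi>) * ?B \<phi>" by (simp add: g0)
  next
    fix \<tau> assume "\<tau> \<in> ?P"
    then have t: "\<tau> permutes {..<?N}" by simp
    let ?\<phi> = "\<lambda>i\<in>{..<r}. (\<tau> (2 * i), \<tau> (2 * i + 1))"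
    have gt: "g ?\<phi> j = \<tau> j" if "j < ?N" for j
    proof (cases "even j")
      case True then show ?thesis using that by (auto simp: g_def elim!: evenE)
    next
      case False then show ?thesis using that by (auto simp: g_def elim!: oddE)
    qed
    show "(\<lambda>j. if j < ?N then g ?\<phi> j else j) = \<tau>"
      using gt permutes_not_in[OF t] by (auto simp: fun_eq_iff)
    have "inj_on (g ?\<phi>) {..<?N}"
      using inj_on_cong[of "{..<?N}" "g ?\<phi>" \<tau>] gt permutes_inj_on[OF t] by auto
    moreover have "\<tau> j < ?N" if "j < ?N" for j using t that permutes_in_image[of \<tau> "{..<?N}" j] by auto
    ultimately show "?\<phi> \<in> {\<phi> \<in> ?F. inj_on (g \<phi>) {..<?N}}" by auto
  qed
  also have "\<dots> = nat_det ?N d * wedge_power r b e * 2 ^ r"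
    unfolding wedge_power_def by (simp add: sum_distrib_left mult.left_commute mult.assoc)
  finally show ?thesis by simp
qed

text \<open>\<open>wedge_power\<close> numbers its vectors by naturals, while \<open>det\<close> is
  indexed by a finite type; the numbering \<open>f\<close> translates between them.\<close>

lemma det_eq_nat_det:
  fixes D :: "real ^ 'i::finite ^ 'i"
  assumes f: "bij_betw f (UNIV :: 'i set) {..<N}" and d: "\<And>i j. D $ i $ j = d (f i) (f j)"
  shows "det D = nat_det N d"
proof -
  \<comment> \<open>Transposing first makes the permutation act on the row index, as in
    \<open>nat_det\<close>.\<close>
  have *: "det D = (\<Sum>p | p permutes (UNIV :: 'i set). of_int (sign p) * (\<Prod>i\<in>UNIV. d (f (p i)) (f i)))"
    by (subst det_transpose[symmetric]) (simp add: det_def transpose_def d)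
  let ?g = "inv_into UNIV f"
  have g: "bij_betw ?g {..<N} UNIV" by (rule bij_betw_inv_into[OF f])
  have fg: "f (?g x) = x" if "x < N" for x using that f by (auto simp: bij_betw_def f_inv_into_f)
  have gf: "?g (f x) = x" for x using f by (auto simp: bij_betw_def)
  have inj: "inj f" using f by (simp add: bij_betw_def)
  show ?thesis unfolding * nat_det_def
  proof (rule sum.reindex_bij_witness[where j = "map_permutation UNIV f" and i = "map_permutation {..<N} ?g"])
    fix p assume "p \<in> {p. p permutes (UNIV :: 'i set)}"
    then have p: "p permutes UNIV" by simp
    show "map_permutation {..<N} ?g (map_permutation UNIV f p) = p"
      by (rule map_permutation_compose_inv[OF f p]) (simp add: gf)
    show "map_permutation UNIV f p \<in> {p. p permutes {..<N}}"
      using map_permutation_permutes[OF f p] by simp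
    have "(\<Prod>i<N. d (map_permutation UNIV f p i) i) = (\<Prod>i\<in>UNIV. d (map_permutation UNIV f p (f i)) (f i))"
      by (rule prod.reindex_bij_betw[OF f, symmetric])
    also have "\<dots> = (\<Prod>i\<in>UNIV. d (f (p i)) (f i))"
      using map_permutation_apply[OF inj, of _ p] by simp
    finally show "of_int (sign (map_permutation UNIV f p)) * (\<Prod>i<N. d (map_permutation UNIV f p i) i) =
       of_int (sign p) * (\<Prod>i\<in>UNIV. d (f (p i)) (f i))"
      using sign_map_permutation[OF inj p] by simp
  next
    fix p assume "p \<in> {p. p permutes {..<N}}"
    then have p: "p permutes {..<N}" by simp
    show "map_permutation UNIV f (map_permutation {..<N} ?g p) = p"
      by (rule map_permutation_compose_inv[OF g p]) (simp add: fg)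
    show "map_permutation {..<N} ?g p \<in> {p. p permutes UNIV}"
      using map_permutation_permutes[OF g p] by simp
  qed
qed

section \<open>Change of variables for arbitrary finite index types\<close>

text \<open>The library proves the change of variables formula only for well-ordered index types.\<close>

typedef 'n index = "{..<CARD('n::finite)}" by (rule exI[of _ 0]) simp

instance index :: (finite) finite
proof
  show "finite (UNIV :: 'a index set)"
    using type_definition.univ[OF type_definition_index] by (metis finite_imageI finite_lessThan)
qed

instantiation index :: (finite) wellorder
begin

definition less_eq_index :: "'a index \<Rightarrow> 'a index \<Rightarrow> bool" where "x \<le> y \<longleftrightarrow> Rep_index x \<le> Rep_index y"

definition less_index :: "'a index \<Rightarrow> 'a index \<Rightarrow> bool" where "x < y \<longleftrightarrow> Rep_index x < Rep_index y"

instance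
proof
  fix P :: "'a index \<Rightarrow> bool" and a
  assume step: "\<And>x. (\<And>y. y < x \<Longrightarrow> P y) \<Longrightarrow> P x"
  show "P a"
    by (induction "Rep_index a" arbitrary: a rule: less_induct) (metis step less_index_def)
qed (auto simp: less_eq_index_def less_index_def Rep_index_inject)

end

lemma bij_betw_Rep_index: "bij_betw (Rep_index :: 'n index \<Rightarrow> nat) UNIV {..<CARD('n::finite)}"
  unfolding bij_betw_def
  using type_definition.Rep_range[OF type_definition_index] by (auto simp: inj_on_def Rep_index_inject)

text \<open>Boundedness gives the image finite measure, so that the formula holds for the gauge
  integral; as the integrand is nonnegative, this is a Lebesgue integral.\<close>

lemma emeasure_differentiable_image_wellorder:
  fixes g :: "real ^ 'i::{finite,wellorder} \<Rightarrow> real ^ 'i::_"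
  assumes S: "S \<in> sets borel" and g: "\<And>x. x \<in> S \<Longrightarrow> (g has_derivative g' x) (at x within S)"
    and inj: "inj_on g S" and gS: "g ` S \<in> sets borel" "bounded (g ` S)"
  shows "emeasure lborel (g ` S) = (\<integral>\<^sup>+x\<in>S. ennreal \<bar>det (matrix (g' x))\<bar> \<partial>lborel)"
proof -
  have L: "S \<in> sets lebesgue" using S by simp
  have fin: "g ` S \<in> lmeasurable"
    using gS by (simp add: bounded_set_imp_lmeasurable)
  have int: "((\<lambda>x. \<bar>det (matrix (g' x))\<bar>) has_integral measure lebesgue (g ` S)) S"
    using has_measure_differentiable_image[OF L g inj] fin by blast
  then have "(\<lambda>x. \<bar>det (matrix (g' x))\<bar>) absolutely_integrable_on S"
    by (intro nonnegative_absolutely_integrable_1) (auto simp: has_integral_integrable)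
  then have "ennreal (measure lebesgue (g ` S)) = (\<integral>\<^sup>+x. ennreal (indicator S x * \<bar>det (matrix (g' x))\<bar>) \<partial>lebesgue)"
    unfolding integral_unique[OF int, symmetric]
    by (subst set_lebesgue_integral_eq_integral(2)[symmetric])
       (auto simp: set_lebesgue_integral_def set_integrable_def intro!: nn_integral_eq_integral[symmetric])
  also have "\<dots> = (\<integral>\<^sup>+x\<in>S. ennreal \<bar>det (matrix (g' x))\<bar> \<partial>lebesgue)"
    by (intro nn_integral_cong) (simp add: indicator_def)
  finally show ?thesis
    using fin gS emeasure_eq_measure2[OF fin] by (simp add: nn_integral_completion)
qed

text \<open>The frame on which \<open>liouville_density\<close> evaluates the form.\<close>

definition enum_axis :: "nat \<Rightarrow> real ^ 'n::finite" where
  "enum_axis i = axis (from_nat_into (UNIV :: 'n set) i) 1"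

lemma bij_betw_enum: "bij_betw (from_nat_into (UNIV :: 'n::finite set)) {..<CARD('n)} UNIV"
  by (rule bij_betw_from_nat_into_finite) simp

lemma sum_enum: "(\<Sum>i<CARD('n). f (from_nat_into (UNIV :: 'n::finite set) i)) = (\<Sum>j\<in>UNIV. f j)"
  by (rule sum.reindex_bij_betw[OF bij_betw_enum])

definition index_to :: "'n index \<Rightarrow> 'n::finite" where
  "index_to j = from_nat_into UNIV (Rep_index j)"

lemma bij_index_to: "bij index_to"
  using bij_betw_trans[OF bij_betw_Rep_index bij_betw_enum]
  by (simp add: comp_def index_to_def[abs_def])

definition reindex :: "real ^ 'n::finite \<Rightarrow> real ^ 'n index" where
  "reindex x = (\<chi> j. x $ index_to j)"

definition unindex :: "real ^ 'n index \<Rightarrow> real ^ 'n::finite" where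
  "unindex y = (\<chi> i. y $ inv index_to i)"

lemma reindex_unindex [simp]: "reindex (unindex y) = y" and unindex_reindex [simp]: "unindex (reindex x) = x"
  by (simp_all add: reindex_def unindex_def vec_eq_iff bij_is_inj[OF bij_index_to] bij_is_surj[OF bij_index_to] surj_f_inv_f)

lemma bounded_linear_reindex: "bounded_linear reindex" and bounded_linear_unindex: "bounded_linear unindex"
  by (auto intro!: linearI simp: linear_conv_bounded_linear[symmetric] reindex_def unindex_def vec_eq_iff)

lemma borel_measurable_unindex [measurable]: "unindex \<in> borel_measurable borel"
  by (intro borel_measurable_continuous_onI linear_continuous_on bounded_linear_unindex)

text \<open>Renaming coordinates maps boxes to boxes with the same side lengths, and boxes determine
  Lebesgue measure.\<close>

lemma distr_lborel_unindex: "distr lborel borel unindex = (lborel :: (real ^ 'n::finite) measure)"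
proof (rule lborel_eqI[symmetric])
  fix l u :: "real ^ 'n" assume "\<And>b. b \<in> Basis \<Longrightarrow> l \<bullet> b \<le> u \<bullet> b"
  then have lu: "l $ i \<le> u $ i" for i
    by (metis axis_in_Basis_iff cart_eq_inner_axis Basis_real_def insertI1)
  have prod: "(\<Prod>b\<in>(Basis :: (real ^ 'm::finite) set). (w - v) \<bullet> b) = (\<Prod>i\<in>UNIV. w $ i - v $ i)" for v w :: "real ^ 'm"
    by (subst prod.reindex_bij_betw[symmetric, where h = "\<lambda>i. axis i 1" and S = UNIV])
       (auto simp: bij_betw_def inj_on_def axis_eq_axis Basis_vec_def inner_axis)
  have "emeasure (distr lborel borel unindex) (box l u) = emeasure lborel (box (reindex l) (reindex u))"
    by (subst emeasure_distr)
       (auto intro!: arg_cong[where f = "emeasure lborel"] simp: mem_box_cart reindex_def unindex_def,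
        (metis bij_index_to bij_inv_eq_iff)+)
  also have "\<dots> = (\<Prod>b\<in>Basis. (reindex u - reindex l) \<bullet> b)"
    using lu by (intro emeasure_lborel_box) (auto simp: Basis_vec_def inner_axis reindex_def)
  also have "(\<Prod>b\<in>Basis. (reindex u - reindex l) \<bullet> b) = (\<Prod>b\<in>Basis. (u - l) \<bullet> b)"
    unfolding prod reindex_def vec_lambda_beta
    by (rule prod.reindex_bij_betw[OF bij_index_to, where g = "\<lambda>i. u $ i - l $ i"])
  finally show "emeasure (distr lborel borel unindex) (box l u) = ennreal (\<Prod>b\<in>Basis. (u - l) \<bullet> b)" .
qed simp

lemma emeasure_lborel_reindex:
  assumes "B \<in> sets borel"
  shows "emeasure lborel (unindex -` B) = emeasure lborel B"
  using emeasure_distr[of unindex lborel borel B] assms by (simp add: distr_lborel_unindex)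

text \<open>The determinant of \<open>D\<close> in the frame \<open>enum_axis\<close>, written with
  \<open>nat_det\<close> so that \<open>wedge_power_linear_image\<close> produces it
  directly.\<close>

definition jacobian :: "(real ^ 'n::finite \<Rightarrow> real ^ 'n) \<Rightarrow> real" where
  "jacobian D = nat_det CARD('n) (\<lambda>i j. D (enum_axis j) $ from_nat_into UNIV i)"

lemma det_conjugate:
  fixes D :: "real ^ 'n::finite \<Rightarrow> real ^ 'n"
  shows "det (matrix (reindex \<circ> D \<circ> unindex)) = jacobian D"
proof -
  have "unindex (axis j 1) = axis (index_to j) 1" for j :: "'n index"
    by (simp add: unindex_def axis_def vec_eq_iff) (metis bij_index_to bij_inv_eq_iff)
  then show ?thesis unfolding jacobian_def
    by (intro det_eq_nat_det[OF bij_betw_Rep_index])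
       (simp add: matrix_def reindex_def index_to_def enum_axis_def)
qed

lemma emeasure_differentiable_image:
  fixes g :: "real ^ 'n::finite \<Rightarrow> real ^ 'n"
  assumes S: "S \<in> sets borel" and g: "\<And>x. x \<in> S \<Longrightarrow> (g has_derivative g' x) (at x within S)"
    and inj: "inj_on g S" and gS: "g ` S \<in> sets borel" "bounded (g ` S)"
    and J: "(\<lambda>x. indicator S x * \<bar>jacobian (g' x)\<bar>) \<in> borel_measurable borel"
  shows "emeasure lborel (g ` S) = (\<integral>\<^sup>+x\<in>S. ennreal \<bar>jacobian (g' x)\<bar> \<partial>lborel)"
proof -
  let ?g = "reindex \<circ> g \<circ> unindex" and ?T = "reindex ` S"
  have T: "?T = unindex -` S" by (auto simp: image_iff) (metis reindex_unindex)
  have gT: "?g ` ?T = unindex -` (g ` S)" by (auto simp: image_iff) (metis reindex_unindex)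
  have "emeasure lborel (g ` S) = emeasure lborel (?g ` ?T)"
    unfolding gT using gS by (simp add: emeasure_lborel_reindex)
  also have "\<dots> = (\<integral>\<^sup>+x\<in>?T. ennreal \<bar>det (matrix (reindex \<circ> g' (unindex x) \<circ> unindex))\<bar> \<partial>lborel)"
  proof (rule emeasure_differentiable_image_wellorder)
    show "?T \<in> sets borel" unfolding T using measurable_sets[OF borel_measurable_unindex S] by simp
    show "?g ` ?T \<in> sets borel" unfolding gT using measurable_sets[OF borel_measurable_unindex gS(1)] by simp
    show "bounded (?g ` ?T)"
      using bounded_linear_image[OF gS(2) bounded_linear_reindex] by (simp add: image_comp comp_def)
    show "inj_on ?g ?T"
      using inj by (auto simp: inj_on_def) (metis unindex_reindex)
    fix y assume y: "y \<in> ?T"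
    then have "unindex y \<in> S" by auto
    from g[OF this] have "(g has_derivative g' (unindex y)) (at (unindex y) within unindex ` ?T)"
      by (simp add: image_comp comp_def)
    from diff_chain_within[OF bounded_linear_imp_has_derivative[OF bounded_linear_unindex] this]
    have "(g \<circ> unindex has_derivative g' (unindex y) \<circ> unindex) (at y within ?T)" .
    from diff_chain_within[OF this bounded_linear_imp_has_derivative[OF bounded_linear_reindex]]
    show "(?g has_derivative reindex \<circ> g' (unindex y) \<circ> unindex) (at y within ?T)"
      by (simp add: comp_assoc)
  qed
  also have "\<dots> = (\<integral>\<^sup>+y. ennreal (indicator S (unindex y) * \<bar>jacobian (g' (unindex y))\<bar>) \<partial>lborel)"
    unfolding det_conjugate T by (intro nn_integral_cong) (simp add: indicator_def)
  also have "\<dots> = (\<integral>\<^sup>+x. ennreal (indicator S x * \<bar>jacobian (g' x)\<bar>) \<partial>distr lborel borel unindex)"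
    using J by (subst nn_integral_distr) auto
  also have "\<dots> = (\<integral>\<^sup>+x\<in>S. ennreal \<bar>jacobian (g' x)\<bar> \<partial>lborel)"
    unfolding distr_lborel_unindex by (intro nn_integral_cong) (simp add: indicator_def)
  finally show ?thesis .
qed

text \<open>Both sides integrate \<open>f\<close>, against the push-forward of the weighted Lebesgue
  measure on \<open>K\<close> and against Lebesgue measure on the image of \<open>K\<close>. These
  two measures agree on Borel sets by \<open>emeasure_differentiable_image\<close>.\<close>

lemma nn_integral_differentiable_image:
  fixes g :: "real ^ 'n::finite \<Rightarrow> real ^ 'n"
  assumes K: "compact K" and g: "\<And>x. x \<in> K \<Longrightarrow> (g has_derivative g' x) (at x within K)"
    and inj: "inj_on g K"
    and J: "(\<lambda>x. indicator K x * \<bar>jacobian (g' x)\<bar>) \<in> borel_measurable borel"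
    and f: "f \<in> borel_measurable borel"
  shows "(\<integral>\<^sup>+x\<in>K. f (g x) * ennreal \<bar>jacobian (g' x)\<bar> \<partial>lborel) = (\<integral>\<^sup>+y\<in>g ` K. f y \<partial>lborel)"
proof -
  have cont: "continuous_on K g" using g by (rule has_derivative_continuous_on)
  have gK: "compact (g ` K)" using cont K by (rule compact_continuous_image)
  \<comment> \<open>The value 0 outside \<open>K\<close> only makes the map Borel on the whole
    space; the density of \<open>M\<close> vanishes there.\<close>
  define h where "h = (\<lambda>x. if x \<in> K then g x else 0)"
  have [measurable]: "K \<in> sets borel" "g ` K \<in> sets borel" using K gK by (auto simp: borel_compact)
  have h[measurable]: "h \<in> borel_measurable borel"
    unfolding h_def using cont by (rule borel_measurable_continuous_on_if[OF \<open>K \<in> sets borel\<close> _ continuous_on_const])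
  note J[measurable] f[measurable]
  define M where "M = density lborel (\<lambda>x. ennreal (indicator K x * \<bar>jacobian (g' x)\<bar>))"
  have eq: "distr M borel h = density lborel (indicator (g ` K))"
  proof (rule measure_eqI)
    fix B assume "B \<in> sets (distr M borel h)"
    then have [measurable]: "B \<in> sets borel" by simp
    have [measurable]: "h -` B \<in> sets borel" using measurable_sets[OF h, of B] by simp
    let ?S = "K \<inter> h -` B"
    have gS: "g ` ?S = g ` K \<inter> B" by (auto simp: h_def)
    have sub: "?S \<subseteq> K" by auto
    have "emeasure (distr M borel h) B = emeasure M (h -` B)"
      by (subst emeasure_distr) (auto simp: M_def)
    also have "\<dots> = (\<integral>\<^sup>+x. ennreal (indicator K x * \<bar>jacobian (g' x)\<bar>) * indicator (h -` B) x \<partial>lborel)"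
      unfolding M_def by (rule emeasure_density) auto
    also have "\<dots> = (\<integral>\<^sup>+x\<in>?S. ennreal \<bar>jacobian (g' x)\<bar> \<partial>lborel)"
      by (intro nn_integral_cong) (auto simp: indicator_def)
    also have "\<dots> = emeasure lborel (g ` ?S)"
    proof (rule emeasure_differentiable_image[symmetric])
      show "(g has_derivative g' x) (at x within ?S)" if "x \<in> ?S" for x
        using g that has_derivative_subset[OF _ sub] by blast
      show "inj_on g ?S" using inj sub by (rule inj_on_subset)
      show "bounded (g ` ?S)" using gK sub by (meson bounded_subset compact_imp_bounded image_mono)
      have "(\<lambda>x. indicator ?S x * \<bar>jacobian (g' x)\<bar>) = (\<lambda>x. indicator (h -` B) x * (indicator K x * \<bar>jacobian (g' x)\<bar>))"
        by (auto simp: indicator_def)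
      then show "(\<lambda>x. indicator ?S x * \<bar>jacobian (g' x)\<bar>) \<in> borel_measurable borel" by simp
      show "g ` ?S \<in> sets borel" unfolding gS by measurable
    qed measurable
    also have "\<dots> = (\<integral>\<^sup>+y. indicator (g ` K \<inter> B) y \<partial>lborel)"
      unfolding gS by (rule nn_integral_indicator[symmetric]) simp
    also have "\<dots> = emeasure (density lborel (indicator (g ` K))) B"
      unfolding indicator_inter_arith by (rule emeasure_density[symmetric]) auto
    finally show "emeasure (distr M borel h) B = emeasure (density lborel (indicator (g ` K))) B" .
  qed simp
  have "(\<integral>\<^sup>+y. f y \<partial>distr M borel h) = (\<integral>\<^sup>+x. f (h x) \<partial>M)"
    by (rule nn_integral_distr) (auto simp: M_def)
  also have "\<dots> = (\<integral>\<^sup>+x. ennreal (indicator K x * \<bar>jacobian (g' x)\<bar>) * f (h x) \<partial>lborel)"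
    unfolding M_def by (rule nn_integral_density) auto
  also have "\<dots> = (\<integral>\<^sup>+x\<in>K. f (g x) * ennreal \<bar>jacobian (g' x)\<bar> \<partial>lborel)"
    by (intro nn_integral_cong) (auto simp: indicator_def h_def mult.commute)
  finally show ?thesis
    unfolding eq by (subst (asm) nn_integral_density) (auto simp: mult.commute)
qed

section \<open>The Euler scheme\<close>

text \<open>Curves start within \<open>R\<close> of the centre and are followed while they move by
  at most another \<open>R\<close>, whence the ball of radius \<open>2 * R\<close>.
  \<open>distortion\<close> is Liouville's theorem to first order: one step loses at most
  \<open>\<epsilon> * s\<close> of the density, uniformly.\<close>

locale euler_scheme =
  fixes x\<^sub>0 :: "real ^ 'n::finite" and R M L :: real and X X' and \<rho> :: "real ^ 'n \<Rightarrow> real"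
  assumes R_pos: "R > 0" and M_pos: "M > 0" and L_pos: "L > 0"
    and X_bound: "\<And>x. x \<in> cball x\<^sub>0 (2 * R) \<Longrightarrow> norm (X x) \<le> M"
    and X_lipschitz: "\<And>x y. x \<in> cball x\<^sub>0 (2 * R) \<Longrightarrow> y \<in> cball x\<^sub>0 (2 * R) \<Longrightarrow> norm (X x - X y) \<le> L * norm (x - y)"
    and X_deriv: "\<And>x. x \<in> cball x\<^sub>0 (2 * R) \<Longrightarrow> (X has_derivative X' x) (at x)"
    and X'_cont: "\<And>v. continuous_on (cball x\<^sub>0 (2 * R)) (\<lambda>x. X' x v)"
    and \<rho>_cont: "continuous_on (cball x\<^sub>0 (2 * R)) \<rho>"
    and \<rho>_nonneg: "\<And>x. \<rho> x \<ge> 0"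
    and distortion: "\<And>\<epsilon>. \<epsilon> > 0 \<Longrightarrow> \<exists>\<delta>>0. \<forall>s. 0 < s \<longrightarrow> s < \<delta> \<longrightarrow> (\<forall>x\<in>cball x\<^sub>0 (2 * R).
        \<rho> x \<le> \<bar>jacobian (\<lambda>v. v + s *\<^sub>R X' x v)\<bar> * \<rho> (x + s *\<^sub>R X x) + \<epsilon> * s)"
begin

abbreviation "K \<equiv> cball x\<^sub>0 (2 * R)"

text \<open>Points outside \<open>K\<close> stay put, which makes the map Borel on the whole
  space.\<close>

definition euler :: "real \<Rightarrow> real ^ 'n \<Rightarrow> real ^ 'n" where
  "euler s x = x + s *\<^sub>R (if x \<in> K then X x else 0)"

text \<open>The Liouville measure in coordinates, cut off to \<open>K\<close>; being finite, it is
  outer regular, which \<open>solution_measure\<close> uses.\<close>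

definition \<mu> :: "(real ^ 'n) measure" where
  "\<mu> = density lborel (\<lambda>x. ennreal (indicator K x * \<rho> x))"

lemma X_cont: "continuous_on K X"
  by (rule has_derivative_continuous_on[OF has_derivative_at_withinI[OF X_deriv]])

lemma measurable_euler [measurable]: "euler s \<in> borel_measurable borel"
proof -
  have "(\<lambda>x. if x \<in> K then X x else 0) \<in> borel_measurable borel"
    by (rule borel_measurable_continuous_on_if) (auto intro: X_cont continuous_on_const)
  then show ?thesis unfolding euler_def by measurable
qed

lemma measurable_euler_pow [measurable]: "(euler s ^^ n) \<in> borel_measurable borel"
  by (induction n) (auto simp: id_def)

lemma measurable_density [measurable]: "(\<lambda>x. indicator K x * \<rho> x) \<in> borel_measurable borel"
  using borel_measurable_continuous_on_indicator[OF _ \<rho>_cont] by simp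

lemma sets_\<mu> [simp, measurable_cong]: "sets \<mu> = sets borel" and space_\<mu> [simp]: "space \<mu> = UNIV"
  by (simp_all add: \<mu>_def)

lemma emeasure_\<mu>:
  assumes "B \<in> sets borel"
  shows "emeasure \<mu> B = (\<integral>\<^sup>+x\<in>B \<inter> K. ennreal (\<rho> x) \<partial>lborel)"
proof -
  have "emeasure \<mu> B = (\<integral>\<^sup>+x\<in>B. ennreal (indicator K x * \<rho> x) \<partial>lborel)"
    using assms unfolding \<mu>_def by (intro emeasure_density) simp_all
  also have "\<dots> = (\<integral>\<^sup>+x\<in>B \<inter> K. ennreal (\<rho> x) \<partial>lborel)"
    by (intro nn_integral_cong) (auto simp: indicator_def)
  finally show ?thesis .
qed

lemma finite_\<mu>: "finite_measure \<mu>"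
proof
  obtain C where C: "\<And>x. x \<in> K \<Longrightarrow> \<rho> x \<le> C"
    using compact_continuous_image[OF \<rho>_cont compact_cball, THEN compact_imp_bounded]
    unfolding bounded_iff by (metis abs_le_D1 image_eqI real_norm_def)
  have "emeasure \<mu> (space \<mu>) \<le> (\<integral>\<^sup>+x. ennreal C * indicator K x \<partial>lborel)"
    by (subst emeasure_\<mu>) (auto intro!: nn_integral_mono simp: indicator_def C ennreal_leI)
  also have "\<dots> = ennreal C * emeasure lborel K" by (subst nn_integral_cmult_indicator) auto
  also have "\<dots> < \<infinity>" using emeasure_lborel_cball_finite[of x\<^sub>0 "2 * R"] by (simp add: ennreal_mult_less_top del: mem_cball)
  finally show "emeasure \<mu> (space \<mu>) \<noteq> \<infinity>" by simp
qed

section \<open>Transport of measure by Euler steps\<close>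

lemma euler_step_le: "x \<in> K \<Longrightarrow> s \<ge> 0 \<Longrightarrow> dist x\<^sub>0 (euler s x) \<le> dist x\<^sub>0 x + s * M"
proof -
  assume "x \<in> K" "s \<ge> 0"
  then have "dist x (euler s x) \<le> s * M"
    using X_bound[of x] by (simp add: euler_def dist_norm mult_left_mono)
  then show ?thesis using dist_triangle[of x\<^sub>0 "euler s x" x] by linarith
qed

lemma euler_pow_dist:
  assumes "s \<ge> 0" "dist x\<^sub>0 x + real j * (s * M) \<le> 2 * R"
  shows "dist x\<^sub>0 ((euler s ^^ j) x) \<le> dist x\<^sub>0 x + real j * (s * M)"
  using assms(2)
proof (induction j)
  case (Suc j)
  have "0 \<le> s * M" using assms(1) M_pos by simp
  then have *: "real j * (s * M) \<le> real (Suc j) * (s * M)" by (intro mult_right_mono) auto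
  with Suc have "dist x\<^sub>0 ((euler s ^^ j) x) \<le> dist x\<^sub>0 x + real j * (s * M)" by linarith
  moreover have "(euler s ^^ j) x \<in> K" using calculation * Suc.prems by simp
  ultimately show ?case using euler_step_le[OF _ assms(1)] by (fastforce simp: algebra_simps)
qed simp

text \<open>The distance of two points with the same image is \<open>s\<close> times the distance of
  their field values, which is too small if \<open>s * L < 1\<close>.\<close>

lemma inj_euler:
  assumes "0 < s" "s * L < 1"
  shows "inj_on (euler s) K"
proof (rule inj_onI, rule ccontr)
  fix x y assume xy: "x \<in> K" "y \<in> K" "euler s x = euler s y" "x \<noteq> y"
  then have "x - y = s *\<^sub>R (X y - X x)" by (simp add: euler_def algebra_simps)
  then have "norm (x - y) = s * norm (X y - X x)" using assms(1) by (metis abs_of_pos norm_scaleR)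
  also have "\<dots> \<le> s * (L * norm (x - y))"
    using X_lipschitz[OF xy(2,1)] assms(1) by (simp add: norm_minus_commute mult_left_mono)
  finally have "norm (x - y) * (1 - s * L) \<le> 0" by (simp add: algebra_simps)
  then show False using assms xy(4) by (simp add: mult_le_0_iff)
qed

text \<open>The density is at most the pulled-back density plus \<open>\<epsilon> * s\<close>. After
  the change of variables the first part is an integral over the image, which lies in the ball
  enlarged by the step length bound \<open>s * M\<close>.\<close>

lemma euler_step_measure:
  assumes s: "0 < s" "s * L < 1" and a: "a + s * M \<le> 2 * R" and \<epsilon>: "\<epsilon> \<ge> 0"
    and dist: "\<And>x. x \<in> K \<Longrightarrow> \<rho> x \<le> \<bar>jacobian (\<lambda>v. v + s *\<^sub>R X' x v)\<bar> * \<rho> (x + s *\<^sub>R X x) + \<epsilon> * s"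
    and B [measurable]: "B \<in> sets borel"
  shows "emeasure \<mu> (cball x\<^sub>0 a \<inter> euler s -` B) \<le> emeasure \<mu> (cball x\<^sub>0 (a + s * M) \<inter> B) + ennreal (\<epsilon> * s) * emeasure lborel K"
proof -
  let ?a = "cball x\<^sub>0 a" and ?J = "\<lambda>x. \<bar>jacobian (\<lambda>v. v + s *\<^sub>R X' x v)\<bar>"
  have sM: "s * M > 0" using s M_pos by simp
  have aK: "?a \<subseteq> K" using a sM by auto
  have [measurable]: "euler s -` B \<in> sets borel"
    using measurable_sets[OF measurable_euler B] by simp
  let ?f = "\<lambda>y. indicator B y * ennreal (indicator K y * \<rho> y)"
  have into: "euler s x \<in> cball x\<^sub>0 (a + s * M)" if "x \<in> ?a" for x
    using euler_step_le[of x s] that aK s by fastforce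
  have "continuous_on ?a (\<lambda>x. ?J x)"
    unfolding jacobian_def nat_det_def
    by (intro continuous_intros continuous_on_subset[OF X'_cont aK])
  then have J: "(\<lambda>x. indicator ?a x * ?J x) \<in> borel_measurable borel"
    using borel_measurable_continuous_on_indicator[of ?a ?J] by simp
  have "emeasure \<mu> (?a \<inter> euler s -` B) = (\<integral>\<^sup>+x\<in>?a. indicator B (euler s x) * ennreal (\<rho> x) \<partial>lborel)"
    using aK by (subst emeasure_\<mu>) (auto intro!: nn_integral_cong simp: indicator_def)
  also have "\<dots> \<le> (\<integral>\<^sup>+x. ?f (euler s x) * ennreal (?J x) * indicator ?a x + ennreal (\<epsilon> * s) * indicator ?a x \<partial>lborel)"
  proof (intro nn_integral_mono)
    fix x
    show "indicator B (euler s x) * ennreal (\<rho> x) * indicator ?a x \<le>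
      ?f (euler s x) * ennreal (?J x) * indicator ?a x + ennreal (\<epsilon> * s) * indicator ?a x"
    proof (cases "x \<in> ?a \<and> euler s x \<in> B")
      case True
      then have xK: "x \<in> K" using aK by auto
      have "euler s x \<in> K" using into[of x] True a by auto
      moreover have "ennreal (\<rho> x) \<le> ennreal (\<rho> (euler s x)) * ennreal (?J x) + ennreal (\<epsilon> * s)"
        using dist[OF xK] xK \<epsilon> s \<rho>_nonneg
        by (simp add: euler_def mult.commute flip: ennreal_mult ennreal_plus)
      ultimately show ?thesis using True by simp
    qed (auto simp: indicator_def)
  qed
  also have "\<dots> = (\<integral>\<^sup>+x\<in>?a. ?f (euler s x) * ennreal (?J x) \<partial>lborel) + ennreal (\<epsilon> * s) * emeasure lborel ?a"
  proof (subst nn_integral_add)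
    have "(\<lambda>x. ?f (euler s x) * ennreal (indicator ?a x * ?J x)) \<in> borel_measurable lborel"
      using J by measurable
    also have "(\<lambda>x. ?f (euler s x) * ennreal (indicator ?a x * ?J x)) = (\<lambda>x. ?f (euler s x) * ennreal (?J x) * indicator ?a x)"
      by (auto simp: indicator_def)
    finally show "(\<lambda>x. ?f (euler s x) * ennreal (?J x) * indicator ?a x) \<in> borel_measurable lborel" .
    show "(\<lambda>x. ennreal (\<epsilon> * s) * indicator ?a x) \<in> borel_measurable lborel"
      by (intro borel_measurable_times_ennreal borel_measurable_const borel_measurable_indicator) simp
  qed (simp only: nn_integral_cmult_indicator sets_lborel borel_closed closed_cball)
  also have "(\<integral>\<^sup>+x\<in>?a. ?f (euler s x) * ennreal (?J x) \<partial>lborel) = (\<integral>\<^sup>+y\<in>euler s ` ?a. ?f y \<partial>lborel)"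
  proof (rule nn_integral_differentiable_image[OF compact_cball _ _ J])
    show "inj_on (euler s) ?a" using inj_on_subset[OF inj_euler[OF s] aK] .
    fix x assume x: "x \<in> ?a"
    have "((\<lambda>x. x + s *\<^sub>R X x) has_derivative (\<lambda>v. v + s *\<^sub>R X' x v)) (at x within ?a)"
      by (rule has_derivative_add[OF has_derivative_ident
            has_derivative_scaleR_right[OF has_derivative_at_withinI[OF X_deriv[OF subsetD[OF aK x]]]]])
    then show "(euler s has_derivative (\<lambda>v. v + s *\<^sub>R X' x v)) (at x within ?a)"
      by (rule has_derivative_transform[rotated -1]) (use x aK in \<open>auto simp: euler_def\<close>)
  qed measurable
  also have "\<dots> \<le> emeasure \<mu> (cball x\<^sub>0 (a + s * M) \<inter> B)"
    using into by (subst emeasure_\<mu>) (auto intro!: nn_integral_mono simp: indicator_def)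
  finally have *: "emeasure \<mu> (?a \<inter> euler s -` B) \<le>
    emeasure \<mu> (cball x\<^sub>0 (a + s * M) \<inter> B) + ennreal (\<epsilon> * s) * emeasure lborel ?a"
    by (simp add: add_right_mono)
  have "emeasure lborel ?a \<le> emeasure lborel K" by (rule emeasure_mono[OF aK]) simp
  then show ?thesis by (intro order_trans[OF *] add_left_mono mult_left_mono) auto
qed

text \<open>The first of the \<open>Suc j\<close> steps is split off, so the induction hypothesis is
  used at the larger radius \<open>a + s * M\<close>. The errors add up to a multiple of
  \<open>j * s\<close>, which stays bounded as the steps get finer.\<close>

lemma euler_pow_measure:
  assumes s: "0 < s" "s * L < 1" and a: "a + real j * (s * M) \<le> 2 * R" and \<epsilon>: "\<epsilon> \<ge> 0"
    and dist: "\<And>x. x \<in> K \<Longrightarrow> \<rho> x \<le> \<bar>jacobian (\<lambda>v. v + s *\<^sub>R X' x v)\<bar> * \<rho> (x + s *\<^sub>R X x) + \<epsilon> * s"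
    and B [measurable]: "B \<in> sets borel"
  shows "emeasure \<mu> (cball x\<^sub>0 a \<inter> (euler s ^^ j) -` B) \<le> emeasure \<mu> (cball x\<^sub>0 (a + real j * (s * M)) \<inter> B) + ennreal (real j * (\<epsilon> * s)) * emeasure lborel K"
  using a
proof (induction j arbitrary: a)
  case (Suc j)
  let ?B = "(euler s ^^ j) -` B"
  have B': "?B \<in> sets borel" using measurable_sets[OF measurable_euler_pow B] by simp
  have sM: "s * M > 0" using s M_pos by simp
  have eq: "a + s * M + real j * (s * M) = a + real (Suc j) * (s * M)" by (simp add: algebra_simps)
  have "0 \<le> real j * (s * M)" using sM by simp
  then have "a + s * M \<le> 2 * R" using Suc.prems unfolding eq[symmetric] by linarith
  then have "emeasure \<mu> (cball x\<^sub>0 a \<inter> euler s -` ?B) \<le> emeasure \<mu> (cball x\<^sub>0 (a + s * M) \<inter> ?B) + ennreal (\<epsilon> * s) * emeasure lborel K"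
    by (rule euler_step_measure[OF s _ \<epsilon> dist B'])
  also have "\<dots> \<le> (emeasure \<mu> (cball x\<^sub>0 (a + real (Suc j) * (s * M)) \<inter> B) + ennreal (real j * (\<epsilon> * s)) * emeasure lborel K) + ennreal (\<epsilon> * s) * emeasure lborel K"
    using Suc.IH[of "a + s * M"] Suc.prems unfolding eq by (intro add_right_mono) simp
  also have "\<dots> =
     emeasure \<mu> (cball x\<^sub>0 (a + real (Suc j) * (s * M)) \<inter> B) + ennreal (real (Suc j) * (\<epsilon> * s)) * emeasure lborel K"
  proof -
    have "ennreal (real (Suc j) * (\<epsilon> * s)) = ennreal (real j * (\<epsilon> * s)) + ennreal (\<epsilon> * s)"
      using \<epsilon> s by (subst ennreal_plus[symmetric]) (auto simp: algebra_simps)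
    then show ?thesis by (simp only: distrib_right add.assoc)
  qed
  finally show ?case by (simp only: vimage_comp funpow_Suc_right)
qed simp

section \<open>Convergence of the scheme to solutions\<close>

definition solution :: "real \<Rightarrow> (real \<Rightarrow> real ^ 'n) \<Rightarrow> bool" where
  "solution T y \<longleftrightarrow> (\<forall>t\<in>{0..T}. y t \<in> K \<and> (y has_vector_derivative X (y t)) (at t within {0..T}))"

lemma solution_dist:
  assumes y: "solution T y" and t: "t \<in> {0..T}" "u \<in> {0..T}"
  shows "norm (y t - y u) \<le> M * \<bar>t - u\<bar>"
proof -
  have "norm (y t - y u) \<le> M * norm (t - u)"
  proof (rule differentiable_bound[OF convex_real_interval(5)[of 0 T] _ _ t])
    fix z assume z: "z \<in> {0..T}"
    show "(y has_derivative (\<lambda>h. h *\<^sub>R X (y z))) (at z within {0..T})"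
      using y z by (simp add: solution_def has_vector_derivative_def)
    show "onorm (\<lambda>h. h *\<^sub>R X (y z)) \<le> M"
      using X_bound[of "y z"] y z M_pos by (intro onorm_le) (auto simp: solution_def mult.commute[of M] mult_left_mono)
  qed
  then show ?thesis by simp
qed

text \<open>The local truncation error: within time \<open>s\<close> the solution moves by at most
  \<open>M * s\<close>, so its velocity changes by at most \<open>L * M * s\<close>.\<close>

lemma solution_step:
  assumes y: "solution T y" and t: "0 \<le> t" "0 \<le> s" "t + s \<le> T"
  shows "norm (y (t + s) - (y t + s *\<^sub>R X (y t))) \<le> L * M * s\<^sup>2"
proof -
  have ytK: "y t \<in> K" using y t by (auto simp: solution_def)
  have "norm (y (t + s) - y t - ((t + s) - t) *\<^sub>R X (y t)) \<le> norm ((t + s) - t) * (L * M * s)"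
  proof (rule differentiable_bound_linearization[where S = "{t..t + s}" and f' = "\<lambda>z h. h *\<^sub>R X (y z)" and a = t and b = "t + s" and ?x0.0 = t])
    fix z assume "z \<in> {t..t + s}"
    then have z: "z \<in> {0..T}" "\<bar>z - t\<bar> \<le> s" using t by auto
    show "(y has_derivative (\<lambda>h. h *\<^sub>R X (y z))) (at z within {t..t + s})"
      by (rule has_derivative_subset[of y _ z "{0..T}"]) (use y z t in \<open>auto simp: solution_def has_vector_derivative_def\<close>)
    have "norm (X (y z) - X (y t)) \<le> L * norm (y z - y t)"
      using y z ytK by (intro X_lipschitz) (auto simp: solution_def)
    also have "\<dots> \<le> L * (M * s)"
      using solution_dist[OF y z(1), of t] z t L_pos M_pos
      by (intro mult_left_mono order_trans[OF solution_dist[OF y z(1), of t]]) auto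
    finally have *: "norm (X (y z) - X (y t)) \<le> L * M * s" by simp
    show "onorm ((\<lambda>h. h *\<^sub>R X (y z)) - (\<lambda>h. h *\<^sub>R X (y t))) \<le> L * M * s"
      by (rule onorm_le) (use * in \<open>auto simp: mult.commute[of _ "\<bar>_\<bar>"] mult_left_mono simp flip: scaleR_diff_right\<close>)
  qed (use t in \<open>auto simp: mult_left_le_one_le\<close>)
  then show ?thesis using t by (simp add: power2_eq_square mult_ac algebra_simps)
qed

lemma euler_lipschitz:
  assumes "x \<in> K" "y \<in> K" "s \<ge> 0"
  shows "norm (euler s x - euler s y) \<le> (1 + s * L) * norm (x - y)"
proof -
  have "norm (euler s x - euler s y) = norm ((x - y) + s *\<^sub>R (X x - X y))"
    using assms by (simp add: euler_def algebra_simps)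
  also have "\<dots> \<le> norm (x - y) + s * norm (X x - X y)"
    using norm_triangle_ineq[of "x - y" "s *\<^sub>R (X x - X y)"] assms(3) by simp
  also have "\<dots> \<le> norm (x - y) + s * (L * norm (x - y))"
    using X_lipschitz[OF assms(1,2)] assms(3) by (simp add: mult_left_mono)
  finally show ?thesis by (simp add: algebra_simps)
qed

text \<open>Each step adds the truncation error of \<open>solution_step\<close> and stretches the
  earlier error by at most \<open>1 + s * L\<close>. The bound replaces the resulting geometric sum
  by \<open>j\<close> times its largest possible term.\<close>

lemma euler_error:
  assumes y: "solution T y" and y0: "y 0 \<in> cball x\<^sub>0 R" and TM: "T * M \<le> R" and s: "0 \<le> s" and j: "real j * s \<le> T"
  shows "norm ((euler s ^^ j) (y 0) - y (real j * s)) \<le> real j * (L * M * s\<^sup>2) * (1 + s * L) ^ j"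
  using j
proof (induction j)
  case (Suc j)
  have le: "real j * s \<le> T" "real j * s + s \<le> T" using Suc.prems s by (auto simp: algebra_simps)
  have yK: "y (real j * s) \<in> K" using y le s by (auto simp: solution_def)
  have "real j * (s * M) \<le> T * M" using le M_pos by (simp add: mult.assoc[symmetric] mult_right_mono)
  then have b: "dist x\<^sub>0 (y 0) + real j * (s * M) \<le> 2 * R" using y0 TM by simp
  have eK: "(euler s ^^ j) (y 0) \<in> K" using euler_pow_dist[OF s b] b by simp
  let ?e = "(euler s ^^ j) (y 0)" and ?y = "y (real j * s)" and ?c = "1 + s * L"
  have c: "?c \<ge> 1" using s L_pos by simp
  have LM: "L * M * s\<^sup>2 \<ge> 0" using L_pos M_pos by simp
  have tri: "norm (euler s ?e - y (real j * s + s)) \<le> norm (euler s ?e - euler s ?y) + norm (y (real j * s + s) - euler s ?y)"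
    using norm_triangle_ineq4[of "euler s ?e - euler s ?y" "y (real j * s + s) - euler s ?y"] by simp
  have "norm (euler s ?e - euler s ?y) \<le> ?c * norm (?e - ?y)"
    by (rule euler_lipschitz[OF eK yK s])
  also have "\<dots> \<le> ?c * (real j * (L * M * s\<^sup>2) * ?c ^ j)"
    using Suc.IH le c by (intro mult_left_mono) auto
  also have "\<dots> = real j * (L * M * s\<^sup>2) * ?c ^ Suc j" by simp
  finally have 1: "norm (euler s ?e - euler s ?y) \<le> real j * (L * M * s\<^sup>2) * ?c ^ Suc j" .
  have "norm (y (real j * s + s) - euler s ?y) \<le> L * M * s\<^sup>2"
    using solution_step[OF y _ s le(2)] s yK by (simp add: euler_def)
  also have "\<dots> \<le> L * M * s\<^sup>2 * ?c ^ Suc j" using c LM by (simp add: mult_le_cancel_left1 one_le_power del: power_Suc)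
  finally have 2: "norm (y (real j * s + s) - euler s ?y) \<le> L * M * s\<^sup>2 * ?c ^ Suc j" .
  have eq: "real (Suc j) * s = real j * s + s" by (simp add: algebra_simps)
  have "real (Suc j) * (L * M * s\<^sup>2) * ?c ^ Suc j = real j * (L * M * s\<^sup>2) * ?c ^ Suc j + L * M * s\<^sup>2 * ?c ^ Suc j"
    by (simp only: of_nat_Suc distrib_right mult_1 add.commute)
  then show ?case using tri 1 2 unfolding eq funpow.simps comp_apply by linarith
qed simp

lemma one_plus_div_power_le: "(1 + c / real n) ^ n \<le> exp c" if "c \<ge> 0" "n > 0"
proof -
  have "(1 + c / real n) ^ n \<le> exp (c / real n) ^ n" using that by (intro power_mono) auto
  also have "\<dots> = exp c" using that by (simp flip: exp_of_nat_mult)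
  finally show ?thesis .
qed

text \<open>With \<open>n\<close> steps of length \<open>T / n\<close> the truncation errors add up
  to order \<open>1 / n\<close>, and the amplification stays below
  \<open>exp (T * L)\<close>.\<close>

lemma euler_tendsto:
  assumes y: "solution T y" and y0: "y 0 \<in> cball x\<^sub>0 R" and TM: "T * M \<le> R" and T: "T \<ge> 0"
  shows "(\<lambda>n. (euler (T / real n) ^^ n) (y 0)) \<longlonglongrightarrow> y T"
proof (rule Lim_null_comparison[where g = "\<lambda>n. L * M * T\<^sup>2 * exp (T * L) / real n", THEN LIM_zero_cancel])
  have "norm ((euler (T / real n) ^^ n) (y 0) - y T) \<le> L * M * T\<^sup>2 * exp (T * L) / real n" if n: "n > 0" for n
  proof -
    have "norm ((euler (T / real n) ^^ n) (y 0) - y (real n * (T / real n))) \<le>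
        real n * (L * M * (T / real n)\<^sup>2) * (1 + T / real n * L) ^ n"
      by (rule euler_error[OF y y0 TM]) (use T n in auto)
    also have "\<dots> \<le> real n * (L * M * (T / real n)\<^sup>2) * exp (T * L)"
      using one_plus_div_power_le[of "T * L" n] T n L_pos M_pos by (intro mult_left_mono) auto
    also have "\<dots> = L * M * T\<^sup>2 * exp (T * L) / real n" using n by (simp add: power2_eq_square)
    finally show ?thesis using n by simp
  qed
  then show "\<forall>\<^sub>F n in sequentially. norm ((euler (T / real n) ^^ n) (y 0) - y T) \<le> L * M * T\<^sup>2 * exp (T * L) / real n"
    by (intro eventually_mono[OF eventually_gt_at_top[of 0]])
qed real_asymp

text \<open>Both solutions are limits of the same Euler iterates.\<close>

lemma solution_unique:
  assumes "solution T y" "solution T z" "y 0 = z 0" "y 0 \<in> cball x\<^sub>0 R" "T * M \<le> R" "T \<ge> 0"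
  shows "y T = z T"
  using euler_tendsto[of T y] euler_tendsto[of T z] assms LIMSEQ_unique by fastforce

text \<open>Gronwall's estimate without a differential inequality: the iterates of two starting
  points separate at most by the factor \<open>(1 + s * L) ^ n\<close>, and this bound passes to the
  limit.\<close>

lemma solution_lipschitz:
  assumes "solution T y" "solution T z" "y 0 \<in> cball x\<^sub>0 R" "z 0 \<in> cball x\<^sub>0 R" "T * M \<le> R" "T \<ge> 0"
  shows "norm (y T - z T) \<le> exp (T * L) * norm (y 0 - z 0)"
proof (rule tendsto_upperbound)
  show "(\<lambda>n. norm ((euler (T / real n) ^^ n) (y 0) - (euler (T / real n) ^^ n) (z 0))) \<longlonglongrightarrow> norm (y T - z T)"
    using assms by (intro tendsto_intros euler_tendsto)
  have "norm ((euler (T / real n) ^^ n) (y 0) - (euler (T / real n) ^^ n) (z 0)) \<le> exp (T * L) * norm (y 0 - z 0)" if n: "n > 0" for n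
  proof -
    define s where "s = T / real n"
    have s: "s \<ge> 0" using assms by (simp add: s_def)
    have "norm ((euler s ^^ j) (y 0) - (euler s ^^ j) (z 0)) \<le> (1 + s * L) ^ j * norm (y 0 - z 0)" if "j \<le> n" for j
      using that
    proof (induction j)
      case (Suc j)
      have "real j * (s * M) \<le> real n * (s * M)" using Suc.prems s M_pos by (intro mult_right_mono) auto
      also have "\<dots> = T * M" using n by (simp add: s_def)
      finally have *: "real j * (s * M) \<le> R" using assms by linarith
      have K: "(euler s ^^ j) (y 0) \<in> K" "(euler s ^^ j) (z 0) \<in> K"
        using euler_pow_dist[OF s, of "y 0" j] euler_pow_dist[OF s, of "z 0" j] * assms by auto
      have "norm ((euler s ^^ Suc j) (y 0) - (euler s ^^ Suc j) (z 0)) \<le> (1 + s * L) * norm ((euler s ^^ j) (y 0) - (euler s ^^ j) (z 0))"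
        using euler_lipschitz[OF K s] by simp
      also have "\<dots> \<le> (1 + s * L) * ((1 + s * L) ^ j * norm (y 0 - z 0))"
        using Suc s L_pos by (intro mult_left_mono) auto
      finally show ?case by (simp add: mult.assoc)
    qed simp
    from this[of n] have "norm ((euler s ^^ n) (y 0) - (euler s ^^ n) (z 0)) \<le> (1 + s * L) ^ n * norm (y 0 - z 0)" by simp
    also have "\<dots> \<le> exp (T * L) * norm (y 0 - z 0)"
      using one_plus_div_power_le[of "T * L" n] n assms L_pos by (intro mult_right_mono) (auto simp: s_def)
    finally show ?thesis unfolding s_def .
  qed
  then show "\<forall>\<^sub>F n in sequentially. norm ((euler (T / real n) ^^ n) (y 0) - (euler (T / real n) ^^ n) (z 0)) \<le> exp (T * L) * norm (y 0 - z 0)"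
    by (intro eventually_mono[OF eventually_gt_at_top[of 0]])
qed simp

lemma solution_subinterval: "solution T y \<Longrightarrow> t \<le> T \<Longrightarrow> solution t y"
  unfolding solution_def
  by (intro ballI conjI; (rule has_vector_derivative_within_subset[of y _ _ "{0..T}"])?) auto

section \<open>Continuity of the solution map and its effect on the measure\<close>

lemma solution_continuous:
  assumes y: "\<And>x. x \<in> ball x\<^sub>0 R \<Longrightarrow> solution T (y x) \<and> y x 0 = x" and TM: "T * M \<le> R" and T: "T \<ge> 0"
  shows "continuous_on (ball x\<^sub>0 R \<times> {0..T}) (\<lambda>(x, t). y x t)"
proof (rule lipschitz_on_continuous_on, rule lipschitz_onI)
  fix p q assume pq: "p \<in> ball x\<^sub>0 R \<times> {0..T}" "q \<in> ball x\<^sub>0 R \<times> {0..T}"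
  obtain x t x' t' where p: "p = (x, t)" and q: "q = (x', t')" by (cases p, cases q)
  have t: "t \<in> {0..T}" "t' \<in> {0..T}" and x: "x \<in> ball x\<^sub>0 R" "x' \<in> ball x\<^sub>0 R" using pq by (auto simp: p q)
  have "t * M \<le> T * M" using t M_pos by (intro mult_right_mono) auto
  moreover have "solution t (y x)" "solution t (y x')"
    using solution_subinterval[of T "y x" t] solution_subinterval[of T "y x'" t] y[OF x(1)] y[OF x(2)] t by auto
  ultimately have "norm (y x t - y x' t) \<le> exp (t * L) * norm (y x 0 - y x' 0)"
    by (intro solution_lipschitz) (use y x t TM in auto)
  also have "\<dots> = exp (t * L) * dist x x'" using y x by (simp add: dist_norm)
  also have "\<dots> \<le> exp (T * L) * dist p q"
    using t L_pos dist_fst_le[of p q] by (intro mult_mono) (auto simp: p q)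
  finally have 1: "dist (y x t) (y x' t) \<le> exp (T * L) * dist p q" by (simp add: dist_norm)
  have "dist (y x' t) (y x' t') \<le> M * \<bar>t - t'\<bar>"
    using solution_dist[of T "y x'" t t'] y[OF x(2)] t by (simp add: dist_norm)
  also have "\<dots> \<le> M * dist p q"
    using dist_snd_le[of p q] M_pos by (intro mult_left_mono) (auto simp: p q dist_real_def)
  finally show "dist (case p of (x, t) \<Rightarrow> y x t) (case q of (x, t) \<Rightarrow> y x t) \<le> (exp (T * L) + M) * dist p q"
    using 1 dist_triangle[of "y x t" "y x' t'" "y x' t"] by (simp add: p q distrib_right)
qed (use M_pos in auto)

text \<open>If the solution from \<open>x\<close> ends in an open set, so do all but finitely many
  of its Euler approximations; Fatou's lemma therefore carries \<open>euler_pow_measure\<close> to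
  the limit, with an error proportional to \<open>\<epsilon>\<close>. Outer regularity extends the
  inequality from open to Borel sets.\<close>

lemma solution_measure:
  assumes y: "\<And>x. x \<in> ball x\<^sub>0 R \<Longrightarrow> solution T (y x) \<and> y x 0 = x" and TM: "T * M \<le> R" and T: "T \<ge> 0"
  shows solution_measurable: "B \<in> sets borel \<Longrightarrow> {x \<in> ball x\<^sub>0 R. y x T \<in> B} \<in> sets borel" (is "_ \<Longrightarrow> ?A B \<in> _")
    and "B \<in> sets borel \<Longrightarrow> emeasure \<mu> {x \<in> ball x\<^sub>0 R. y x T \<in> B} \<le> emeasure \<mu> B"
proof -
  have "continuous_on (ball x\<^sub>0 R) (\<lambda>x. case (x, T) of (x, t) \<Rightarrow> y x t)"
    using T by (intro continuous_on_compose2[OF solution_continuous[OF y TM T]]) (auto intro!: continuous_intros)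
  then have "continuous_on (ball x\<^sub>0 R) (\<lambda>x. y x T)" by simp
  then have h: "(\<lambda>x. if x \<in> ball x\<^sub>0 R then y x T else x) \<in> borel_measurable borel"
    by (rule borel_measurable_continuous_on_if[rotated]) (auto intro: continuous_on_id)
  have A: "?A B \<in> sets borel" if "B \<in> sets borel" for B
  proof -
    have "?A B = ball x\<^sub>0 R \<inter> (\<lambda>x. if x \<in> ball x\<^sub>0 R then y x T else x) -` B" by auto
    then show ?thesis using measurable_sets[OF h that] by (simp add: sets.Int)
  qed
  then show "B \<in> sets borel \<Longrightarrow> ?A B \<in> sets borel" .
  interpret finite_measure \<mu> by (rule finite_\<mu>)
  have V: "emeasure lborel K = ennreal (measure lborel K)"
    using emeasure_lborel_cball_finite[of x\<^sub>0 "2 * R"] by (intro emeasure_eq_ennreal_measure) auto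
  have opn: "emeasure \<mu> (?A B) \<le> emeasure \<mu> B" if B: "open B" for B
  proof (cases "T = 0")
    \<comment> \<open>Steps of length 0 are not covered by \<open>distortion\<close>; here the
      solution has not moved.\<close>
    case True
    then have "?A B \<subseteq> B" using y by fastforce
    then show ?thesis using B by (intro emeasure_mono) auto
  next
    case False
    then have T0: "T > 0" using T by simp
    have [measurable]: "B \<in> sets borel" using B by simp
    let ?S = "\<lambda>n. cball x\<^sub>0 R \<inter> (euler (T / real n) ^^ n) -` B"
    have S: "?S n \<in> sets \<mu>" for n
      using measurable_sets[OF measurable_euler_pow, of B] by (simp add: sets.Int)
    have bound: "emeasure \<mu> (?A B) \<le> emeasure \<mu> B + ennreal (\<epsilon> * T) * emeasure lborel K" if \<epsilon>: "\<epsilon> > 0" for \<epsilon>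
    proof -
      obtain \<delta> where \<delta>: "\<delta> > 0" "\<And>s x. 0 < s \<Longrightarrow> s < \<delta> \<Longrightarrow> x \<in> K \<Longrightarrow>
          \<rho> x \<le> \<bar>jacobian (\<lambda>v. v + s *\<^sub>R X' x v)\<bar> * \<rho> (x + s *\<^sub>R X x) + \<epsilon> * s"
        using distortion[OF \<epsilon>] by blast
      have "(\<lambda>n. T / real n) \<longlonglongrightarrow> 0" by real_asymp
      then have "\<forall>\<^sub>F n in sequentially. T / real n < \<delta>" "\<forall>\<^sub>F n in sequentially. T / real n < 1 / L"
        using \<delta>(1) L_pos by (auto intro: order_tendstoD(2))
      then have "\<forall>\<^sub>F n in sequentially. emeasure \<mu> (?S n) \<le> emeasure \<mu> B + ennreal (\<epsilon> * T) * emeasure lborel K"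
        using eventually_gt_at_top[of 0]
      proof eventually_elim
        case (elim n)
        let ?s = "T / real n"
        have s: "0 < ?s" "?s * L < 1" using elim T0 L_pos by (auto simp: field_simps)
        have n: "real n * (?s * M) = T * M" "real n * (\<epsilon> * ?s) = \<epsilon> * T" using elim by auto
        have "emeasure \<mu> (?S n) \<le> emeasure \<mu> (cball x\<^sub>0 (R + T * M) \<inter> B) + ennreal (\<epsilon> * T) * emeasure lborel K"
          using euler_pow_measure[OF s, of R n \<epsilon> B] TM \<epsilon> \<delta>(2)[OF s(1) elim(1)] unfolding n by simp
        also have "emeasure \<mu> (cball x\<^sub>0 (R + T * M) \<inter> B) \<le> emeasure \<mu> B" by (intro emeasure_mono) auto
        finally show ?case by (simp add: add_right_mono)
      qed
      then have le: "liminf (\<lambda>n. emeasure \<mu> (?S n)) \<le> emeasure \<mu> B + ennreal (\<epsilon> * T) * emeasure lborel K"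
        by (intro Liminf_le) auto
      have "emeasure \<mu> (?A B) = (\<integral>\<^sup>+x. indicator (?A B) x \<partial>\<mu>)"
        using A by (intro nn_integral_indicator[symmetric]) auto
      also have "\<dots> \<le> (\<integral>\<^sup>+x. liminf (\<lambda>n. indicator (?S n) x) \<partial>\<mu>)"
      proof (intro nn_integral_mono)
        fix x
        show "indicator (?A B) x \<le> liminf (\<lambda>n. indicator (?S n) x :: ennreal)"
        proof (cases "x \<in> ?A B")
          case True
          then have "(\<lambda>n. (euler (T / real n) ^^ n) (y x 0)) \<longlonglongrightarrow> y x T"
            using y[of x] TM T by (intro euler_tendsto) auto
          then have "\<forall>\<^sub>F n in sequentially. (euler (T / real n) ^^ n) (y x 0) \<in> B"
            using B True by (intro topological_tendstoD) auto
          then have "\<forall>\<^sub>F n in sequentially. x \<in> ?S n"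
            by eventually_elim (use True y[of x] in auto)
          then show ?thesis using True by (intro Liminf_bounded) (auto elim: eventually_mono)
        qed simp
      qed
      also have "\<dots> \<le> liminf (\<lambda>n. \<integral>\<^sup>+x. indicator (?S n) x \<partial>\<mu>)"
        using S by (intro nn_integral_liminf) auto
      also have "\<dots> = liminf (\<lambda>n. emeasure \<mu> (?S n))"
        using S by (simp add: nn_integral_indicator)
      finally show ?thesis using le by (rule order_trans)
    qed
    show ?thesis
    proof (rule ennreal_le_epsilon)
      fix e :: real assume e: "e > 0"
      \<comment> \<open>With \<open>e / (T * (v + 1))\<close> in place of \<open>\<epsilon>\<close>
        the error is \<open>e * (v / (v + 1))\<close>; adding 1 avoids a case distinction on
        \<open>v = 0\<close>.\<close>
      define v where "v = measure lborel K"
      have v: "v \<ge> 0" by (simp add: v_def)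
      have "e / (T * (v + 1)) * T * v = e * (v / (v + 1))" using T0 by simp
      also have "\<dots> \<le> e * 1" using e v by (intro mult_left_mono) auto
      finally have "e / (T * (v + 1)) * T * v \<le> e" by simp
      then have "ennreal (e / (T * (v + 1)) * T) * emeasure lborel K \<le> ennreal e"
        unfolding V v_def[symmetric] using e T0 v by (subst ennreal_mult[symmetric]) (auto intro!: ennreal_leI)
      then show "emeasure \<mu> (?A B) \<le> emeasure \<mu> B + ennreal e"
        using bound[of "e / (T * (v + 1))"] e T0 v by (meson add_left_mono divide_pos_pos mult_pos_pos order_trans add_nonneg_pos zero_less_one)
    qed
  qed
  show "emeasure \<mu> (?A B) \<le> emeasure \<mu> B" if B: "B \<in> sets borel"
  proof -
    have "emeasure \<mu> B = (INF U\<in>{U. B \<subseteq> U \<and> open U}. emeasure \<mu> U)"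
      using outer_regular[of \<mu> B] B emeasure_finite[of "space \<mu>"] by simp
    moreover have "emeasure \<mu> (?A B) \<le> (INF U\<in>{U. B \<subseteq> U \<and> open U}. emeasure \<mu> U)"
    proof (rule INF_greatest)
      fix U assume "U \<in> {U. B \<subseteq> U \<and> open U}"
      then have U: "B \<subseteq> U" "open U" by auto
      have "emeasure \<mu> (?A B) \<le> emeasure \<mu> (?A U)" using U A[of U] by (intro emeasure_mono) auto
      also have "\<dots> \<le> emeasure \<mu> U" by (rule opn[OF U(2)])
      finally show "emeasure \<mu> (?A B) \<le> emeasure \<mu> U" .
    qed
    ultimately show ?thesis by simp
  qed
qed

end

section \<open>Hamiltonian vector fields in a chart\<close>

definition C1_on :: "'a::real_normed_vector set \<Rightarrow> ('a \<Rightarrow> real) \<Rightarrow> bool" where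
  "C1_on U f \<longleftrightarrow> (\<forall>x\<in>U. f differentiable (at x)) \<and>
     (\<forall>v. continuous_on U (\<lambda>x. frechet_derivative f (at x) v))"

lemma C1_onI:
  assumes "\<And>x. x \<in> U \<Longrightarrow> (f has_derivative f' x) (at x)" and "\<And>v. continuous_on U (\<lambda>x. f' x v)"
  shows "C1_on U f"
proof -
  have "f' x = frechet_derivative f (at x)" if "x \<in> U" for x
    using assms(1)[OF that] by (rule frechet_derivative_at)
  then have "continuous_on U (\<lambda>x. frechet_derivative f (at x) v)" for v
    by (intro continuous_on_cong[THEN iffD1, OF refl _ assms(2)]) simp
  then show ?thesis using assms(1) by (auto simp: C1_on_def differentiable_def)
qed

lemma C1_on_has_derivative: "C1_on U f \<Longrightarrow> x \<in> U \<Longrightarrow> (f has_derivative frechet_derivative f (at x)) (at x)"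
  by (simp add: C1_on_def frechet_derivative_works)

lemma C1_on_continuous_deriv: "C1_on U f \<Longrightarrow> continuous_on U (\<lambda>x. frechet_derivative f (at x) v)"
  by (simp add: C1_on_def)

lemma C1_on_continuous: "C1_on U f \<Longrightarrow> continuous_on U f"
  by (meson C1_on_has_derivative has_derivative_at_withinI has_derivative_continuous_on)

lemma C1_on_const: "C1_on U (\<lambda>_. c)"
  by (rule C1_onI[where f' = "\<lambda>_ _. 0"]) auto

lemma C1_on_add:
  assumes "C1_on U f" "C1_on U g"
  shows "C1_on U (\<lambda>x. f x + g x)"
proof (rule C1_onI)
  fix x assume "x \<in> U"
  then show "((\<lambda>x. f x + g x) has_derivative (\<lambda>v. frechet_derivative f (at x) v + frechet_derivative g (at x) v)) (at x)"
    using assms by (intro has_derivative_add C1_on_has_derivative)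
qed (intro continuous_intros C1_on_continuous_deriv assms)

lemma C1_on_mult:
  assumes "C1_on U f" "C1_on U g"
  shows "C1_on U (\<lambda>x. f x * g x)"
proof (rule C1_onI)
  fix x assume "x \<in> U"
  then show "((\<lambda>x. f x * g x) has_derivative (\<lambda>v. f x * frechet_derivative g (at x) v + frechet_derivative f (at x) v * g x)) (at x)"
    using assms by (intro has_derivative_mult C1_on_has_derivative)
qed (intro continuous_intros C1_on_continuous_deriv C1_on_continuous assms)

lemma C1_on_divide:
  assumes "C1_on U f" "C1_on U g" "\<And>x. x \<in> U \<Longrightarrow> g x \<noteq> 0"
  shows "C1_on U (\<lambda>x. f x / g x)"
proof (rule C1_onI)
  fix x assume "x \<in> U"
  then show "((\<lambda>x. f x / g x) has_derivative
      (\<lambda>v. (frechet_derivative f (at x) v * g x - f x * frechet_derivative g (at x) v) / (g x * g x))) (at x)"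
    using assms by (intro has_derivative_divide' C1_on_has_derivative)
qed (intro continuous_intros C1_on_continuous_deriv C1_on_continuous assms; simp add: assms(3))

lemma C1_on_sum: "(\<And>i. i \<in> I \<Longrightarrow> C1_on U (f i)) \<Longrightarrow> C1_on U (\<lambda>x. \<Sum>i\<in>I. f i x)"
  by (induction I rule: infinite_finite_induct) (auto intro: C1_on_const C1_on_add)

lemma C1_on_prod: "(\<And>i. i \<in> I \<Longrightarrow> C1_on U (f i)) \<Longrightarrow> C1_on U (\<lambda>x. \<Prod>i\<in>I. f i x)"
  by (induction I rule: infinite_finite_induct) (auto intro: C1_on_const C1_on_mult)

lemma C1_on_det:
  fixes A :: "'a::real_normed_vector \<Rightarrow> real ^ 'n::finite ^ 'n"
  assumes "\<And>i j. C1_on U (\<lambda>x. A x $ i $ j)"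
  shows "C1_on U (\<lambda>x. det (A x))"
  unfolding det_def by (intro C1_on_sum C1_on_mult C1_on_const C1_on_prod assms)

lemma smooth_on_C1_on:
  assumes "open U" "smooth_on U f"
  shows "C1_on U f"
proof -
  have "C_k_on (Suc 0) f U" using assms(2) by (simp only: smooth_on_def)
  then show ?thesis by (auto simp: C1_on_def differentiable_on_def at_within_open[OF _ assms(1)])
qed

lemma smooth_on_C1_on_deriv:
  assumes "open U" "smooth_on U f"
  shows "C1_on U (\<lambda>x. frechet_derivative f (at x) v)"
proof -
  have "C_k_on (Suc (Suc 0)) f U" using assms(2) by (simp only: smooth_on_def)
  then show ?thesis by (auto simp: C1_on_def differentiable_on_def at_within_open[OF _ assms(1)])
qed

text \<open>Two applications of the mean value theorem: in the direction \<open>u\<close> to the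
  increment of \<open>h\<close> along \<open>s *\<^sub>R v\<close>, then in the direction
  \<open>v\<close> to the derivative so obtained. The bound on \<open>s\<close> keeps the whole
  parallelogram in \<open>U\<close>.\<close>

lemma second_difference:
  fixes h :: "'a::real_normed_vector \<Rightarrow> real"
  assumes U: "ball x e \<subseteq> U" and h: "C1_on U h" "C1_on U (\<lambda>y. frechet_derivative h (at y) u)"
    and s: "s > 0" "s * (norm u + norm v) < e"
  shows "\<exists>a\<in>{0..s}. \<exists>b\<in>{0..s}. h (x + s *\<^sub>R u + s *\<^sub>R v) - h (x + s *\<^sub>R u) - h (x + s *\<^sub>R v) + h x =
     s\<^sup>2 * frechet_derivative (\<lambda>y. frechet_derivative h (at y) u) (at (x + a *\<^sub>R u + b *\<^sub>R v)) v"
proof -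
  let ?D = "\<lambda>y. frechet_derivative h (at y) u"
  have mem: "x + a *\<^sub>R u + b *\<^sub>R v \<in> U" if "a \<in> {0..s}" "b \<in> {0..s}" for a b
  proof -
    have "norm (a *\<^sub>R u + b *\<^sub>R v) \<le> a * norm u + b * norm v"
      using that norm_triangle_ineq[of "a *\<^sub>R u" "b *\<^sub>R v"] by simp
    also have "\<dots> \<le> s * norm u + s * norm v" using that by (intro add_mono mult_right_mono) auto
    also have "\<dots> < e" using s by (simp add: algebra_simps)
    finally have "x + a *\<^sub>R u + b *\<^sub>R v \<in> ball x e"
      by (metis add.assoc add_diff_cancel_left' dist_norm mem_ball dist_commute)
    then show ?thesis using U by blast
  qed
  define \<phi> where "\<phi> a = h (x + a *\<^sub>R u + s *\<^sub>R v) - h (x + a *\<^sub>R u)" for a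
  have "\<exists>a\<in>{0<..<s}. \<phi> s - \<phi> 0 = (s - 0) * (?D (x + a *\<^sub>R u + s *\<^sub>R v) - ?D (x + a *\<^sub>R u))"
  proof (rule mvt_simple[where f' = "\<lambda>a d. d * (?D (x + a *\<^sub>R u + s *\<^sub>R v) - ?D (x + a *\<^sub>R u))", OF s(1)])
    fix a assume "0 \<le> a" "a \<le> s"
    then have a: "a \<in> {0..s}" by simp
    have H: "((\<lambda>a. h (x + a *\<^sub>R u + b *\<^sub>R v)) has_derivative (\<lambda>d. d * ?D (x + a *\<^sub>R u + b *\<^sub>R v))) (at a)" if "b \<in> {0..s}" for b
    proof -
      have "((\<lambda>a. x + a *\<^sub>R u + b *\<^sub>R v) has_derivative (\<lambda>d. d *\<^sub>R u)) (at a)"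
        by (auto intro!: derivative_eq_intros)
      from diff_chain_at[OF this C1_on_has_derivative[OF h(1) mem[OF a that]]]
      show ?thesis
        using linear_frechet_derivative[of h "at (x + a *\<^sub>R u + b *\<^sub>R v)"] h(1) mem[OF a that]
        by (simp add: comp_def C1_on_def linear_cmul)
    qed
    show "(\<phi> has_derivative (\<lambda>d. d * (?D (x + a *\<^sub>R u + s *\<^sub>R v) - ?D (x + a *\<^sub>R u)))) (at a within {0..s})"
    proof (rule has_derivative_at_withinI)
      have "(\<phi> has_derivative (\<lambda>d. d * ?D (x + a *\<^sub>R u + s *\<^sub>R v) - d * ?D (x + a *\<^sub>R u + 0 *\<^sub>R v))) (at a)"
        using has_derivative_diff[OF H[of s] H[of 0]] s(1) unfolding \<phi>_def[abs_def] by simp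
      then show "(\<phi> has_derivative (\<lambda>d. d * (?D (x + a *\<^sub>R u + s *\<^sub>R v) - ?D (x + a *\<^sub>R u)))) (at a)"
        by (simp only: right_diff_distrib scaleR_zero_left add_0_right)
    qed
  qed
  then obtain a where "a \<in> {0<..<s}" "\<phi> s - \<phi> 0 = (s - 0) * (?D (x + a *\<^sub>R u + s *\<^sub>R v) - ?D (x + a *\<^sub>R u))"
    by blast
  then have a: "a \<in> {0..s}" "\<phi> s - \<phi> 0 = s * (?D (x + a *\<^sub>R u + s *\<^sub>R v) - ?D (x + a *\<^sub>R u))" by simp_all
  have "\<exists>b\<in>{0<..<s}. ?D (x + a *\<^sub>R u + s *\<^sub>R v) - ?D (x + a *\<^sub>R u + 0 *\<^sub>R v) =
       (s - 0) * frechet_derivative ?D (at (x + a *\<^sub>R u + b *\<^sub>R v)) v"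
  proof (rule mvt_simple[where f = "\<lambda>b. ?D (x + a *\<^sub>R u + b *\<^sub>R v)" and f' = "\<lambda>b d. d * frechet_derivative ?D (at (x + a *\<^sub>R u + b *\<^sub>R v)) v", OF s(1)])
    fix b assume "0 \<le> b" "b \<le> s"
    then have b: "b \<in> {0..s}" by simp
    have "((\<lambda>b. x + a *\<^sub>R u + b *\<^sub>R v) has_derivative (\<lambda>d. d *\<^sub>R v)) (at b within {0..s})"
      by (auto intro!: derivative_eq_intros)
    from diff_chain_within[OF this has_derivative_at_withinI[OF C1_on_has_derivative[OF h(2) mem[OF a(1) b]]]]
    show "((\<lambda>b. ?D (x + a *\<^sub>R u + b *\<^sub>R v)) has_derivative (\<lambda>d. d * frechet_derivative ?D (at (x + a *\<^sub>R u + b *\<^sub>R v)) v)) (at b within {0..s})"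
      using linear_frechet_derivative[of ?D "at (x + a *\<^sub>R u + b *\<^sub>R v)"] h(2) mem[OF a(1) b]
      by (simp add: comp_def C1_on_def linear_cmul)
  qed
  then obtain b where "b \<in> {0<..<s}" "?D (x + a *\<^sub>R u + s *\<^sub>R v) - ?D (x + a *\<^sub>R u + 0 *\<^sub>R v) =
       (s - 0) * frechet_derivative ?D (at (x + a *\<^sub>R u + b *\<^sub>R v)) v"
    by blast
  then have b: "b \<in> {0..s}" "?D (x + a *\<^sub>R u + s *\<^sub>R v) - ?D (x + a *\<^sub>R u) = s * frechet_derivative ?D (at (x + a *\<^sub>R u + b *\<^sub>R v)) v"
    by simp_all
  show ?thesis using a b by (intro bexI[of _ a] bexI[of _ b]) (auto simp: \<phi>_def power2_eq_square algebra_simps)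
qed

text \<open>The second difference is symmetric in \<open>u\<close> and \<open>v\<close>; divided by
  \<open>s\<^sup>2\<close> it tends to either mixed derivative by \<open>second_difference\<close>
  and continuity.\<close>

lemma second_derivative_symmetric:
  fixes h :: "'a::real_normed_vector \<Rightarrow> real"
  assumes U: "open U" "x \<in> U" and h: "C1_on U h" "\<And>u. C1_on U (\<lambda>y. frechet_derivative h (at y) u)"
  shows "frechet_derivative (\<lambda>y. frechet_derivative h (at y) u) (at x) v = frechet_derivative (\<lambda>y. frechet_derivative h (at y) v) (at x) u"
proof -
  let ?F = "\<lambda>u v y. frechet_derivative (\<lambda>y. frechet_derivative h (at y) u) (at y) v"
  let ?\<Delta> = "\<lambda>u v s. h (x + s *\<^sub>R u + s *\<^sub>R v) - h (x + s *\<^sub>R u) - h (x + s *\<^sub>R v) + h x"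
  obtain e where e: "e > 0" "ball x e \<subseteq> U" using U open_contains_ball by blast
  have lim: "((\<lambda>s. ?\<Delta> u v s / s\<^sup>2) \<longlongrightarrow> ?F u v x) (at_right 0)" for u v
  proof (rule tendstoI)
    fix \<epsilon> :: real assume \<epsilon>: "\<epsilon> > 0"
    have "continuous (at x) (?F u v)"
      using h(2)[of u] U by (auto simp: C1_on_def continuous_on_eq_continuous_at)
    then obtain d where d: "d > 0" "\<And>y. dist y x < d \<Longrightarrow> dist (?F u v y) (?F u v x) < \<epsilon>"
      using \<epsilon> unfolding continuous_at_eps_delta by blast
    have "((\<lambda>s. s * (norm u + norm v)) \<longlongrightarrow> 0 * (norm u + norm v)) (at_right 0)"
      by (intro tendsto_intros)
    then have "\<forall>\<^sub>F s in at_right 0. s * (norm u + norm v) < min d e"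
      using d e by (intro order_tendstoD(2)) auto
    moreover have "\<forall>\<^sub>F s in at_right 0. (s::real) > 0" by (auto simp: eventually_at_filter)
    ultimately show "\<forall>\<^sub>F s in at_right 0. dist (?\<Delta> u v s / s\<^sup>2) (?F u v x) < \<epsilon>"
    proof eventually_elim
      case (elim s)
      then obtain a b where ab: "a \<in> {0..s}" "b \<in> {0..s}" "?\<Delta> u v s = s\<^sup>2 * ?F u v (x + a *\<^sub>R u + b *\<^sub>R v)"
        using second_difference[OF e(2) h(1) h(2)[of u], of s v] by auto
      have "norm (a *\<^sub>R u + b *\<^sub>R v) \<le> a * norm u + b * norm v"
        using ab norm_triangle_ineq[of "a *\<^sub>R u" "b *\<^sub>R v"] by simp
      also have "\<dots> \<le> s * norm u + s * norm v" using ab by (intro add_mono mult_right_mono) auto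
      also have "\<dots> < d" using elim by (simp add: algebra_simps)
      finally have "dist (x + a *\<^sub>R u + b *\<^sub>R v) x < d" by (simp add: dist_norm add.assoc)
      then show ?case using d(2) elim ab by simp
    qed
  qed
  have "?\<Delta> v u = ?\<Delta> u v" by (rule ext) (simp add: add.left_commute add.commute diff_diff_eq)
  from lim[of v u, unfolded fun_cong[OF this]]
  have "((\<lambda>s. ?\<Delta> u v s / s\<^sup>2) \<longlongrightarrow> ?F v u x) (at_right 0)" .
  then show ?thesis by (rule tendsto_unique[OF trivial_limit_at_right_real lim[of u v]])
qed

lemma bilinear_expand:
  fixes b :: "real ^ 'n::finite \<Rightarrow> real ^ 'n \<Rightarrow> real"
  assumes "bilinear b"
  shows "b u v = (\<Sum>i\<in>UNIV. \<Sum>j\<in>UNIV. u $ i * v $ j * b (axis i 1) (axis j 1))"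
proof -
  have e: "w = (\<Sum>i\<in>UNIV. w $ i *\<^sub>R axis i 1)" for w :: "real ^ 'n"
    using basis_expansion[of w] by (simp add: scalar_mult_eq_scaleR)
  have "b u v = b (\<Sum>i\<in>UNIV. u $ i *\<^sub>R axis i 1) (\<Sum>i\<in>UNIV. v $ i *\<^sub>R axis i 1)" using e by metis
  also have "\<dots> = (\<Sum>i\<in>UNIV. \<Sum>j\<in>UNIV. u $ i * v $ j * b (axis i 1) (axis j 1))"
    unfolding bilinear_sum[OF assms] sum.cartesian_product[symmetric]
    by (simp add: bilinear_lmul[OF assms] bilinear_rmul[OF assms] mult.assoc mult.left_commute)
  finally show ?thesis .
qed

text \<open>\<open>f s x = f 0 x + o(s)\<close> uniformly on \<open>K\<close>, that is, a zero
  derivative in \<open>s\<close> at 0. The bound on \<open>f 0\<close> is included so that products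
  of flat families are flat.\<close>

definition flat_on :: "'a set \<Rightarrow> (real \<Rightarrow> 'a \<Rightarrow> real) \<Rightarrow> bool" where
  "flat_on K f \<longleftrightarrow> (\<forall>\<epsilon>>0. \<exists>\<delta>>0. \<forall>s. 0 < s \<longrightarrow> s < \<delta> \<longrightarrow> (\<forall>x\<in>K. \<bar>f s x - f 0 x\<bar> \<le> \<epsilon> * s)) \<and>
     (\<exists>C. \<forall>x\<in>K. \<bar>f 0 x\<bar> \<le> C)"

lemma flat_onD:
  assumes "flat_on K f" "\<epsilon> > 0"
  shows "\<exists>\<delta>>0. \<forall>s x. 0 < s \<longrightarrow> s < \<delta> \<longrightarrow> x \<in> K \<longrightarrow> \<bar>f s x - f 0 x\<bar> \<le> \<epsilon> * s"
proof -
  have "\<exists>\<delta>>0. \<forall>s. 0 < s \<longrightarrow> s < \<delta> \<longrightarrow> (\<forall>x\<in>K. \<bar>f s x - f 0 x\<bar> \<le> \<epsilon> * s)"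
    using assms by (simp only: flat_on_def)
  then show ?thesis by (elim ex_forward conj_forward) auto
qed

lemma flat_on_bounded: "flat_on K f \<Longrightarrow> \<exists>C. \<forall>x. x \<in> K \<longrightarrow> \<bar>f 0 x\<bar> \<le> C"
  unfolding flat_on_def Ball_def by (erule conjunct2)

lemma flat_on_const: "flat_on K (\<lambda>_ _. c)"
  unfolding flat_on_def by (auto intro: exI[of _ 1] exI[of _ "\<bar>c\<bar>"])

lemma flat_on_add:
  assumes "flat_on K f" "flat_on K g"
  shows "flat_on K (\<lambda>s x. f s x + g s x)"
  unfolding flat_on_def
proof (intro conjI allI impI)
  fix \<epsilon> :: real assume "\<epsilon> > 0"
  then have e: "\<epsilon> / 2 > 0" by simp
  obtain \<delta>1 where 1: "\<delta>1 > 0" "\<And>s x. 0 < s \<Longrightarrow> s < \<delta>1 \<Longrightarrow> x \<in> K \<Longrightarrow> \<bar>f s x - f 0 x\<bar> \<le> \<epsilon> / 2 * s"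
    using flat_onD[OF assms(1) e(1)] by blast
  obtain \<delta>2 where 2: "\<delta>2 > 0" "\<And>s x. 0 < s \<Longrightarrow> s < \<delta>2 \<Longrightarrow> x \<in> K \<Longrightarrow> \<bar>g s x - g 0 x\<bar> \<le> \<epsilon> / 2 * s"
    using flat_onD[OF assms(2) e(1)] by blast
  show "\<exists>\<delta>>0. \<forall>s. 0 < s \<longrightarrow> s < \<delta> \<longrightarrow> (\<forall>x\<in>K. \<bar>f s x + g s x - (f 0 x + g 0 x)\<bar> \<le> \<epsilon> * s)"
  proof (intro exI[of _ "min \<delta>1 \<delta>2"] conjI allI impI ballI)
    fix s x assume "0 < s" "s < min \<delta>1 \<delta>2" "x \<in> K"
    then have "\<bar>f s x - f 0 x\<bar> \<le> \<epsilon> / 2 * s" "\<bar>g s x - g 0 x\<bar> \<le> \<epsilon> / 2 * s" using 1(2) 2(2) by auto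
    then show "\<bar>f s x + g s x - (f 0 x + g 0 x)\<bar> \<le> \<epsilon> * s" unfolding abs_le_iff by (auto simp: field_simps)
  qed (use 1 2 in auto)
next
  obtain C D where "\<And>x. x \<in> K \<Longrightarrow> \<bar>f 0 x\<bar> \<le> C" "\<And>x. x \<in> K \<Longrightarrow> \<bar>g 0 x\<bar> \<le> D"
    using flat_on_bounded[OF assms(1)] flat_on_bounded[OF assms(2)] by blast
  then show "\<exists>C. \<forall>x\<in>K. \<bar>f 0 x + g 0 x\<bar> \<le> C"
    by (intro exI[of _ "C + D"] ballI order_trans[OF abs_triangle_ineq] add_mono)
qed

lemma flat_on_mult:
  assumes "flat_on K f" "flat_on K g"
  shows "flat_on K (\<lambda>s x. f s x * g s x)"
  unfolding flat_on_def
proof (intro conjI allI impI)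
  obtain C D where CD: "\<And>x. x \<in> K \<Longrightarrow> \<bar>f 0 x\<bar> \<le> C" "\<And>x. x \<in> K \<Longrightarrow> \<bar>g 0 x\<bar> \<le> D"
    using flat_on_bounded[OF assms(1)] flat_on_bounded[OF assms(2)] by blast
  show "\<exists>C. \<forall>x\<in>K. \<bar>f 0 x * g 0 x\<bar> \<le> C"
    using CD by (intro exI[of _ "C * D"]) (force simp: abs_mult intro!: mult_mono)
  define B where "B = \<bar>C\<bar> + \<bar>D\<bar> + 1"
  have B: "B > 0" by (simp add: B_def)
  fix \<epsilon> :: real assume \<epsilon>: "\<epsilon> > 0"
  \<comment> \<open>The cap 1 keeps \<open>e * s\<close> at most 1, so the product of the two
    increments is bounded by one of them; the three terms of the expansion then add up to at most
    \<open>e * B * s\<close>.\<close>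
  define e where "e = min 1 (\<epsilon> / B)"
  have e: "e > 0" "e \<le> 1" "e * B \<le> \<epsilon>"
    using \<epsilon> B by (auto simp: e_def min_def field_simps)
  obtain \<delta>1 where 1: "\<delta>1 > 0" "\<And>s x. 0 < s \<Longrightarrow> s < \<delta>1 \<Longrightarrow> x \<in> K \<Longrightarrow> \<bar>f s x - f 0 x\<bar> \<le> e * s"
    using flat_onD[OF assms(1) e(1)] by blast
  obtain \<delta>2 where 2: "\<delta>2 > 0" "\<And>s x. 0 < s \<Longrightarrow> s < \<delta>2 \<Longrightarrow> x \<in> K \<Longrightarrow> \<bar>g s x - g 0 x\<bar> \<le> e * s"
    using flat_onD[OF assms(2) e(1)] by blast
  show "\<exists>\<delta>>0. \<forall>s. 0 < s \<longrightarrow> s < \<delta> \<longrightarrow> (\<forall>x\<in>K. \<bar>f s x * g s x - f 0 x * g 0 x\<bar> \<le> \<epsilon> * s)"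
  proof (intro exI[of _ "min 1 (min \<delta>1 \<delta>2)"] conjI allI impI ballI)
    fix s x assume s: "0 < s" "s < min 1 (min \<delta>1 \<delta>2)" and x: "x \<in> K"
    let ?a = "f s x - f 0 x" and ?b = "g s x - g 0 x"
    have a: "\<bar>?a\<bar> \<le> e * s" and b: "\<bar>?b\<bar> \<le> e * s" using 1(2)[of s x] 2(2)[of s x] s x by auto
    have es: "e * s \<le> 1" using e s by (simp add: mult_le_one)
    have C: "\<bar>f 0 x\<bar> \<le> \<bar>C\<bar>" "\<bar>g 0 x\<bar> \<le> \<bar>D\<bar>" using CD[OF x] by auto
    have "f s x * g s x - f 0 x * g 0 x = ?a * ?b + ?a * g 0 x + f 0 x * ?b" by (simp add: algebra_simps)
    then have "\<bar>f s x * g s x - f 0 x * g 0 x\<bar> \<le> \<bar>?a\<bar> * \<bar>?b\<bar> + \<bar>?a\<bar> * \<bar>g 0 x\<bar> + \<bar>f 0 x\<bar> * \<bar>?b\<bar>"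
      by (metis (no_types, opaque_lifting) abs_mult abs_triangle_ineq add_right_mono order_trans)
    also have "\<dots> \<le> (e * s) * 1 + (e * s) * \<bar>D\<bar> + \<bar>C\<bar> * (e * s)"
      using a b C es by (intro add_mono mult_mono) auto
    also have "\<dots> = e * B * s" by (simp add: B_def algebra_simps)
    also have "\<dots> \<le> \<epsilon> * s" using e s by (intro mult_right_mono) auto
    finally show "\<bar>f s x * g s x - f 0 x * g 0 x\<bar> \<le> \<epsilon> * s" .
  qed (use 1 2 in auto)
qed

lemma flat_on_sum: "(\<And>i. i \<in> I \<Longrightarrow> flat_on K (f i)) \<Longrightarrow> flat_on K (\<lambda>s x. \<Sum>i\<in>I. f i s x)"
  by (induction I rule: infinite_finite_induct) (auto intro: flat_on_const flat_on_add)

lemma flat_on_prod: "(\<And>i. i \<in> I \<Longrightarrow> flat_on K (f i)) \<Longrightarrow> flat_on K (\<lambda>s x. \<Prod>i\<in>I. f i s x)"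
  by (induction I rule: infinite_finite_induct) (auto intro: flat_on_const flat_on_mult)

text \<open>\<open>h\<close>, \<open>w\<close> and \<open>X\<close> are the coordinate expressions of the Hamiltonian, of the symplectic form and of
  the Hamiltonian vector field.\<close>

locale hamiltonian_domain =
  fixes U :: "(real ^ 'n::finite) set" and w :: "real ^ 'n \<Rightarrow> real ^ 'n \<Rightarrow> real ^ 'n \<Rightarrow> real"
    and h :: "real ^ 'n \<Rightarrow> real" and r :: nat
  assumes open_U: "open U" and dim: "CARD('n) = 2 * r"
    and bil: "x \<in> U \<Longrightarrow> bilinear (w x)"
    and antisym: "x \<in> U \<Longrightarrow> w x u v = - w x v u"
    and nondegenerate: "x \<in> U \<Longrightarrow> (\<And>v. w x u v = 0) \<Longrightarrow> u = 0"
    and w_smooth: "smooth_on U (\<lambda>x. w x u v)"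
    and w_closed: "x \<in> U \<Longrightarrow> frechet_derivative (\<lambda>y. w y v z) (at x) u
        + frechet_derivative (\<lambda>y. w y z u) (at x) v + frechet_derivative (\<lambda>y. w y u v) (at x) z = 0"
    and h_smooth: "smooth_on U h"
begin

text \<open>The arguments appear as \<open>axis j 1\<close>, \<open>axis i 1\<close>, so that
  \<open>W x *v u\<close> lists the values \<open>w x u (axis i 1)\<close>.\<close>

definition W :: "real ^ 'n \<Rightarrow> real ^ 'n ^ 'n" where
  "W x = (\<chi> i j. w x (axis j 1) (axis i 1))"

text \<open>Cramer's rule for the coordinate form of Hamilton's equations. From a quotient of
  determinants continuous differentiability of the field is evident.\<close>

definition X :: "real ^ 'n \<Rightarrow> real ^ 'n" where
  "X x = (\<chi> k. det (\<chi> i j. if j = k then frechet_derivative h (at x) (axis i 1) else W x $ i $ j) / det (W x))"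

definition X' :: "real ^ 'n \<Rightarrow> real ^ 'n \<Rightarrow> real ^ 'n" where
  "X' x v = (\<Sum>k\<in>UNIV. frechet_derivative (\<lambda>y. X y $ k) (at x) v *\<^sub>R axis k 1)"

text \<open>The derivative of the coefficients of the form in the direction \<open>d\<close>, not
  the exterior derivative.\<close>

definition dw :: "real ^ 'n \<Rightarrow> real ^ 'n \<Rightarrow> real ^ 'n \<Rightarrow> real ^ 'n \<Rightarrow> real" where
  "dw x d u v = frechet_derivative (\<lambda>y. w y u v) (at x) d"

section \<open>The Hamiltonian vector field in coordinates\<close>

lemma W_mult: "x \<in> U \<Longrightarrow> (W x *v u) $ i = w x u (axis i 1)"
proof -
  assume x: "x \<in> U"
  have "w x u (axis i 1) = (\<Sum>j\<in>UNIV. \<Sum>k\<in>UNIV. u $ j * axis i 1 $ k * w x (axis j 1) (axis k 1))"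
    by (rule bilinear_expand[OF bil[OF x]])
  also have "\<dots> = (\<Sum>j\<in>UNIV. u $ j * w x (axis j 1) (axis i 1))"
    by (intro sum.cong refl, subst sum.remove[of _ i]) (auto simp: axis_def intro!: sum.neutral)
  finally show ?thesis by (simp add: matrix_vector_mult_def W_def mult.commute)
qed

lemma det_W: assumes x: "x \<in> U" shows "det (W x) \<noteq> 0"
proof -
  have "inj ((*v) (W x))"
  proof (rule linear_injective_0[THEN iffD2], rule matrix_vector_mul_linear, intro allI impI)
    fix u assume u: "W x *v u = 0"
    have "w x u v = 0" for v
    proof -
      have "w x u (axis i 1) = 0" for i using W_mult[OF x, of u i] u by simp
      moreover have "w x u v = (\<Sum>i\<in>UNIV. v $ i * w x u (axis i 1))"
      proof -
        have "w x u (\<Sum>i\<in>UNIV. v $ i *\<^sub>R axis i 1) = (\<Sum>i\<in>UNIV. v $ i * w x u (axis i 1))"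
          using bil[OF x] by (simp add: bilinear_def linear_sum linear_cmul)
        then show ?thesis using basis_expansion[of v] by (simp add: scalar_mult_eq_scaleR)
      qed
      ultimately show ?thesis by simp
    qed
    then show "u = 0" by (rule nondegenerate[OF x])
  qed
  then have "invertible (W x)"
    using invertible_left_inverse matrix_left_invertible_injective by blast
  then show ?thesis by (simp add: invertible_det_nz)
qed

lemma h_C1: "C1_on U h" and h_C2: "C1_on U (\<lambda>x. frechet_derivative h (at x) v)" and w_C1: "C1_on U (\<lambda>x. w x u v)"
  using smooth_on_C1_on[OF open_U h_smooth] smooth_on_C1_on_deriv[OF open_U h_smooth] smooth_on_C1_on[OF open_U w_smooth] by auto

lemma linear_eq_axis:
  assumes "linear f" "linear g" "\<And>i. f (axis i 1) = g (axis i 1)"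
  shows "f v = g (v :: real ^ 'n) "
proof -
  have e: "v = (\<Sum>i\<in>UNIV. v $ i *\<^sub>R axis i 1)"
    using basis_expansion[of v] by (simp add: scalar_mult_eq_scaleR)
  show ?thesis by (subst (1 2) e) (simp add: linear_sum assms linear_cmul)
qed

lemma X_eq: assumes x: "x \<in> U" shows "w x (X x) v = frechet_derivative h (at x) v"
proof -
  have "W x *v X x = (\<chi> i. frechet_derivative h (at x) (axis i 1))"
    by (rule cramer[OF det_W[OF x], THEN iffD2]) (simp add: X_def cong: if_cong)
  then have "w x (X x) (axis i 1) = frechet_derivative h (at x) (axis i 1)" for i
    using W_mult[OF x, of "X x" i] by simp
  moreover have "linear (w x (X x))" using bil[OF x] by (simp add: bilinear_def)
  moreover have "linear (frechet_derivative h (at x))"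
    using h_C1 x by (intro linear_frechet_derivative) (auto simp: C1_on_def)
  ultimately show ?thesis using linear_eq_axis by blast
qed

lemma X_unique:
  assumes x: "x \<in> U" and Y: "\<And>v. w x Y v = frechet_derivative h (at x) v"
  shows "Y = X x"
proof -
  have "w x (Y - X x) v = 0" for v
    using bil[OF x] Y[of v] X_eq[OF x, of v] by (simp add: bilinear_lsub)
  then have "Y - X x = 0" by (rule nondegenerate[OF x])
  then show ?thesis by simp
qed

lemma X_C1: "C1_on U (\<lambda>x. X x $ k)"
proof -
  have W: "C1_on U (\<lambda>x. W x $ i $ j)" for i j unfolding W_def using w_C1 by simp
  show ?thesis unfolding X_def vec_lambda_beta
  proof (rule C1_on_divide)
    show "C1_on U (\<lambda>x. det (\<chi> i j. if j = k then frechet_derivative h (at x) (axis i 1) else W x $ i $ j))"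
    proof (rule C1_on_det)
      show "C1_on U (\<lambda>x. (\<chi> i j. if j = k then frechet_derivative h (at x) (axis i 1) else W x $ i $ j) $ i $ j)" for i j
        using W h_C2 by (cases "j = k") simp_all
    qed
    show "C1_on U (\<lambda>x. det (W x))" by (rule C1_on_det) (rule W)
  qed (rule det_W)
qed

lemma X_has_derivative: assumes "x \<in> U" shows "(X has_derivative X' x) (at x)"
proof -
  have "((\<lambda>y. \<Sum>k\<in>UNIV. X y $ k *\<^sub>R axis k 1) has_derivative X' x) (at x)"
    unfolding X'_def[abs_def]
    by (intro has_derivative_sum has_derivative_scaleR_left C1_on_has_derivative[OF X_C1 assms])
  moreover have "(\<Sum>k\<in>UNIV. X y $ k *\<^sub>R axis k 1) = X y" for y
    using basis_expansion[of "X y"] by (simp add: scalar_mult_eq_scaleR)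
  ultimately show ?thesis by simp
qed

lemma continuous_X': "continuous_on U (\<lambda>x. X' x v)"
  unfolding X'_def by (intro continuous_intros C1_on_continuous_deriv X_C1)

lemma continuous_X: "continuous_on U X"
  by (rule has_derivative_continuous_on[OF has_derivative_at_withinI[OF X_has_derivative]])

section \<open>The Lie derivative of the form along the field\<close>

lemma linear_dw: "x \<in> U \<Longrightarrow> linear (\<lambda>d. dw x d u v)"
  unfolding dw_def using w_C1 by (intro linear_frechet_derivative) (auto simp: C1_on_def)

text \<open>The Leibniz rule for a moving base point and moving arguments. Smoothness of the form is
  given for constant arguments, so it is expanded in the standard basis; the first summand is folded
  back once \<open>dw_expand\<close> is available.\<close>

lemma has_derivative_form_aux:
  fixes z :: "'t::real_normed_vector \<Rightarrow> real ^ 'n"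
  assumes z: "z t \<in> U" "(z has_derivative z') (at t)"
    and a: "(a has_derivative a') (at t)" and b: "(b has_derivative b') (at t)"
  shows "((\<lambda>t. w (z t) (a t) (b t)) has_derivative
     (\<lambda>\<tau>. (\<Sum>i\<in>UNIV. \<Sum>j\<in>UNIV. a t $ i * b t $ j * dw (z t) (z' \<tau>) (axis i 1) (axis j 1)) + w (z t) (a' \<tau>) (b t) + w (z t) (a t) (b' \<tau>))) (at t)"
proof -
  let ?g = "\<lambda>t. \<Sum>i\<in>UNIV. \<Sum>j\<in>UNIV. a t $ i * b t $ j * w (z t) (axis i 1) (axis j 1)"
  have ai: "((\<lambda>t. a t $ i) has_derivative (\<lambda>\<tau>. a' \<tau> $ i)) (at t)" for i
    by (rule bounded_linear.has_derivative[OF bounded_linear_vec_nth a])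
  have bi: "((\<lambda>t. b t $ i) has_derivative (\<lambda>\<tau>. b' \<tau> $ i)) (at t)" for i
    by (rule bounded_linear.has_derivative[OF bounded_linear_vec_nth b])
  have wz: "((\<lambda>t. w (z t) u v) has_derivative (\<lambda>\<tau>. dw (z t) (z' \<tau>) u v)) (at t)" for u v
    using diff_chain_at[OF z(2) C1_on_has_derivative[OF w_C1[of u v] z(1)]] by (simp add: comp_def dw_def)
  have "(?g has_derivative (\<lambda>\<tau>. \<Sum>i\<in>UNIV. \<Sum>j\<in>UNIV. a t $ i * b t $ j * dw (z t) (z' \<tau>) (axis i 1) (axis j 1) +
     (a t $ i * b' \<tau> $ j + a' \<tau> $ i * b t $ j) * w (z t) (axis i 1) (axis j 1))) (at t)"
    by (intro has_derivative_sum has_derivative_mult ai bi wz)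
  also have "(\<lambda>\<tau>. \<Sum>i\<in>UNIV. \<Sum>j\<in>UNIV. a t $ i * b t $ j * dw (z t) (z' \<tau>) (axis i 1) (axis j 1) +
     (a t $ i * b' \<tau> $ j + a' \<tau> $ i * b t $ j) * w (z t) (axis i 1) (axis j 1)) =
     (\<lambda>\<tau>. (\<Sum>i\<in>UNIV. \<Sum>j\<in>UNIV. a t $ i * b t $ j * dw (z t) (z' \<tau>) (axis i 1) (axis j 1)) + w (z t) (a' \<tau>) (b t) + w (z t) (a t) (b' \<tau>))"
    unfolding bilinear_expand[OF bil[OF z(1)], of "a' _" "b t"] bilinear_expand[OF bil[OF z(1)], of "a t" "b' _"]
    by (simp add: sum.distrib distrib_right add.commute add.left_commute)
  finally have g: "(?g has_derivative (\<lambda>\<tau>. (\<Sum>i\<in>UNIV. \<Sum>j\<in>UNIV. a t $ i * b t $ j * dw (z t) (z' \<tau>) (axis i 1) (axis j 1)) +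
     w (z t) (a' \<tau>) (b t) + w (z t) (a t) (b' \<tau>))) (at t)" .
  have "(z \<longlongrightarrow> z t) (at t)" using has_derivative_continuous[OF z(2)] by (simp add: continuous_at)
  then have "\<forall>\<^sub>F s in at t. z s \<in> U" using open_U z(1) by (rule topological_tendstoD)
  then have "\<forall>\<^sub>F s in at t. ?g s = w (z s) (a s) (b s)"
    by eventually_elim (rule bilinear_expand[OF bil, symmetric])
  then show ?thesis
    by (intro has_derivative_transform_eventually[OF g] bilinear_expand[OF bil[OF z(1)], symmetric]) auto
qed

text \<open>The rule just proved, for constant arguments: uniqueness of derivatives yields
  bilinearity of \<open>dw x d\<close>.\<close>

lemma dw_expand:
  assumes "x \<in> U"
  shows "dw x d u v = (\<Sum>i\<in>UNIV. \<Sum>j\<in>UNIV. u $ i * v $ j * dw x d (axis i 1) (axis j 1))"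
proof -
  have "((\<lambda>y. w y u v) has_derivative (\<lambda>\<tau>. (\<Sum>i\<in>UNIV. \<Sum>j\<in>UNIV. u $ i * v $ j * dw x \<tau> (axis i 1) (axis j 1)))) (at x)"
    using has_derivative_form_aux[of id x id "\<lambda>_. u" "\<lambda>_. 0" "\<lambda>_. v" "\<lambda>_. 0"] assms bil[OF assms]
    by (simp add: id_def bilinear_lzero bilinear_rzero)
  from fun_cong[OF frechet_derivative_at[OF this], of d] show ?thesis by (simp add: dw_def)
qed

lemma has_derivative_form:
  fixes z :: "'t::real_normed_vector \<Rightarrow> real ^ 'n"
  assumes z: "z t \<in> U" "(z has_derivative z') (at t)"
    and a: "(a has_derivative a') (at t)" and b: "(b has_derivative b') (at t)"
  shows "((\<lambda>t. w (z t) (a t) (b t)) has_derivative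
     (\<lambda>\<tau>. dw (z t) (z' \<tau>) (a t) (b t) + w (z t) (a' \<tau>) (b t) + w (z t) (a t) (b' \<tau>))) (at t)"
  using has_derivative_form_aux[OF z a b] unfolding dw_expand[OF z(1), symmetric] .

text \<open>Cartan's formula: the Lie derivative of \<open>w\<close> is the exterior derivative of
  the contraction of \<open>w\<close> with \<open>X\<close>, plus the contraction of the exterior
  derivative of \<open>w\<close>. The former is 0 because the contraction is the differential of
  \<open>h\<close> and second derivatives commute, the latter because \<open>w\<close> is
  closed.\<close>

lemma lie_derivative_form:
  assumes x: "x \<in> U"
  shows "dw x (X x) u v + w x (X' x u) v + w x u (X' x v) = 0"
proof -
  \<comment> \<open>Differentiating \<open>X_eq\<close> along \<open>d\<close> expresses the Hessian
    of \<open>h\<close> through \<open>dw\<close> and \<open>X'\<close>; its symmetry enters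
    next.\<close>
  have hess: "dw x d (X x) v + w x (X' x d) v = frechet_derivative (\<lambda>y. frechet_derivative h (at y) v) (at x) d" for d v
  proof -
    have "((\<lambda>y. w y (X y) v) has_derivative (\<lambda>d. dw x d (X x) v + w x (X' x d) v)) (at x)"
      using has_derivative_form[of id x id X "X' x" "\<lambda>_. v" "\<lambda>_. 0"] x X_has_derivative[OF x] bil[OF x]
      by (simp add: id_def bilinear_rzero)
    then have "((\<lambda>y. frechet_derivative h (at y) v) has_derivative (\<lambda>d. dw x d (X x) v + w x (X' x d) v)) (at x)"
      using open_U x X_eq by (rule has_derivative_transform_within_open)
    from fun_cong[OF frechet_derivative_at[OF this], of d] show ?thesis .
  qed
  have sym: "dw x u (X x) v + w x (X' x u) v = dw x v (X x) u + w x (X' x v) u"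
    unfolding hess by (rule second_derivative_symmetric[OF open_U x h_C1 h_C2])
  have anti: "dw x d p q = - dw x d q p" for d p q
  proof -
    have "((\<lambda>y. - w y q p) has_derivative (\<lambda>d. - dw x d q p)) (at x)"
      using has_derivative_minus[OF C1_on_has_derivative[OF w_C1[of q p] x]] by (simp add: dw_def)
    then have "((\<lambda>y. w y p q) has_derivative (\<lambda>d. - dw x d q p)) (at x)"
      using open_U x by (rule has_derivative_transform_within_open) (rule antisym[symmetric])
    from fun_cong[OF frechet_derivative_at[OF this], of d] show ?thesis by (simp add: dw_def)
  qed
  have "dw x u v (X x) + dw x v (X x) u + dw x (X x) u v = 0"
    unfolding dw_def by (rule w_closed[OF x])
  then show ?thesis using sym anti[of u v "X x"] antisym[OF x, of u "X' x v"] by linarith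
qed

section \<open>Distortion of form and density by an Euler step\<close>

lemma continuous_dw:
  assumes "continuous_on S z" "z ` S \<subseteq> U" "continuous_on S d" "continuous_on S a" "continuous_on S b"
  shows "continuous_on S (\<lambda>p. dw (z p) (d p) (a p) (b p))"
proof -
  have dw: "dw x d a b = (\<Sum>i\<in>UNIV. \<Sum>j\<in>UNIV. a $ i * b $ j * (\<Sum>k\<in>UNIV. d $ k * dw x (axis k 1) (axis i 1) (axis j 1)))"
    if "x \<in> U" for x d a b
  proof -
    have "dw x d u v = (\<Sum>k\<in>UNIV. d $ k * dw x (axis k 1) u v)" for u v
    proof -
      have "dw x (\<Sum>k\<in>UNIV. d $ k *\<^sub>R axis k 1) u v = (\<Sum>k\<in>UNIV. d $ k * dw x (axis k 1) u v)"
        using linear_sum[OF linear_dw[OF that, of u v], of "\<lambda>k. d $ k *\<^sub>R axis k 1" UNIV] linear_cmul[OF linear_dw[OF that, of u v]] by simp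
      then show ?thesis using basis_expansion[of d] by (simp add: scalar_mult_eq_scaleR)
    qed
    then show ?thesis using dw_expand[OF that, of d a b] by simp
  qed
  have "continuous_on S (\<lambda>p. dw (z p) u v v')" for u v v'
    unfolding dw_def by (rule continuous_on_compose2[OF C1_on_continuous_deriv[OF w_C1] assms(1,2)])
  then have "continuous_on S (\<lambda>p. \<Sum>i\<in>UNIV. \<Sum>j\<in>UNIV. a p $ i * b p $ j * (\<Sum>k\<in>UNIV. d p $ k * dw (z p) (axis k 1) (axis i 1) (axis j 1)))"
    using assms by (intro continuous_intros)
  then show ?thesis
    by (rule continuous_on_eq) (use dw assms(2) in \<open>auto simp: image_subset_iff\<close>)
qed

lemma continuous_form:
  assumes "continuous_on S z" "z ` S \<subseteq> U" "continuous_on S a" "continuous_on S b"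
  shows "continuous_on S (\<lambda>p. w (z p) (a p) (b p))"
proof -
  have "continuous_on S (\<lambda>p. w (z p) u v)" for u v
    by (rule continuous_on_compose2[OF C1_on_continuous[OF w_C1] assms(1,2)])
  then have "continuous_on S (\<lambda>p. \<Sum>i\<in>UNIV. \<Sum>j\<in>UNIV. a p $ i * b p $ j * w (z p) (axis i 1) (axis j 1))"
    using assms by (intro continuous_intros)
  then show ?thesis
  proof (rule continuous_on_eq)
    fix p assume "p \<in> S"
    then have "z p \<in> U" using assms(2) by auto
    from bilinear_expand[OF bil[OF this], of "a p" "b p"]
    show "(\<Sum>i\<in>UNIV. \<Sum>j\<in>UNIV. a p $ i * b p $ j * w (z p) (axis i 1) (axis j 1)) = w (z p) (a p) (b p)" by simp
  qed
qed

text \<open>The family is the pullback of the form under the Euler step, whose differential sends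
  \<open>v\<close> to \<open>v + s *\<^sub>R X' x v\<close>. Its derivative \<open>D\<close> in
  \<open>s\<close> is at \<open>s = 0\<close> the Lie derivative, hence 0; uniform continuity of
  \<open>D\<close> on a compact set and the mean value theorem give the uniform
  \<open>o(s)\<close>.\<close>

lemma form_flat_on:
  assumes R: "R > 0" and K: "cball x\<^sub>0 (3 * R) \<subseteq> U" and M: "M > 0" "\<And>x. x \<in> cball x\<^sub>0 (2 * R) \<Longrightarrow> norm (X x) \<le> M"
  shows "flat_on (cball x\<^sub>0 (2 * R)) (\<lambda>s x. w (x + s *\<^sub>R X x) (u + s *\<^sub>R X' x u) (v + s *\<^sub>R X' x v))"
proof -
  \<comment> \<open>Steps of size at most \<open>R / M\<close> lead from radius \<open>2 * R\<close>
    to radius at most \<open>3 * R\<close>, hence stay in \<open>U\<close>.\<close>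
  let ?K = "cball x\<^sub>0 (2 * R)" and ?s = "R / M"
  define z where "z s x = x + s *\<^sub>R X x" for s x
  define a where "a u s x = u + s *\<^sub>R X' x u" for u s x
  define D where "D s x = dw (z s x) (X x) (a u s x) (a v s x) + w (z s x) (X' x u) (a v s x) + w (z s x) (a u s x) (X' x v)" for s x
  have s0: "?s > 0" using R M by simp
  have KU: "?K \<subseteq> U" using subset_cball[of "2 * R" "3 * R" x\<^sub>0] K R by auto
  have zU: "z s x \<in> U" if "s \<in> {0..?s}" "x \<in> ?K" for s x
  proof -
    have "s * norm (X x) \<le> ?s * M" by (rule mult_mono) (use that M s0 in auto)
    then have "dist x (z s x) \<le> R" using that M by (simp add: z_def dist_norm)
    then have "dist x\<^sub>0 (z s x) \<le> 3 * R" using that(2) dist_triangle[of x\<^sub>0 "z s x" x] by simp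
    then show ?thesis using K by auto
  qed
  have cont: "continuous_on ({0..?s} \<times> ?K) (\<lambda>p. D (fst p) (snd p))"
  proof -
    have X: "continuous_on ({0..?s} \<times> ?K) (\<lambda>p. X (snd p))" "continuous_on ({0..?s} \<times> ?K) (\<lambda>p. X' (snd p) u)" for u
      by (rule continuous_on_compose2[OF continuous_X] continuous_on_compose2[OF continuous_X'], use KU in \<open>auto intro!: continuous_intros\<close>)+
    show ?thesis unfolding D_def
      by (intro continuous_on_add continuous_dw continuous_form)
         (use zU in \<open>auto simp: z_def a_def intro!: continuous_intros X\<close>)
  qed
  have D0: "D 0 x = 0" if "x \<in> ?K" for x
    using lie_derivative_form[of x u v] KU that by (auto simp: D_def z_def a_def)
  have deriv: "((\<lambda>s. w (z s x) (a u s x) (a v s x)) has_derivative (\<lambda>\<sigma>. \<sigma> * D s x)) (at s)"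
    if "s \<in> {0..?s}" "x \<in> ?K" for s x
  proof -
    have z': "((\<lambda>s. z s x) has_derivative (\<lambda>\<sigma>. \<sigma> *\<^sub>R X x)) (at s)"
      and a': "((\<lambda>s. a u s x) has_derivative (\<lambda>\<sigma>. \<sigma> *\<^sub>R X' x u)) (at s)" for u
      unfolding z_def a_def by (auto intro!: derivative_eq_intros)
    have U: "z s x \<in> U" by (rule zU[OF that])
    show ?thesis
      using has_derivative_form[of "\<lambda>s. z s x", OF U z' a'[of u] a'[of v]] bil[OF U]
      by (simp add: D_def bilinear_lmul bilinear_rmul linear_cmul[OF linear_dw[OF U]] distrib_left)
  qed
  show ?thesis unfolding flat_on_def
  proof (intro conjI allI impI)
    fix \<epsilon> :: real assume \<epsilon>: "\<epsilon> > 0"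
    have "uniformly_continuous_on ({0..?s} \<times> ?K) (\<lambda>p. D (fst p) (snd p))"
      by (rule compact_uniformly_continuous[OF cont]) (intro compact_Times compact_Icc compact_cball)
    then obtain \<delta> where \<delta>: "\<delta> > 0" "\<And>p q. p \<in> {0..?s} \<times> ?K \<Longrightarrow> q \<in> {0..?s} \<times> ?K \<Longrightarrow> dist q p < \<delta> \<Longrightarrow>
        dist (D (fst q) (snd q)) (D (fst p) (snd p)) < \<epsilon>"
      using \<epsilon> unfolding uniformly_continuous_on_def by metis
    have small: "\<bar>D s x\<bar> \<le> \<epsilon>" if "0 \<le> s" "s < \<delta>" "s \<le> ?s" "x \<in> ?K" for s x
      using \<delta>(2)[of "(0, x)" "(s, x)"] that D0[OF that(4)] s0 by (simp add: dist_Pair_Pair)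
    show "\<exists>\<delta>>0. \<forall>s. 0 < s \<longrightarrow> s < \<delta> \<longrightarrow> (\<forall>x\<in>?K. \<bar>w (x + s *\<^sub>R X x) (u + s *\<^sub>R X' x u) (v + s *\<^sub>R X' x v) -
        w (x + 0 *\<^sub>R X x) (u + 0 *\<^sub>R X' x u) (v + 0 *\<^sub>R X' x v)\<bar> \<le> \<epsilon> * s)"
    proof (intro exI[of _ "min \<delta> ?s"] conjI allI impI ballI)
      fix s x assume s: "0 < s" "s < min \<delta> ?s" and x: "x \<in> ?K"
      have "\<exists>\<xi>\<in>{0<..<s}. w (z s x) (a u s x) (a v s x) - w (z 0 x) (a u 0 x) (a v 0 x) = (s - 0) * D \<xi> x"
      proof (rule mvt_simple[where f = "\<lambda>s. w (z s x) (a u s x) (a v s x)" and f' = "\<lambda>\<xi> \<sigma>. \<sigma> * D \<xi> x", OF s(1)])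
        fix \<xi> assume "0 \<le> \<xi>" "\<xi> \<le> s"
        then show "((\<lambda>s. w (z s x) (a u s x) (a v s x)) has_derivative (\<lambda>\<sigma>. \<sigma> * D \<xi> x)) (at \<xi> within {0..s})"
          using s x by (intro has_derivative_at_withinI[OF deriv]) auto
      qed
      then obtain \<xi> where \<xi>: "\<xi> \<in> {0<..<s}" "w (z s x) (a u s x) (a v s x) - w (z 0 x) (a u 0 x) (a v 0 x) = (s - 0) * D \<xi> x"
        by blast
      have "\<bar>(s - 0) * D \<xi> x\<bar> \<le> \<epsilon> * s"
        using small[of \<xi> x] \<xi>(1) s x by (simp add: abs_mult mult.commute)
      then show "\<bar>w (x + s *\<^sub>R X x) (u + s *\<^sub>R X' x u) (v + s *\<^sub>R X' x v) -
        w (x + 0 *\<^sub>R X x) (u + 0 *\<^sub>R X' x u) (v + 0 *\<^sub>R X' x v)\<bar> \<le> \<epsilon> * s"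
        using \<xi>(2) unfolding z_def a_def by simp
    qed (use \<delta> s0 in auto)
  next
    have "continuous_on ?K (\<lambda>x. w x u v)" using C1_on_continuous[OF w_C1] KU by (rule continuous_on_subset)
    from compact_continuous_image[OF this compact_cball, THEN compact_imp_bounded]
    show "\<exists>C. \<forall>x\<in>?K. \<bar>w (x + 0 *\<^sub>R X x) (u + 0 *\<^sub>R X' x u) (v + 0 *\<^sub>R X' x v)\<bar> \<le> C"
      by (auto simp: bounded_iff)
  qed
qed

definition \<rho> :: "real ^ 'n \<Rightarrow> real" where
  "\<rho> x = \<bar>wedge_power r (w x) enum_axis\<bar> / fact r"

lemma continuous_\<rho>: "continuous_on U \<rho>"
  unfolding \<rho>_def wedge_power_def by (intro continuous_intros C1_on_continuous[OF w_C1]) auto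

lemma wedge_power_image:
  assumes b: "bilinear b" and D: "linear D"
  shows "wedge_power r (\<lambda>u v. b (D u) (D v)) enum_axis = jacobian D * wedge_power r b (enum_axis :: nat \<Rightarrow> real ^ 'n)"
proof -
  have "D (enum_axis j) = (\<Sum>i<2 * r. (D (enum_axis j) $ from_nat_into UNIV i) *\<^sub>R enum_axis i)" for j
    using basis_expansion[of "D (enum_axis j)"] sum_enum[of "\<lambda>i. D (enum_axis j) $ i *\<^sub>R axis i 1"]
    unfolding enum_axis_def dim scalar_mult_eq_scaleR by (rule trans[OF sym sym])
  then have "wedge_power r b (\<lambda>j. D (enum_axis j)) = jacobian D * wedge_power r b enum_axis"
    unfolding jacobian_def dim by (intro wedge_power_linear_image[OF b])
  then show ?thesis by (simp add: wedge_power_def)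
qed

lemma linear_X': "x \<in> U \<Longrightarrow> linear (X' x)"
  using has_derivative_linear[OF X_has_derivative] .

text \<open>The top power is a polynomial in the values of the form, so it inherits flatness; by
  \<open>wedge_power_image\<close> its pullback is the Jacobian times the top power at the new
  point.\<close>

lemma density_distortion:
  assumes R: "R > 0" and K: "cball x\<^sub>0 (3 * R) \<subseteq> U" and M: "M > 0" "\<And>x. x \<in> cball x\<^sub>0 (2 * R) \<Longrightarrow> norm (X x) \<le> M"
    and \<epsilon>: "\<epsilon> > 0"
  shows "\<exists>\<delta>>0. \<forall>s. 0 < s \<longrightarrow> s < \<delta> \<longrightarrow> (\<forall>x\<in>cball x\<^sub>0 (2 * R).
        \<rho> x \<le> \<bar>jacobian (\<lambda>v. v + s *\<^sub>R X' x v)\<bar> * \<rho> (x + s *\<^sub>R X x) + \<epsilon> * s)"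
proof -
  let ?K = "cball x\<^sub>0 (2 * R)"
  let ?P = "\<lambda>s x. wedge_power r (\<lambda>u v. w (x + s *\<^sub>R X x) (u + s *\<^sub>R X' x u) (v + s *\<^sub>R X' x v)) enum_axis"
  have flat: "flat_on ?K ?P"
    unfolding wedge_power_def divide_inverse
    by (intro flat_on_mult flat_on_const flat_on_sum flat_on_prod form_flat_on[OF R K M])
  obtain \<delta> where \<delta>: "\<delta> > 0" "\<And>s x. 0 < s \<Longrightarrow> s < \<delta> \<Longrightarrow> x \<in> ?K \<Longrightarrow> \<bar>?P s x - ?P 0 x\<bar> \<le> \<epsilon> * s"
    using flat_onD[OF flat \<epsilon>] by blast
  show ?thesis
  proof (intro exI[of _ "min \<delta> (R / M)"] conjI allI impI ballI)
    fix s x assume s: "0 < s" "s < min \<delta> (R / M)" and x: "x \<in> ?K"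
    have "s * norm (X x) \<le> R / M * M" by (rule mult_mono) (use s x M R in auto)
    then have "dist x (x + s *\<^sub>R X x) \<le> R" using s M by (simp add: dist_norm)
    then have "dist x\<^sub>0 (x + s *\<^sub>R X x) \<le> 3 * R" using x dist_triangle[of x\<^sub>0 "x + s *\<^sub>R X x" x] by simp
    then have zU: "x + s *\<^sub>R X x \<in> U" using K by auto
    have xU: "x \<in> U" using x K R by auto
    have "linear (\<lambda>v. v + s *\<^sub>R X' x v)"
      using linear_X'[OF xU] by (intro linear_compose_add linear_compose_scale_right linear_id[unfolded id_def])
    then have P: "?P s x = jacobian (\<lambda>v. v + s *\<^sub>R X' x v) * wedge_power r (w (x + s *\<^sub>R X x)) enum_axis"
      by (rule wedge_power_image[OF bil[OF zU]])
    have "\<bar>?P 0 x\<bar> \<le> \<bar>?P s x\<bar> + \<epsilon> * s" using \<delta>(2)[of s x] s x by auto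
    then have "\<bar>wedge_power r (w x) enum_axis\<bar> / fact r \<le> (\<bar>?P s x\<bar> + \<epsilon> * s) / fact r"
      by (intro divide_right_mono) auto
    also have "\<dots> \<le> \<bar>?P s x\<bar> / fact r + \<epsilon> * s"
    proof -
      have "\<epsilon> * s / fact r \<le> \<epsilon> * s / 1" using \<epsilon> s by (intro divide_left_mono) (auto simp: fact_ge_1)
      then show ?thesis by (simp add: add_divide_distrib)
    qed
    finally show "\<rho> x \<le> \<bar>jacobian (\<lambda>v. v + s *\<^sub>R X' x v)\<bar> * \<rho> (x + s *\<^sub>R X x) + \<epsilon> * s"
      unfolding P \<rho>_def by (simp add: abs_mult)
  qed (use \<delta> R M in auto)
qed

lemma euler_scheme_exists:
  assumes R: "R > 0" and K: "cball x\<^sub>0 (3 * R) \<subseteq> U"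
  shows "\<exists>M L. euler_scheme x\<^sub>0 R M L X X' \<rho>"
proof -
  let ?K = "cball x\<^sub>0 (2 * R)"
  have KU: "?K \<subseteq> U" using subset_cball[of "2 * R" "3 * R" x\<^sub>0] K R by auto
  have bdd: "\<exists>B. \<forall>x\<in>?K. norm (f x) \<le> B" if "continuous_on U f" for f :: "real ^ 'n \<Rightarrow> real ^ 'n"
    using compact_continuous_image[OF continuous_on_subset[OF that KU] compact_cball, THEN compact_imp_bounded]
    by (auto simp: bounded_iff)
  obtain M0 where M0: "\<And>x. x \<in> ?K \<Longrightarrow> norm (X x) \<le> M0" using bdd[OF continuous_X] by blast
  define M where "M = \<bar>M0\<bar> + 1"
  have M: "M > 0" "\<And>x. x \<in> ?K \<Longrightarrow> norm (X x) \<le> M" using M0 by (fastforce simp: M_def)+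
  have "\<forall>v. \<exists>B. \<forall>x\<in>?K. norm (X' x v) \<le> B" using bdd[OF continuous_X'] by blast
  then obtain B where B: "\<And>v x. x \<in> ?K \<Longrightarrow> norm (X' x v) \<le> B v" by metis
  \<comment> \<open>By linearity of \<open>X' x\<close>, bounds on its columns bound its operator
    norm; adding 1 makes the constant positive.\<close>
  define L where "L = (\<Sum>j\<in>UNIV. \<bar>B (axis j 1)\<bar>) + 1"
  have L: "L > 0" by (simp add: L_def add_nonneg_pos sum_nonneg)
  have X'L: "onorm (X' x) \<le> L" if x: "x \<in> ?K" for x
  proof (rule onorm_le)
    fix v
    have "X' x (\<Sum>j\<in>UNIV. v $ j *\<^sub>R axis j 1) = (\<Sum>j\<in>UNIV. v $ j *\<^sub>R X' x (axis j 1))"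
      using linear_X'[of x] x KU by (auto simp: linear_sum linear_cmul)
    then have "norm (X' x v) = norm (\<Sum>j\<in>UNIV. v $ j *\<^sub>R X' x (axis j 1))"
      using basis_expansion[of v] by (simp add: scalar_mult_eq_scaleR)
    also have "\<dots> \<le> (\<Sum>j\<in>UNIV. norm v * \<bar>B (axis j 1)\<bar>)"
    proof (rule sum_norm_le)
      fix j
      have "norm (X' x (axis j 1)) \<le> \<bar>B (axis j 1)\<bar>" using B[OF x, of "axis j 1"] by linarith
      then show "norm (v $ j *\<^sub>R X' x (axis j 1)) \<le> norm v * \<bar>B (axis j 1)\<bar>"
        using component_le_norm_cart[of v j] by (simp add: mult_mono)
    qed
    also have "\<dots> \<le> L * norm v" by (simp add: L_def sum_distrib_left[symmetric] algebra_simps)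
    finally show "norm (X' x v) \<le> L * norm v" .
  qed
  have "euler_scheme x\<^sub>0 R M L X X' \<rho>"
  proof
    fix x y assume xy: "x \<in> ?K" "y \<in> ?K"
    show "norm (X x - X y) \<le> L * norm (x - y)"
      by (rule differentiable_bound[where S = ?K and f' = X'])
         (use xy X'L KU in \<open>auto intro!: has_derivative_at_withinI[OF X_has_derivative]\<close>)
  next
    fix \<epsilon> :: real assume "\<epsilon> > 0"
    show "\<exists>\<delta>>0. \<forall>s. 0 < s \<longrightarrow> s < \<delta> \<longrightarrow> (\<forall>x\<in>?K.
        \<rho> x \<le> \<bar>jacobian (\<lambda>v. v + s *\<^sub>R X' x v)\<bar> * \<rho> (x + s *\<^sub>R X x) + \<epsilon> * s)"
      by (rule density_distortion[OF R K M(1) _ \<open>\<epsilon> > 0\<close>]) (rule M(2))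
  qed (use R M L KU continuous_on_subset[OF continuous_X' KU] continuous_on_subset[OF continuous_\<rho> KU]
        in \<open>auto intro!: X_has_derivative simp: \<rho>_def\<close>)
  then show ?thesis by blast
qed

end

section \<open>The Hamiltonian flow and Liouville's theorem\<close>

lemma solves_hamilton_shift: "solves_hamilton atlas \<omega> H g \<Longrightarrow> solves_hamilton atlas \<omega> H (\<lambda>s. g (s + t))"
  unfolding solves_hamilton_def
proof (safe)
  assume g: "continuous_on UNIV g" "\<forall>t. \<forall>c\<in>atlas. g t \<in> fst c \<longrightarrow>
        (\<exists>X. ((\<lambda>s. snd c (g s)) has_vector_derivative X) (at t) \<and>
             (\<forall>v. \<omega> c (snd c (g t)) X v = differential c H (g t) v))"
  show "continuous_on UNIV (\<lambda>s. g (s + t))"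
    by (rule continuous_on_compose2[OF g(1)]) (auto intro!: continuous_intros)
  fix u a b assume c: "(a, b) \<in> atlas" "g (u + t) \<in> fst (a, b)"
  then obtain X where X: "((\<lambda>s. snd (a, b) (g s)) has_vector_derivative X) (at (u + t))"
      "\<forall>v. \<omega> (a, b) (snd (a, b) (g (u + t))) X v = differential (a, b) H (g (u + t)) v" using g(2) by blast
  have "((\<lambda>s. s + t) has_vector_derivative 1) (at u)" by (auto intro!: derivative_eq_intros)
  from vector_diff_chain_at[OF this X(1)]
  show "\<exists>X. ((\<lambda>s. snd (a, b) (g (s + t))) has_vector_derivative X) (at u) \<and>
             (\<forall>v. \<omega> (a, b) (snd (a, b) (g (u + t))) X v = differential (a, b) H (g (u + t)) v)"
    using X(2) by (auto simp: comp_def)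
qed

lemma frechet_derivative_cong_open:
  assumes "open S" "x \<in> S" "\<And>y. y \<in> S \<Longrightarrow> f y = g y" "f differentiable (at x)"
  shows "frechet_derivative f (at x) = frechet_derivative g (at x)"
  by (rule frechet_derivative_at[OF has_derivative_transform_within_open[OF assms(4)[unfolded frechet_derivative_works] assms(1-3)]])

lemma C_k_on_cong:
  assumes "open S"
  shows "(\<And>x. x \<in> S \<Longrightarrow> f x = g x) \<Longrightarrow> C_k_on k f S \<Longrightarrow> C_k_on k g S"
proof (induction k arbitrary: f g)
  case 0
  then show ?case by (simp cong: continuous_on_cong)
next
  case (Suc k)
  have d: "f differentiable (at x)" if "x \<in> S" for x
    using Suc.prems(2) that by (simp add: differentiable_on_def at_within_open[OF _ assms])
  have "frechet_derivative f (at x) v = frechet_derivative g (at x) v" if "x \<in> S" for x v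
    using frechet_derivative_cong_open[OF assms that Suc.prems(1) d[OF that]] by simp
  then have "C_k_on k (\<lambda>x. frechet_derivative g (at x) v) S" for v
    using Suc.IH[of "\<lambda>x. frechet_derivative f (at x) v" "\<lambda>x. frechet_derivative g (at x) v"] Suc.prems(2) by simp
  moreover have "g differentiable (at x)" if "x \<in> S" for x
    using has_derivative_transform_within_open[OF d[OF that, unfolded frechet_derivative_works] assms that Suc.prems(1)]
    by (auto simp: differentiable_def)
  then have "g differentiable_on S"
    by (simp add: differentiable_on_def at_within_open[OF _ assms])
  ultimately show ?case by simp
qed

text \<open>Prepares the sign change of the Hamiltonian under time reversal. The derivatives of
  \<open>- f\<close> and \<open>f\<close> are known to be opposite on \<open>S\<close> only, whence
  the detour through \<open>C_k_on_cong\<close>.\<close>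

lemma C_k_on_minus:
  assumes "open S"
  shows "C_k_on k f S \<Longrightarrow> C_k_on k (\<lambda>x. - f x) S"
proof (induction k arbitrary: f)
  case 0
  then show ?case by (simp add: continuous_on_minus)
next
  case (Suc k)
  have "- frechet_derivative f (at x) v = frechet_derivative (\<lambda>x. - f x) (at x) v" if "x \<in> S" for x v
  proof -
    have "(f has_derivative frechet_derivative f (at x)) (at x)"
      using Suc.prems that by (simp add: differentiable_on_def at_within_open[OF _ assms] frechet_derivative_works)
    from fun_cong[OF frechet_derivative_at[OF has_derivative_minus[OF this]], of v] show ?thesis .
  qed
  then have "C_k_on k (\<lambda>x. frechet_derivative (\<lambda>x. - f x) (at x) v) S" for v
    using C_k_on_cong[OF assms _ Suc.IH, of "\<lambda>x. frechet_derivative f (at x) v"] Suc.prems by simp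
  moreover have "(\<lambda>x. - f x) differentiable_on S" using Suc.prems by (simp add: differentiable_on_minus)
  ultimately show ?case by simp
qed

lemma smooth_on_minus: "open S \<Longrightarrow> smooth_on S f \<Longrightarrow> smooth_on S (\<lambda>x. - f x)"
  by (simp add: smooth_on_def C_k_on_minus)

context hamiltonian_system
begin

context
  fixes c p R
  assumes c: "c \<in> atlas" and p: "p \<in> fst c" and R: "R > 0" "cball (snd c p) (3 * R) \<subseteq> chart_image c"
begin

section \<open>A flow box for nonnegative times\<close>

lemma chart_inverse: "m \<in> fst c \<Longrightarrow> chart_inv c (snd c m) = m" "x \<in> chart_image c \<Longrightarrow> snd c (chart_inv c x) = x"
  "x \<in> chart_image c \<Longrightarrow> chart_inv c x \<in> fst c" "m \<in> fst c \<Longrightarrow> snd c m \<in> chart_image c"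
  using homeo[OF c] by (auto simp: homeomorphism_def)

lemma chart_continuous: "continuous_on (fst c) (snd c)" "continuous_on (chart_image c) (chart_inv c)"
  using homeo[OF c] by (auto simp: homeomorphism_def)

interpretation D: hamiltonian_domain "chart_image c" "\<omega> c" "H \<circ> chart_inv c" r
proof
  show "smooth_on (chart_image c) (H \<circ> chart_inv c)"
    using hamiltonian_smooth c by (simp add: smooth_fun_def)
  show "open (chart_image c)" "CARD('n) = 2 * r" "smooth_on (chart_image c) (\<lambda>x. \<omega> c x u v)" for u v
    by (rule open_image[OF c] dimension form_smooth[OF c])+
  fix x u v z
  assume x: "x \<in> chart_image c"
  show "bilinear (\<omega> c x)" "\<omega> c x u v = - \<omega> c x v u"
    by (rule form_bilinear[OF c x] form_antisym[OF c x])+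
  show "u = 0" if "\<And>v. \<omega> c x u v = 0" using form_nondegenerate[OF c x] that by blast
  show "frechet_derivative (\<lambda>y. \<omega> c y v z) (at x) u + frechet_derivative (\<lambda>y. \<omega> c y z u) (at x) v +
    frechet_derivative (\<lambda>y. \<omega> c y u v) (at x) z = 0" by (rule form_closed[OF c x])
qed

text \<open>Solutions that start in the inner chart ball stay in the chart up to a uniform positive time.\<close>

lemma forward_flow_box_in_chart:
  "\<exists>V \<tau>. open V \<and> p \<in> V \<and> \<tau> > 0 \<and> continuous_on (V \<times> {0..\<tau>}) (\<lambda>(m, t). \<gamma> m t) \<and>
     (\<forall>t\<in>{0..\<tau>}. \<forall>B\<in>sets borel. emeasure dm {m \<in> V. \<gamma> m t \<in> B} \<le> emeasure dm B) \<and>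
     (\<forall>g g'. solves_hamilton atlas \<omega> H g \<longrightarrow> solves_hamilton atlas \<omega> H g' \<longrightarrow> g 0 = g' 0 \<longrightarrow> g 0 \<in> V \<longrightarrow>
        (\<forall>t\<in>{0..\<tau>}. g t = g' t))"
proof -
  let ?x = "snd c p" and ?U = "chart_image c" and ?i = "chart_inv c"
  obtain M L where eul: "euler_scheme ?x R M L D.X D.X' D.\<rho>" using D.euler_scheme_exists[OF R] by blast
  interpret E: euler_scheme ?x R M L D.X D.X' D.\<rho> by (rule eul)
  \<comment> \<open>The closed ball gives a compact, hence closed subset of the Hausdorff manifold,
    the open balls give open ones; the first-exit argument needs both kinds.\<close>
  define W where "W = ?i ` E.K"
  define W' where "W' = ?i ` ball ?x (2 * R)"
  define V where "V = ?i ` ball ?x R"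
  have KU: "E.K \<subseteq> ?U" using subset_cball[of "2 * R" "3 * R" ?x] R by auto
  have bK: "ball ?x R \<subseteq> ball ?x (2 * R)" "ball ?x (2 * R) \<subseteq> E.K" using R by auto
  have bU: "ball ?x R \<subseteq> ?U" "ball ?x (2 * R) \<subseteq> ?U" using bK KU by blast+
  have open_img: "open (?i ` B)" if "open B" "B \<subseteq> ?U" for B
  proof -
    have "?i ` B = fst c \<inter> snd c -` B"
      using that chart_inverse by (auto simp: image_iff) (metis)
    then show ?thesis
      using continuous_openin_preimage_gen[OF chart_continuous(1) that(1)] open_domain[OF c]
      by (simp add: openin_open_eq)
  qed
  have openV: "open V" and openW': "open W'" unfolding V_def W'_def by (rule open_img[OF open_ball bU(1)], rule open_img[OF open_ball bU(2)])
  have "compact W" unfolding W_def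
    by (rule compact_continuous_image[OF continuous_on_subset[OF chart_continuous(2) KU] compact_cball])
  then have closedW: "closed W" by (rule compact_imp_closed)
  have sub: "V \<subseteq> W'" "W' \<subseteq> W" "W \<subseteq> fst c" unfolding V_def W'_def W_def using bK KU chart_inverse(3) by auto
  have pV: "p \<in> V" unfolding V_def using R chart_inverse(1)[OF p] by (auto intro!: image_eqI[of _ _ ?x])
  have coordV: "snd c m \<in> ball ?x R" if "m \<in> V" for m
    using that bU(1) chart_inverse(2) unfolding V_def by fastforce
  have coordW': "snd c m \<in> ball ?x (2 * R)" if "m \<in> W'" for m
    using that bU(2) chart_inverse(2) unfolding W'_def by fastforce
  have coordW: "snd c m \<in> E.K" if "m \<in> W" for m
    using that KU chart_inverse(2) unfolding W_def by fastforce
  define \<tau> where "\<tau> = R / M"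
  have \<tau>: "\<tau> > 0" "\<tau> * M \<le> R" using R E.M_pos by (auto simp: \<tau>_def)

  have deriv: "((\<lambda>s. snd c (g s)) has_vector_derivative D.X (snd c (g t))) (at t)"
    if g: "solves_hamilton atlas \<omega> H g" and t: "g t \<in> fst c" for g t
  proof -
    obtain Y where Y: "((\<lambda>s. snd c (g s)) has_vector_derivative Y) (at t)"
        "\<forall>v. \<omega> c (snd c (g t)) Y v = differential c H (g t) v"
      using g t c unfolding solves_hamilton_def by blast
    have "Y = D.X (snd c (g t))"
      using Y(2) by (intro D.X_unique chart_inverse(4) t) (simp add: differential_def)
    then show ?thesis using Y(1) by simp
  qed
  \<comment> \<open>Hamilton's equations say something in this chart only while the curve is in its
    domain. At the first exit time \<open>t1\<close> from \<open>W'\<close> the curve is still in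
    the closed set \<open>W\<close>, so up to then it is a solution in coordinates and has moved by
    at most \<open>R\<close>. It started strictly inside radius \<open>R\<close>, so it cannot have
    left \<open>W'\<close>.\<close>
  have stay: "g t \<in> W'" if g: "solves_hamilton atlas \<omega> H g" and g0: "g 0 \<in> V" and t: "t \<in> {0..\<tau>}" for g t
  proof (rule ccontr)
    assume nt: "g t \<notin> W'"
    have cont: "continuous_on UNIV g" using g by (simp add: solves_hamilton_def)
    have "closed (g -` (- W'))" using cont openW' by (intro closed_vimage) (auto simp: continuous_on_eq_continuous_within)
    then have "compact ({0..\<tau>} \<inter> g -` (- W'))" by (intro compact_Int_closed) auto
    moreover have "{0..\<tau>} \<inter> g -` (- W') \<noteq> {}" using t nt by auto
    ultimately obtain t1 where "t1 \<in> {0..\<tau>} \<inter> g -` (- W')" "\<forall>s\<in>{0..\<tau>} \<inter> g -` (- W'). t1 \<le> s"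
      using compact_attains_inf by blast
    then have t1: "t1 \<in> {0..\<tau>}" "g t1 \<notin> W'" "\<And>s. s \<in> {0..\<tau>} \<Longrightarrow> g s \<notin> W' \<Longrightarrow> t1 \<le> s" by auto
    have before: "g s \<in> W'" if "s \<in> {0..<t1}" for s using t1 that by force
    have "t1 \<noteq> 0" using t1(2) g0 sub by auto
    then have t1pos: "t1 > 0" using t1 by auto
    have "g t1 \<in> W"
    proof (rule Lim_in_closed_set[OF closedW])
      show "(g \<longlongrightarrow> g t1) (at_left t1)"
        using cont by (metis UNIV_I continuous_on_eq_continuous_within continuous_within tendsto_within_subset subset_UNIV)
      show "\<forall>\<^sub>F s in at_left t1. g s \<in> W"
        unfolding eventually_at_left_field using t1pos before sub by (intro exI[of _ 0]) auto
    qed simp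
    then have inW: "g s \<in> W" if "s \<in> {0..t1}" for s
      using before[of s] sub that by (cases "s = t1") auto
    let ?y = "\<lambda>s. snd c (g s)"
    have "E.solution t1 ?y"
      unfolding E.solution_def
    proof (intro ballI conjI)
      fix s assume "s \<in> {0..t1}"
      then have "g s \<in> W" by (rule inW)
      then show "snd c (g s) \<in> E.K" by (rule coordW)
      show "((\<lambda>s. snd c (g s)) has_vector_derivative D.X (snd c (g s))) (at s within {0..t1})"
        by (rule has_vector_derivative_at_within[OF deriv[OF g subsetD[OF sub(3) \<open>g s \<in> W\<close>]]])
    qed
    from E.solution_dist[OF this, of t1 0] have "norm (?y t1 - ?y 0) \<le> M * t1" using t1pos by simp
    also have "\<dots> \<le> \<tau> * M" using t1 E.M_pos by (simp add: mult.commute mult_left_mono)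
    finally have "dist (?y 0) (?y t1) \<le> R" using \<tau> by (simp add: dist_norm norm_minus_commute)
    moreover have "dist ?x (?y 0) < R" using coordV[OF g0] by simp
    ultimately have "?y t1 \<in> ball ?x (2 * R)" using dist_triangle[of ?x "?y t1" "?y 0"] by simp
    moreover have "g t1 = ?i (?y t1)" using inW[of t1] sub t1pos chart_inverse(1) by force
    ultimately have "g t1 \<in> W'" unfolding W'_def by blast
    then show False using t1(2) by simp
  qed
  have sol: "E.solution \<tau> (\<lambda>s. snd c (g s))" if g: "solves_hamilton atlas \<omega> H g" and g0: "g 0 \<in> V" for g
    unfolding E.solution_def
  proof (intro ballI conjI)
    fix t assume "t \<in> {0..\<tau>}"
    then have "g t \<in> W'" by (rule stay[OF g g0])
    then have W: "g t \<in> W" "g t \<in> fst c" using sub by auto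
    show "snd c (g t) \<in> E.K" by (rule coordW[OF W(1)])
    show "((\<lambda>s. snd c (g s)) has_vector_derivative D.X (snd c (g t))) (at t within {0..\<tau>})"
      by (rule has_vector_derivative_at_within[OF deriv[OF g W(2)]])
  qed
  let ?y = "\<lambda>x t. snd c (\<gamma> (?i x) t)"
  have iV: "?i x \<in> V" if "x \<in> ball ?x R" for x using that by (auto simp: V_def)
  have y: "E.solution \<tau> (?y x) \<and> ?y x 0 = x" if "x \<in> ball ?x R" for x
  proof
    show "?y x 0 = x" using flow_init subsetD[OF bU(1) that] by (simp add: chart_inverse(2))
    show "E.solution \<tau> (?y x)" using sol[OF flow_solves] flow_init iV[OF that] by simp
  qed
  have uniq: "g t = g' t" if g: "solves_hamilton atlas \<omega> H g" "solves_hamilton atlas \<omega> H g'" "g 0 = g' 0" "g 0 \<in> V"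
    and t: "t \<in> {0..\<tau>}" for g g' t
  proof -
    have "t * M \<le> \<tau> * M" using t E.M_pos by (intro mult_right_mono) auto
    then have "snd c (g t) = snd c (g' t)"
      using E.solution_unique[OF E.solution_subinterval[OF sol[OF g(1,4)]] E.solution_subinterval[OF sol[OF g(2)]], of t]
        g t \<tau> coordV[OF g(4)] by auto
    moreover have "g t \<in> fst c" "g' t \<in> fst c" using stay[OF g(1,4) t] stay[OF g(2) _ t] g(3,4) sub by auto
    ultimately show ?thesis using chart_inverse(1) by metis
  qed
  have cont: "continuous_on (V \<times> {0..\<tau>}) (\<lambda>(m, t). \<gamma> m t)"
  proof -
    have "continuous_on (ball ?x R \<times> {0..\<tau>}) (\<lambda>(x, t). ?y x t)"
      by (rule E.solution_continuous) (use y \<tau> in auto)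
    then have "continuous_on (V \<times> {0..\<tau>}) (\<lambda>p. case (snd c (fst p), snd p) of (x, t) \<Rightarrow> ?y x t)"
    proof (rule continuous_on_compose2)
      show "continuous_on (V \<times> {0..\<tau>}) (\<lambda>p. (snd c (fst p), snd p))"
        using sub by (intro continuous_intros continuous_on_compose2[OF chart_continuous(1)]) auto
      show "(\<lambda>p. (snd c (fst p), snd p)) ` (V \<times> {0..\<tau>}) \<subseteq> ball ?x R \<times> {0..\<tau>}"
        using coordV by auto
    qed
    then have "continuous_on (V \<times> {0..\<tau>}) (\<lambda>p. ?i (case (snd c (fst p), snd p) of (x, t) \<Rightarrow> ?y x t))"
    proof (rule continuous_on_compose2[OF chart_continuous(2)])
      show "(\<lambda>p. case (snd c (fst p), snd p) of (x, t) \<Rightarrow> ?y x t) ` (V \<times> {0..\<tau>}) \<subseteq> ?U"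
        using y KU coordV unfolding E.solution_def by fastforce
    qed
    then show ?thesis
    proof (rule continuous_on_eq)
      fix q assume q: "q \<in> V \<times> {0..\<tau>}"
      then obtain m t where mt: "q = (m, t)" "m \<in> V" "t \<in> {0..\<tau>}" by auto
      have "m \<in> fst c" "\<gamma> m t \<in> fst c" using sub mt stay[OF flow_solves _ mt(3)] flow_init by auto
      then show "?i (case (snd c (fst q), snd q) of (x, t) \<Rightarrow> ?y x t) = (case q of (m, t) \<Rightarrow> \<gamma> m t)"
        using chart_inverse(1) by (simp add: mt(1))
    qed
  qed
  have dmE: "emeasure dm (?i ` B) = emeasure E.\<mu> B" if B: "B \<in> sets borel" "B \<subseteq> E.K" "?i ` B \<in> sets borel" for B
  proof -
    have "?i ` B \<subseteq> fst c" using B KU chart_inverse(3) by auto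
    then have "emeasure dm (?i ` B) = (\<integral>\<^sup>+x\<in>snd c ` ?i ` B. ennreal (liouville_density r \<omega> c x) \<partial>lborel)"
      using liouville c B(3) unfolding is_liouville_measure_def by blast
    also have "snd c ` ?i ` B = B" using B KU chart_inverse(2) by (force simp: image_iff)
    also have "liouville_density r \<omega> c = D.\<rho>"
      by (simp add: fun_eq_iff liouville_density_def D.\<rho>_def enum_axis_def[abs_def])
    finally show ?thesis using B by (simp add: E.emeasure_\<mu> Int_absorb2)
  qed
  have meas: "emeasure dm {m \<in> V. \<gamma> m t \<in> B} \<le> emeasure dm B" if t: "t \<in> {0..\<tau>}" and B: "B \<in> sets borel" for t B
  proof -
    \<comment> \<open>The coordinates of the part of \<open>B\<close> in \<open>W\<close>; the value
      \<open>p\<close> outside \<open>E.K\<close> only makes the map Borel.\<close>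
    define B' where "B' = E.K \<inter> (\<lambda>x. if x \<in> E.K then ?i x else p) -` B"
    have [measurable]: "(\<lambda>x. if x \<in> E.K then ?i x else p) \<in> borel_measurable borel"
      by (rule borel_measurable_continuous_on_if) (auto intro: continuous_on_subset[OF chart_continuous(2) KU] continuous_on_const)
    have B'_sets: "B' \<in> sets borel" unfolding B'_def
      using measurable_sets[OF \<open>(\<lambda>x. if x \<in> E.K then ?i x else p) \<in> borel_measurable borel\<close> B] by (simp add: sets.Int)
    have iB': "?i ` B' = W \<inter> B" unfolding B'_def W_def by auto
    have WB: "W \<inter> B \<in> sets borel" using closedW B by (simp add: borel_closed sets.Int)
    let ?A = "{x \<in> ball ?x R. ?y x t \<in> B'}"
    have "t * M \<le> \<tau> * M" using t E.M_pos by (intro mult_right_mono) auto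
    then have tM: "t * M \<le> R" using \<tau> by linarith
    have yt: "E.solution t (?y x) \<and> ?y x 0 = x" if "x \<in> ball ?x R" for x
      using y[OF that] E.solution_subinterval t by auto
    have A: "?A \<in> sets borel" using E.solution_measurable[of t ?y B'] yt tM t B'_sets by auto
    have "continuous_on V (\<lambda>m. case (m, t) of (m, t) \<Rightarrow> \<gamma> m t)"
      by (rule continuous_on_compose2[OF cont]) (use t in \<open>auto intro!: continuous_intros\<close>)
    then have h: "(\<lambda>m. if m \<in> V then \<gamma> m t else m) \<in> borel_measurable borel"
      using openV by (intro borel_measurable_continuous_on_if) (auto intro: continuous_on_id)
    have "{m \<in> V. \<gamma> m t \<in> B} = V \<inter> (\<lambda>m. if m \<in> V then \<gamma> m t else m) -` B" by auto
    then have set: "{m \<in> V. \<gamma> m t \<in> B} \<in> sets borel"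
      using measurable_sets[OF h B] openV by (simp add: sets.Int)
    have iA: "?i ` ?A = {m \<in> V. \<gamma> m t \<in> B}"
    proof (intro equalityI subsetI)
      fix m assume "m \<in> ?i ` ?A"
      then obtain x where x: "m = ?i x" "x \<in> ball ?x R" "?y x t \<in> B'" by blast
      then have "\<gamma> m t \<in> W'" using iV stay[OF flow_solves _ t] flow_init by auto
      then have "?i (snd c (\<gamma> m t)) = \<gamma> m t" using sub chart_inverse(1) by auto
      moreover have "?i (?y x t) \<in> B" using x(3) by (auto simp: B'_def)
      ultimately show "m \<in> {m \<in> V. \<gamma> m t \<in> B}" using x iV by auto
    next
      fix m assume "m \<in> {m \<in> V. \<gamma> m t \<in> B}"
      then have m: "m \<in> V" "\<gamma> m t \<in> B" by auto
      then have W: "\<gamma> m t \<in> W" using stay[OF flow_solves _ t] flow_init sub by auto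
      have im: "?i (snd c m) = m" using m sub chart_inverse(1) by auto
      have "?i (snd c (\<gamma> m t)) = \<gamma> m t" using W sub chart_inverse(1) by auto
      then have "snd c (\<gamma> m t) \<in> B'" using coordW[OF W] m(2) by (simp add: B'_def del: mem_cball)
      then show "m \<in> ?i ` ?A" using im coordV[OF m(1)] by (intro image_eqI[of _ _ "snd c m"]) auto
    qed
    have AK: "?A \<subseteq> E.K" using bK by auto
    have "emeasure dm {m \<in> V. \<gamma> m t \<in> B} = emeasure E.\<mu> ?A"
      using dmE[OF A AK] set unfolding iA by simp
    also have "\<dots> \<le> emeasure E.\<mu> B'"
      using E.solution_measure[of t ?y B'] yt tM t B'_sets by auto
    also have "\<dots> = emeasure dm (W \<inter> B)"
      using dmE[OF B'_sets] WB unfolding iB' by (simp add: B'_def)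
    also have "\<dots> \<le> emeasure dm B"
      using liouville B by (intro emeasure_mono) (auto simp: is_liouville_measure_def)
    finally show ?thesis .
  qed
  show ?thesis
    by (intro exI[of _ V] exI[of _ \<tau>] conjI) (use openV pV \<tau> cont meas uniq in blast)+
qed

end

lemma forward_flow_box:
  "\<exists>V \<tau>. open V \<and> p \<in> V \<and> \<tau> > 0 \<and> continuous_on (V \<times> {0..\<tau>}) (\<lambda>(m, t). \<gamma> m t) \<and>
     (\<forall>t\<in>{0..\<tau>}. \<forall>B\<in>sets borel. emeasure dm {m \<in> V. \<gamma> m t \<in> B} \<le> emeasure dm B) \<and>
     (\<forall>g g'. solves_hamilton atlas \<omega> H g \<longrightarrow> solves_hamilton atlas \<omega> H g' \<longrightarrow> g 0 = g' 0 \<longrightarrow> g 0 \<in> V \<longrightarrow>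
        (\<forall>t\<in>{0..\<tau>}. g t = g' t))"
proof -
  obtain c where c: "c \<in> atlas" "p \<in> fst c" using cover by (metis UN_E UNIV_I)
  have "snd c p \<in> chart_image c" using c by (simp add: chart_image_def)
  then obtain e where e: "e > 0" "cball (snd c p) e \<subseteq> chart_image c"
    using open_image[OF c(1)] open_contains_cball by blast
  show ?thesis by (rule forward_flow_box_in_chart[OF c, of "e / 3"]) (use e in auto)
qed

section \<open>Time reversal and two-sided flow boxes\<close>

lemma solves_hamilton_reverse:
  assumes "solves_hamilton atlas \<omega> H g"
  shows "solves_hamilton atlas \<omega> (\<lambda>m. - H m) (\<lambda>t. g (- t))"
  unfolding solves_hamilton_def
proof (intro conjI allI ballI impI)
  have g: "continuous_on UNIV g" using assms by (simp add: solves_hamilton_def)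
  show "continuous_on UNIV (\<lambda>t. g (- t))"
    by (rule continuous_on_compose2[OF g]) (auto intro!: continuous_intros)
  fix t c assume c: "c \<in> atlas" "g (- t) \<in> fst c"
  let ?x = "snd c (g (- t))"
  obtain X where X: "((\<lambda>s. snd c (g s)) has_vector_derivative X) (at (- t))"
      "\<forall>v. \<omega> c ?x X v = differential c H (g (- t)) v"
    using assms c unfolding solves_hamilton_def by blast
  have "(uminus has_vector_derivative - 1) (at t)" for t :: real by (auto intro!: derivative_eq_intros)
  from vector_diff_chain_at[OF this X(1)]
  have d: "((\<lambda>s. snd c (g (- s))) has_vector_derivative - X) (at t)" by (simp add: comp_def)
  have x: "?x \<in> chart_image c" using c by (simp add: chart_image_def)
  have "C1_on (chart_image c) (H \<circ> chart_inv c)"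
    using hamiltonian_smooth c open_image[OF c(1)] by (intro smooth_on_C1_on) (auto simp: smooth_fun_def)
  from has_derivative_minus[OF C1_on_has_derivative[OF this x]]
  have "((\<lambda>m. - H m) \<circ> chart_inv c has_derivative (\<lambda>v. - differential c H (g (- t)) v)) (at ?x)"
    by (simp add: comp_def differential_def)
  from frechet_derivative_at[OF this]
  have "differential c (\<lambda>m. - H m) (g (- t)) v = - differential c H (g (- t)) v" for v
    by (metis differential_def)
  then show "\<exists>X. ((\<lambda>s. snd c (g (- s))) has_vector_derivative X) (at t) \<and>
             (\<forall>v. \<omega> c ?x X v = differential c (\<lambda>m. - H m) (g (- t)) v)"
    using d X(2) bilinear_lneg[OF form_bilinear[OF c(1) x]] by (intro exI[of _ "- X"]) simp
qed

lemma smooth_fun_minus: "smooth_fun atlas (\<lambda>m. - H m)"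
  unfolding smooth_fun_def
proof
  fix c assume c: "c \<in> atlas"
  then have "smooth_on (chart_image c) (H \<circ> chart_inv c)"
    using hamiltonian_smooth by (simp add: smooth_fun_def)
  from smooth_on_minus[OF open_image[OF c] this] show "smooth_on (chart_image c) ((\<lambda>m. - H m) \<circ> chart_inv c)" by (simp add: comp_def)
qed

text \<open>Every statement about nonnegative times, applied to this system, becomes one about
  nonpositive times of the original system.\<close>

lemma reversed_system: "hamiltonian_system atlas \<omega> r (\<lambda>m. - H m) (\<lambda>m t. \<gamma> m (- t)) dm"
  by unfold_locales
     (auto intro: smooth_fun_minus solves_hamilton_reverse flow_solves liouville simp: flow_init)

lemma sets_dm: "sets dm = sets borel"
  using liouville by (simp add: is_liouville_measure_def)

lemma restricted_preimage_borel:
  fixes V :: "'m set" and f :: "'m \<Rightarrow> 'm"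
  assumes "open V" "continuous_on V f" "B \<in> sets borel"
  shows "{m \<in> V. f m \<in> B} \<in> sets borel"
proof -
  have "(\<lambda>m. if m \<in> V then f m else m) \<in> borel_measurable borel"
    using assms by (intro borel_measurable_continuous_on_if) (auto intro: continuous_on_id)
  from measurable_sets[OF this assms(3)] have "V \<inter> (\<lambda>m. if m \<in> V then f m else m) -` B \<in> sets borel"
    using assms by (simp add: sets.Int)
  also have "V \<inter> (\<lambda>m. if m \<in> V then f m else m) -` B = {m \<in> V. f m \<in> B}" by auto
  finally show ?thesis .
qed

lemma flow_box:
  "\<exists>V \<tau>. open V \<and> p \<in> V \<and> \<tau> > 0 \<and> continuous_on (V \<times> {- \<tau><..<\<tau>}) (\<lambda>(m, t). \<gamma> m t) \<and>
     (\<forall>t. \<bar>t\<bar> < \<tau> \<longrightarrow> (\<forall>B\<in>sets borel. emeasure dm {m \<in> V. \<gamma> m t \<in> B} \<le> emeasure dm B)) \<and>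
     (\<forall>g g'. solves_hamilton atlas \<omega> H g \<longrightarrow> solves_hamilton atlas \<omega> H g' \<longrightarrow> g 0 = g' 0 \<longrightarrow> g 0 \<in> V \<longrightarrow>
        (\<forall>t. \<bar>t\<bar> < \<tau> \<longrightarrow> g t = g' t))"
proof -
  interpret N: hamiltonian_system atlas \<omega> r "\<lambda>m. - H m" "\<lambda>m t. \<gamma> m (- t)" dm by (rule reversed_system)
  obtain V1 \<tau>1 where 1: "open V1" "p \<in> V1" "\<tau>1 > 0" "continuous_on (V1 \<times> {0..\<tau>1}) (\<lambda>(m, t). \<gamma> m t)"
     "\<And>t B. t \<in> {0..\<tau>1} \<Longrightarrow> B \<in> sets borel \<Longrightarrow> emeasure dm {m \<in> V1. \<gamma> m t \<in> B} \<le> emeasure dm B"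
     "\<And>g g' t. solves_hamilton atlas \<omega> H g \<Longrightarrow> solves_hamilton atlas \<omega> H g' \<Longrightarrow> g 0 = g' 0 \<Longrightarrow> g 0 \<in> V1 \<Longrightarrow>
        t \<in> {0..\<tau>1} \<Longrightarrow> g t = g' t"
    using forward_flow_box[of p] by blast
  obtain V2 \<tau>2 where 2: "open V2" "p \<in> V2" "\<tau>2 > 0" "continuous_on (V2 \<times> {0..\<tau>2}) (\<lambda>(m, t). \<gamma> m (- t))"
     "\<And>t B. t \<in> {0..\<tau>2} \<Longrightarrow> B \<in> sets borel \<Longrightarrow> emeasure dm {m \<in> V2. \<gamma> m (- t) \<in> B} \<le> emeasure dm B"
     "\<And>g g' t. solves_hamilton atlas \<omega> (\<lambda>m. - H m) g \<Longrightarrow> solves_hamilton atlas \<omega> (\<lambda>m. - H m) g' \<Longrightarrow> g 0 = g' 0 \<Longrightarrow> g 0 \<in> V2 \<Longrightarrow>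
        t \<in> {0..\<tau>2} \<Longrightarrow> g t = g' t"
    using N.forward_flow_box[of p] by blast
  define V where "V = V1 \<inter> V2"
  define \<tau> where "\<tau> = min \<tau>1 \<tau>2"
  have V: "open V" "p \<in> V" and \<tau>: "\<tau> > 0" using 1 2 by (auto simp: V_def \<tau>_def)
  have cont: "continuous_on (V \<times> {- \<tau><..<\<tau>}) (\<lambda>(m, t). \<gamma> m t)"
  proof -
    have "continuous_on (V2 \<times> {- \<tau>2..0}) (\<lambda>q. case (fst q, - snd q) of (m, t) \<Rightarrow> \<gamma> m (- t))"
      by (rule continuous_on_compose2[OF 2(4)]) (auto intro!: continuous_intros)
    then have b: "continuous_on (V2 \<times> {- \<tau>2..0}) (\<lambda>(m, t). \<gamma> m t)" by (simp add: case_prod_beta')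
    \<comment> \<open>Both halves contain time 0 and are relatively closed in the box, so the two
      continuous pieces can be glued.\<close>
    let ?S = "V \<times> {0..<\<tau>}" and ?T = "V \<times> {- \<tau><..0}"
    have eq: "V \<times> {- \<tau><..<\<tau>} = ?S \<union> ?T" using \<tau> by auto
    have "?S = (?S \<union> ?T) \<inter> (UNIV \<times> {0..})" "?T = (?S \<union> ?T) \<inter> (UNIV \<times> {..0})" using \<tau> by auto
    then have "closedin (top_of_set (?S \<union> ?T)) ?S" "closedin (top_of_set (?S \<union> ?T)) ?T"
      by (metis closed_Times closed_UNIV closed_atLeast closedin_closed_Int)
         (metis \<open>?T = (?S \<union> ?T) \<inter> (UNIV \<times> {..0})\<close> closed_Times closed_UNIV closed_atMost closedin_closed_Int)
    moreover have "continuous_on ?S (\<lambda>(m, t). \<gamma> m t)" "continuous_on ?T (\<lambda>(m, t). \<gamma> m t)"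
      by (rule continuous_on_subset[OF 1(4)], force simp: V_def \<tau>_def, rule continuous_on_subset[OF b], force simp: V_def \<tau>_def)
    ultimately show ?thesis unfolding eq by (rule continuous_on_Un_local)
  qed
  have meas: "emeasure dm {m \<in> V. \<gamma> m t \<in> B} \<le> emeasure dm B" if t: "\<bar>t\<bar> < \<tau>" and B: "B \<in> sets borel" for t B
  proof -
    show ?thesis
    proof (cases "t \<ge> 0")
      case True
      have "continuous_on V1 (\<lambda>m. case (m, t) of (m, t) \<Rightarrow> \<gamma> m t)"
        by (rule continuous_on_compose2[OF 1(4)]) (use True t in \<open>auto simp: \<tau>_def intro!: continuous_intros\<close>)
      then have "{m \<in> V1. \<gamma> m t \<in> B} \<in> sets dm" using restricted_preimage_borel[OF 1(1) _ B] by (simp add: sets_dm)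
      then have "emeasure dm {m \<in> V. \<gamma> m t \<in> B} \<le> emeasure dm {m \<in> V1. \<gamma> m t \<in> B}"
        by (intro emeasure_mono) (auto simp: V_def)
      also have "\<dots> \<le> emeasure dm B" using 1(5)[of t B] True t B by (simp add: \<tau>_def)
      finally show ?thesis .
    next
      case False
      have "continuous_on V2 (\<lambda>m. case (m, - t) of (m, t) \<Rightarrow> \<gamma> m (- t))"
        by (rule continuous_on_compose2[OF 2(4)]) (use False t in \<open>auto simp: \<tau>_def intro!: continuous_intros\<close>)
      then have "{m \<in> V2. \<gamma> m t \<in> B} \<in> sets dm" using restricted_preimage_borel[OF 2(1) _ B] by (simp add: sets_dm)
      then have "emeasure dm {m \<in> V. \<gamma> m t \<in> B} \<le> emeasure dm {m \<in> V2. \<gamma> m t \<in> B}"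
        by (intro emeasure_mono) (auto simp: V_def)
      also have "\<dots> \<le> emeasure dm B" using 2(5)[of "- t" B] False t B by (simp add: \<tau>_def)
      finally show ?thesis .
    qed
  qed
  have uniq: "g t = g' t" if g: "solves_hamilton atlas \<omega> H g" "solves_hamilton atlas \<omega> H g'" "g 0 = g' 0" "g 0 \<in> V"
    and t: "\<bar>t\<bar> < \<tau>" for g g' t
  proof (cases "t \<ge> 0")
    case True
    then show ?thesis using 1(6)[OF g(1,2,3), of t] g(4) t by (auto simp: V_def \<tau>_def)
  next
    case False
    then show ?thesis
      using 2(6)[OF g(1,2)[THEN solves_hamilton_reverse], of "- t"] g(3,4) t by (auto simp: V_def \<tau>_def)
  qed
  show ?thesis by (intro exI[of _ V] exI[of _ \<tau>] conjI) (use V \<tau> cont meas uniq in blast)+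
qed

text \<open>The times of agreement form a closed set, and an open one because a flow box around a
  common value extends the agreement; the line is connected.\<close>

lemma hamilton_unique:
  assumes g: "solves_hamilton atlas \<omega> H g" "solves_hamilton atlas \<omega> H g'" "g 0 = g' 0"
  shows "g t = g' t"
proof -
  let ?E = "{t. g t = g' t}"
  have "closed ?E"
    using g by (intro closed_Collect_eq) (auto simp: solves_hamilton_def)
  moreover have "open ?E"
    unfolding open_dist
  proof (intro ballI)
    fix t assume t: "t \<in> ?E"
    obtain V \<tau> where V: "g t \<in> V" "\<tau> > 0" and u: "\<forall>g g'. solves_hamilton atlas \<omega> H g \<longrightarrow> solves_hamilton atlas \<omega> H g' \<longrightarrow>
        g 0 = g' 0 \<longrightarrow> g 0 \<in> V \<longrightarrow> (\<forall>t. \<bar>t\<bar> < \<tau> \<longrightarrow> g t = g' t)"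
      using flow_box[of "g t"] by (elim exE conjE)
    have "s \<in> ?E" if "dist s t < \<tau>" for s
      using u[rule_format, OF solves_hamilton_shift[OF g(1), of t] solves_hamilton_shift[OF g(2), of t], of "s - t"] t V(1) that
      by (simp add: dist_real_def)
    then show "\<exists>e>0. \<forall>s. dist s t < e \<longrightarrow> s \<in> ?E" using V(2) by blast
  qed
  ultimately have "?E = UNIV" using clopen[of ?E] g(3) by blast
  then show ?thesis by blast
qed

section \<open>The flow as a continuous one-parameter group\<close>

lemma flow_add: "\<gamma> m (s + t) = \<gamma> (\<gamma> m s) t"
  using hamilton_unique[OF solves_hamilton_shift[OF flow_solves[of m], of s] flow_solves[of "\<gamma> m s"], of t]
  by (simp add: flow_init add.commute)

lemma flow_minus [simp]: "\<gamma> (\<gamma> m t) (- t) = m" "\<gamma> (\<gamma> m (- t)) t = m"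
  using flow_add[of m t "- t"] flow_add[of m "- t" t] by (simp_all add: flow_init)

text \<open>The combination of continuity and measure inequality that can be passed along an orbit:
  near one point and for one fixed time.\<close>

definition locally_subinvariant :: "'m \<Rightarrow> real \<Rightarrow> bool" where
  "locally_subinvariant m t \<longleftrightarrow> (\<exists>V. open V \<and> m \<in> V \<and> continuous_on V (\<lambda>m. \<gamma> m t) \<and>
     (\<forall>B\<in>sets borel. emeasure dm {m \<in> V. \<gamma> m t \<in> B} \<le> emeasure dm B))"

text \<open>The flow box at \<open>\<gamma> m t\<^sub>0\<close> carries the property between any two
  times near \<open>t\<^sub>0\<close>. As the two times play symmetric roles, both the set of good
  times and its complement are open.\<close>

lemma locally_subinvariant_near: "\<exists>\<delta>>0. \<forall>t t'. \<bar>t - t\<^sub>0\<bar> < \<delta> \<longrightarrow> \<bar>t' - t\<^sub>0\<bar> < \<delta> \<longrightarrow> locally_subinvariant m t \<longrightarrow> locally_subinvariant m t'"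
proof -
  obtain V \<tau> where V: "open V" "\<gamma> m t\<^sub>0 \<in> V" "\<tau> > 0" "continuous_on (V \<times> {- \<tau><..<\<tau>}) (\<lambda>(m, t). \<gamma> m t)"
     "\<And>t B. \<bar>t\<bar> < \<tau> \<Longrightarrow> B \<in> sets borel \<Longrightarrow> emeasure dm {m \<in> V. \<gamma> m t \<in> B} \<le> emeasure dm B"
    using flow_box[of "\<gamma> m t\<^sub>0"] by blast
  have "continuous_on UNIV (\<gamma> m)" using flow_solves[of m] by (simp add: solves_hamilton_def)
  then have "open (\<gamma> m -` V)" using V(1) by (intro open_vimage) auto
  then obtain \<delta> where \<delta>: "\<delta> > 0" "\<And>t. dist t t\<^sub>0 < \<delta> \<Longrightarrow> \<gamma> m t \<in> V"
    using V(2) unfolding open_dist by (metis vimage_eq)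
  \<comment> \<open>Two times within \<open>\<tau> / 2\<close> of \<open>t\<^sub>0\<close> differ by
    less than \<open>\<tau>\<close>, and \<open>\<delta>\<close> keeps the orbit of \<open>m\<close>
    inside \<open>V\<close>.\<close>
  have "locally_subinvariant m t'" if t: "\<bar>t - t\<^sub>0\<bar> < min \<delta> (\<tau> / 2)" "\<bar>t' - t\<^sub>0\<bar> < min \<delta> (\<tau> / 2)" and g: "locally_subinvariant m t" for t t'
  proof -
    obtain A where A: "open A" "m \<in> A" "continuous_on A (\<lambda>m. \<gamma> m t)"
      "\<And>B. B \<in> sets borel \<Longrightarrow> emeasure dm {m \<in> A. \<gamma> m t \<in> B} \<le> emeasure dm B"
      using g unfolding locally_subinvariant_def by blast
    let ?A = "A \<inter> (\<lambda>m. \<gamma> m t) -` V"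
    have tt: "\<bar>t' - t\<bar> < \<tau>" using t by linarith
    have step: "\<gamma> q t' = \<gamma> (\<gamma> q t) (t' - t)" for q using flow_add[of q t "t' - t"] by simp
    have c: "continuous_on V (\<lambda>q. \<gamma> q (t' - t))"
    proof -
      have "continuous_on V (\<lambda>q. case (q, t' - t) of (q, t) \<Rightarrow> \<gamma> q t)"
        by (rule continuous_on_compose2[OF V(4)]) (use tt in \<open>auto intro!: continuous_intros\<close>)
      then show ?thesis by simp
    qed
    have "open ?A" by (rule continuous_open_preimage[OF A(3,1) V(1)])
    moreover have "m \<in> ?A" using A(2) \<delta>(2)[of t] t by (simp add: dist_real_def)
    moreover have "continuous_on ?A (\<lambda>m. \<gamma> m t')"
      unfolding step by (rule continuous_on_compose2[OF c]) (auto intro: continuous_on_subset[OF A(3)])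
    moreover have "emeasure dm {q \<in> ?A. \<gamma> q t' \<in> B} \<le> emeasure dm B" if B: "B \<in> sets borel" for B
    proof -
      have "{q \<in> V. \<gamma> q (t' - t) \<in> B} \<in> sets borel" by (rule restricted_preimage_borel[OF V(1) c B])
      then have "emeasure dm {q \<in> A. \<gamma> q t \<in> {q \<in> V. \<gamma> q (t' - t) \<in> B}} \<le> emeasure dm {q \<in> V. \<gamma> q (t' - t) \<in> B}"
        by (rule A(4))
      also have "\<dots> \<le> emeasure dm B" by (rule V(5)[OF tt B])
      also have "{q \<in> A. \<gamma> q t \<in> {q \<in> V. \<gamma> q (t' - t) \<in> B}} = {q \<in> ?A. \<gamma> q t' \<in> B}"
        by (auto simp: step)
      finally show ?thesis .
    qed
    ultimately show ?thesis unfolding locally_subinvariant_def by blast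
  qed
  moreover have "min \<delta> (\<tau> / 2) > 0" using \<delta>(1) V(3) by simp
  ultimately show ?thesis by (intro exI[of _ "min \<delta> (\<tau> / 2)"] conjI allI impI)
qed

lemma locally_subinvariant: "locally_subinvariant m t"
proof -
  let ?G = "{t. locally_subinvariant m t}"
  have "open ?G" unfolding open_dist
  proof (intro ballI)
    fix t assume t: "t \<in> ?G"
    obtain \<delta> where d: "\<delta> > 0" "\<forall>s s'. \<bar>s - t\<bar> < \<delta> \<longrightarrow> \<bar>s' - t\<bar> < \<delta> \<longrightarrow> locally_subinvariant m s \<longrightarrow> locally_subinvariant m s'"
      using locally_subinvariant_near[where t\<^sub>0 = t and m = m] by (elim exE conjE)
    have "\<forall>s. dist s t < \<delta> \<longrightarrow> s \<in> ?G"
      using d(2)[rule_format, of t] d(1) t by (simp add: dist_real_def)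
    then show "\<exists>e>0. \<forall>s. dist s t < e \<longrightarrow> s \<in> ?G" using d(1) by blast
  qed
  moreover have "open (- ?G)" unfolding open_dist
  proof (intro ballI)
    fix t assume t: "t \<in> - ?G"
    obtain \<delta> where d: "\<delta> > 0" "\<forall>s s'. \<bar>s - t\<bar> < \<delta> \<longrightarrow> \<bar>s' - t\<bar> < \<delta> \<longrightarrow> locally_subinvariant m s \<longrightarrow> locally_subinvariant m s'"
      using locally_subinvariant_near[where t\<^sub>0 = t and m = m] by (elim exE conjE)
    have "\<forall>s. dist s t < \<delta> \<longrightarrow> s \<in> - ?G"
      using d(2)[rule_format, of _ t] d(1) t by (auto simp: dist_real_def)
    then show "\<exists>e>0. \<forall>s. dist s t < e \<longrightarrow> s \<in> - ?G" using d(1) by blast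
  qed
  moreover have "locally_subinvariant m 0"
    unfolding locally_subinvariant_def by (intro exI[of _ UNIV]) (auto simp: flow_init intro: continuous_on_id)
  ultimately have "?G = UNIV" using clopen[of ?G] by (auto simp: closed_def)
  then show ?thesis by blast
qed

lemma continuous_flow: "continuous_on UNIV (\<lambda>m. \<gamma> m t)"
proof -
  have "isCont (\<lambda>m. \<gamma> m t) m" for m
    using locally_subinvariant[of m t] unfolding locally_subinvariant_def by (auto simp: continuous_on_eq_continuous_at)
  then show ?thesis by (simp add: continuous_on_eq_continuous_at)
qed

text \<open>Near time \<open>t\<close> the flow is the time-\<open>t\<close> map, continuous in the
  point, followed by a short move inside a flow box.\<close>

lemma continuous_flow_pair: "continuous_on UNIV (\<lambda>(m, t). \<gamma> m t)"
proof -
  have "isCont (\<lambda>(m, t). \<gamma> m t) (m, t)" for m t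
  proof -
    obtain V \<tau> where V: "open V" "\<gamma> m t \<in> V" "\<tau> > 0" "continuous_on (V \<times> {- \<tau><..<\<tau>}) (\<lambda>(m, t). \<gamma> m t)"
      using flow_box[of "\<gamma> m t"] by blast
    have 1: "isCont (\<lambda>q. (\<gamma> (fst q) t, snd q - t)) (m, t)"
    proof (intro continuous_intros)
      have "continuous_on UNIV (\<lambda>q :: 'm \<times> real. \<gamma> (fst q) t)"
        by (rule continuous_on_compose2[OF continuous_flow]) (auto intro!: continuous_intros)
      then show "isCont (\<lambda>q. \<gamma> (fst q) t) (m, t)" by (simp add: continuous_on_eq_continuous_at)
    qed
    have "open (V \<times> {- \<tau><..<\<tau>})" using V by (intro open_Times) auto
    then have "isCont (\<lambda>(m, t). \<gamma> m t) (\<gamma> m t, 0)"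
      using V by (auto simp: continuous_on_eq_continuous_at)
    then have "isCont (\<lambda>(m, t). \<gamma> m t) ((\<lambda>q. (\<gamma> (fst q) t, snd q - t)) (m, t))" by simp
    from isCont_o2[OF 1 this]
    have "isCont (\<lambda>q. \<gamma> (\<gamma> (fst q) t) (snd q - t)) (m, t)" by simp
    also have "(\<lambda>q. \<gamma> (\<gamma> (fst q) t) (snd q - t)) = (\<lambda>(m, t). \<gamma> m t)"
      by (auto simp: fun_eq_iff flow_add[symmetric])
    finally show ?thesis .
  qed
  then show ?thesis by (auto simp: continuous_on_eq_continuous_at)
qed

lemma measurable_flow: "(\<lambda>m. \<gamma> m t) \<in> borel_measurable borel"
  by (rule borel_measurable_continuous_onI[OF continuous_flow])

text \<open>By the Lindelof property \<open>S\<close> splits into countably many disjoint Borel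
  pieces, each inside a set with the local inequality. For each piece the inequality is applied to
  its image under time \<open>t\<close>; written as a preimage under time \<open>- t\<close>, this
  image is Borel.\<close>

lemma emeasure_le_flow:
  assumes S: "S \<in> sets borel"
  shows "emeasure dm S \<le> emeasure dm ((\<lambda>m. \<gamma> m (- t)) -` S)"
proof -
  have "\<forall>m. \<exists>V. open V \<and> m \<in> V \<and> (\<forall>B\<in>sets borel. emeasure dm {m \<in> V. \<gamma> m t \<in> B} \<le> emeasure dm B)"
    using locally_subinvariant[of _ t] unfolding locally_subinvariant_def by blast
  then obtain V where V: "\<And>m. open (V m)" "\<And>m. m \<in> V m"
      "\<And>m B. B \<in> sets borel \<Longrightarrow> emeasure dm {q \<in> V m. \<gamma> q t \<in> B} \<le> emeasure dm B"
    by metis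
  obtain F where F: "F \<subseteq> range V" "countable F" "\<Union>F = \<Union>(range V)"
    using Lindelof[of "range V"] V(1) by auto
  have F0: "F \<noteq> {}" using F(3) V(2) by blast
  define A where "A = from_nat_into F"
  have A: "range A = F" unfolding A_def by (rule range_from_nat_into[OF F0 F(2)])
  have UA: "(\<Union>i. A i) = UNIV" using A F(3) V(2) by blast
  let ?P = "\<lambda>B. (\<lambda>m. \<gamma> m (- t)) -` B"
  have P: "?P B \<in> sets dm" if "B \<in> sets borel" for B
    using measurable_sets[OF measurable_flow that] by (simp add: sets_dm)
  let ?D = "\<lambda>i. S \<inter> disjointed A i"
  have "open (A i)" for i
  proof -
    have "A i \<in> range V" using F(1) unfolding A[symmetric] by blast
    then show ?thesis using V(1) by (elim imageE) simp
  qed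
  then have "range (disjointed A) \<subseteq> sets borel"
    by (intro sets.range_disjointed_sets image_subsetI borel_open)
  then have D: "?D i \<in> sets borel" for i
    by (intro sets.Int[OF S]) blast
  have disj: "disjoint_family ?D" using disjoint_family_disjointed[of A] by (auto simp: disjoint_family_on_def)
  have U: "(\<Union>i. ?D i) = S" using UA UN_disjointed_eq[of A] by auto
  have le: "emeasure dm (?D i) \<le> emeasure dm (?P (?D i))" for i
  proof -
    obtain m where m: "A i = V m" using A F(1) by blast
    have "{q \<in> V m. \<gamma> q t \<in> ?P (?D i)} = ?D i" using disjointed_subset[of A i] by (auto simp: m)
    then show ?thesis using V(3)[of "?P (?D i)" m] P[OF D, of i] by (simp add: sets_dm)
  qed
  have "(\<Sum>i. emeasure dm (?D i)) = emeasure dm (\<Union>i. ?D i)"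
    by (rule suminf_emeasure) (use D disj in \<open>auto simp: sets_dm\<close>)
  then have "emeasure dm S = (\<Sum>i. emeasure dm (?D i))" unfolding U by simp
  also have "\<dots> \<le> (\<Sum>i. emeasure dm (?P (?D i)))" by (intro suminf_le le) auto
  also have "\<dots> = emeasure dm (\<Union>i. ?P (?D i))"
    using P[OF D] disj by (intro suminf_emeasure) (auto simp: disjoint_family_on_def)
  also have "(\<Union>i. ?P (?D i)) = ?P S" using U by blast
  finally show ?thesis .
qed

text \<open>The inequality is used twice: for the preimage with time \<open>t\<close> and for
  \<open>S\<close> with time \<open>- t\<close>.\<close>

lemma flow_measure_preserving:
  assumes S: "S \<in> sets borel"
  shows "emeasure dm ((\<lambda>m. \<gamma> m t) -` S) = emeasure dm S"
proof (rule antisym)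
  let ?P = "(\<lambda>m. \<gamma> m t) -` S"
  have "?P \<in> sets borel" using measurable_sets[OF measurable_flow S] by simp
  from emeasure_le_flow[OF this, of t]
  show "emeasure dm ?P \<le> emeasure dm S" by (simp add: vimage_def)
  show "emeasure dm S \<le> emeasure dm ?P" using emeasure_le_flow[OF S, of "- t"] by simp
qed

end

section \<open>Time averages under a measure-preserving flow\<close>

lemma abs_integral_le:
  fixes f g :: "'a \<Rightarrow> real"
  assumes "integrable M f" "integrable M g" "\<And>x. norm (f x) \<le> g x"
  shows "norm (integral\<^sup>L M f) \<le> integral\<^sup>L M g"
proof -
  have "norm (integral\<^sup>L M f) \<le> (LINT x|M. norm (f x))" by (rule integral_norm_bound)
  also have "\<dots> \<le> integral\<^sup>L M g" using assms by (intro integral_mono) auto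
  finally show ?thesis .
qed

lemma integrable_bounded_interval:
  fixes f :: "real \<Rightarrow> real"
  assumes "f \<in> borel_measurable lborel" and "\<And>t. \<bar>f t\<bar> \<le> C"
  shows "integrable lborel (\<lambda>t. indicator {a..b} t *\<^sub>R f t)"
  by (rule integrableI_bounded_set_indicator[where B = C])
     (use assms in \<open>auto simp: emeasure_lborel_Icc_eq\<close>)

lemma interval_const_integral:
  fixes C :: real
  shows "integrable lborel (\<lambda>t. C * indicator {a..b} t)"
    and "a \<le> b \<Longrightarrow> (LINT t|lborel. C * indicator {a..b} t) = C * (b - a)"
proof -
  have "integrable lborel (indicator {a..b} :: real \<Rightarrow> real)"
    by (rule integrable_real_indicator) (simp_all add: emeasure_lborel_Icc_eq)
  then show "integrable lborel (\<lambda>t. C * indicator {a..b} t)" by (rule integrable_mult_right)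
  show "a \<le> b \<Longrightarrow> (LINT t|lborel. C * indicator {a..b} t) = C * (b - a)"
    by (subst integral_mult_right_zero) simp
qed

lemma time_average_bound:
  assumes f: "f \<in> borel_measurable lborel" and b: "\<And>t. \<bar>f t\<bar> \<le> C" and T: "T \<ge> 0"
  shows "\<bar>time_average f T\<bar> \<le> C"
proof -
  have C: "C \<ge> 0" using b[of 0] by simp
  have int: "integrable lborel (\<lambda>t. indicator {0..T} t *\<^sub>R f t)"
    by (rule integrable_bounded_interval[OF f b])
  have "\<bar>LINT t:{0..T}|lborel. f t\<bar> \<le> (LINT t|lborel. C * indicator {0..T} t)"
    unfolding set_lebesgue_integral_def real_norm_def[symmetric]
    by (intro abs_integral_le int interval_const_integral) (use b in \<open>auto simp: indicator_def\<close>)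
  also have "\<dots> = C * T" using T interval_const_integral(2)[of 0 T C] by simp
  finally show ?thesis
    using T C by (cases "T = 0") (auto simp: time_average_def abs_mult field_simps)
qed

text \<open>The two time windows differ by an interval of length at most \<open>s\<close> at either
  end.\<close>

lemma time_average_shift:
  assumes f[measurable]: "f \<in> borel_measurable lborel" and b: "\<And>t. \<bar>f t\<bar> \<le> C" and T: "T > 0" and s: "s \<ge> 0"
  shows "\<bar>time_average (\<lambda>t. f (s + t)) T - time_average f T\<bar> \<le> 2 * s * C / T"
proof -
  have C: "C \<ge> 0" using b[of 0] by simp
  have int: "integrable lborel (\<lambda>t. indicator {a..b} t * f t)" for a b
    using integrable_bounded_interval[OF f b] by simp
  have "(LINT t:{0..T}|lborel. f (s + t)) = (LINT t|lborel. indicator {s..s + T} (s + 1 * t) *\<^sub>R f (s + 1 * t))"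
    unfolding set_lebesgue_integral_def by (intro Bochner_Integration.integral_cong) (auto simp: indicator_def)
  also have "\<dots> = (LINT t|lborel. indicator {s..s + T} t *\<^sub>R f t)"
    using lborel_integral_real_affine[of 1 "\<lambda>t. indicator {s..s + T} t *\<^sub>R f t" s] by simp
  finally have "(LINT t:{0..T}|lborel. f (s + t)) - (LINT t:{0..T}|lborel. f t) =
      (LINT t|lborel. indicator {s..s + T} t *\<^sub>R f t - indicator {0..T} t *\<^sub>R f t)"
    unfolding set_lebesgue_integral_def by (simp add: int)
  also have "\<bar>\<dots>\<bar> \<le> (LINT t|lborel. C * indicator {0..s} t + C * indicator {T..T + s} t)"
    unfolding real_norm_def[symmetric]
  proof (intro abs_integral_le)
    fix t
    show "norm (indicator {s..s + T} t *\<^sub>R f t - indicator {0..T} t *\<^sub>R f t) \<le> C * indicator {0..s} t + C * indicator {T..T + s} t"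
      using b[of t] T s C by (auto simp: indicator_def)
  qed (auto simp: int intro!: interval_const_integral(1) Bochner_Integration.integrable_add)
  also have "\<dots> = 2 * s * C" using s
    by (subst Bochner_Integration.integral_add) (auto simp: interval_const_integral simp del: integral_mult_right_zero)
  finally have "\<bar>(LINT t:{0..T}|lborel. f (s + t)) - (LINT t:{0..T}|lborel. f t)\<bar> / T \<le> 2 * s * C / T"
    using T by (intro divide_right_mono) auto
  moreover have "time_average (\<lambda>t. f (s + t)) T - time_average f T =
      ((LINT t:{0..T}|lborel. f (s + t)) - (LINT t:{0..T}|lborel. f t)) / T"
    by (simp add: time_average_def diff_divide_distrib)
  ultimately show ?thesis using T by simp
qed

text \<open>Integer times are used wherever sequences are wanted, for measurable limits and
  dominated convergence. Rounding \<open>T\<close> down changes the integral by at most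
  \<open>C\<close>.\<close>

lemma time_average_real_limit:
  assumes f[measurable]: "f \<in> borel_measurable lborel" and b: "\<And>t. \<bar>f t\<bar> \<le> C"
    and l: "(\<lambda>n. time_average f (real n)) \<longlonglongrightarrow> l"
  shows "(time_average f \<longlongrightarrow> l) at_top"
proof -
  have C: "C \<ge> 0" using b[of 0] by simp
  let ?n = "\<lambda>T::real. nat \<lfloor>T\<rfloor>"
  have int: "integrable lborel (\<lambda>t. indicator {a..b} t *\<^sub>R f t)" for a b
    by (rule integrable_bounded_interval[OF f b])
  have flim: "filterlim ?n sequentially at_top"
    unfolding filterlim_at_top
  proof
    fix k
    show "\<forall>\<^sub>F T in at_top. k \<le> ?n T"
      using eventually_ge_at_top[of "real k"] by eventually_elim (simp add: le_nat_iff le_floor_iff)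
  qed
  have "((\<lambda>T. real (?n T) / T) \<longlongrightarrow> 1) at_top"
  proof (rule tendsto_sandwich)
    show "((\<lambda>T::real. (T - 1) / T) \<longlongrightarrow> 1) at_top" "((\<lambda>T::real. T / T) \<longlongrightarrow> 1) at_top" by real_asymp+
    show "\<forall>\<^sub>F T in at_top. (T - 1) / T \<le> real (?n T) / T" "\<forall>\<^sub>F T in at_top. real (?n T) / T \<le> T / T"
      using eventually_ge_at_top[of "1::real"] by (eventually_elim, intro divide_right_mono, linarith, linarith)+
  qed
  moreover have "((\<lambda>T. time_average f (real (?n T))) \<longlongrightarrow> l) at_top"
    by (rule filterlim_compose[OF l flim])
  ultimately have "((\<lambda>T. real (?n T) / T * time_average f (real (?n T))) \<longlongrightarrow> 1 * l) at_top"
    by (rule tendsto_mult)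
  moreover have "((\<lambda>T. time_average f T - real (?n T) / T * time_average f (real (?n T))) \<longlongrightarrow> 0) at_top"
  proof (rule Lim_null_comparison)
    show "((\<lambda>T::real. C / T) \<longlongrightarrow> 0) at_top" by real_asymp
    show "\<forall>\<^sub>F T in at_top. norm (time_average f T - real (?n T) / T * time_average f (real (?n T))) \<le> C / T"
      using eventually_ge_at_top[of "1::real"]
    proof eventually_elim
      case (elim T)
      define k where "k = real (?n T)"
      have k: "0 < k" "k \<le> T" "T \<le> k + 1" using elim unfolding k_def by linarith+
      have "time_average f T - k / T * time_average f k = 1 / T * ((LINT t:{0..T}|lborel. f t) - (LINT t:{0..k}|lborel. f t))"
      proof -
        have "1 / T * x - k / T * (1 / k * y) = 1 / T * (x - y)" if "k > 0" for x y k :: real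
          using that by (simp add: right_diff_distrib)
        from this[OF k(1)] show ?thesis unfolding time_average_def .
      qed
      also have "(LINT t:{0..T}|lborel. f t) - (LINT t:{0..k}|lborel. f t) =
         (LINT t|lborel. indicator {0..T} t *\<^sub>R f t - indicator {0..k} t *\<^sub>R f t)"
        unfolding set_lebesgue_integral_def using int[of 0 T] int[of 0 k] by simp
      finally have eq: "time_average f T - k / T * time_average f k = 1 / T * \<dots>" .
      have "norm (LINT t|lborel. indicator {0..T} t *\<^sub>R f t - indicator {0..k} t *\<^sub>R f t) \<le> (LINT t|lborel. C * indicator {k..T} t)"
      proof (intro abs_integral_le)
        fix t
        show "norm (indicator {0..T} t *\<^sub>R f t - indicator {0..k} t *\<^sub>R f t) \<le> C * indicator {k..T} t"
          using b[of t] k C by (auto simp: indicator_def)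
      qed (use int[of 0 T] int[of 0 k] interval_const_integral(1) in auto)
      also have "\<dots> = C * (T - k)" by (rule interval_const_integral(2)[OF k(2)])
      also have "\<dots> \<le> C * 1" using k C by (intro mult_left_mono) auto
      finally show ?case unfolding k_def[symmetric] eq using k C
        by (simp add: abs_mult divide_right_mono)
    qed
  qed
  ultimately have "((\<lambda>T. real (?n T) / T * time_average f (real (?n T)) +
      (time_average f T - real (?n T) / T * time_average f (real (?n T)))) \<longlongrightarrow> 1 * l + 0) at_top"
    by (rule tendsto_add)
  then show ?thesis by simp
qed

text \<open>Serves the passage from bounded to square-integrable observables: uniform approximation
  preserves convergence and the sign of the limit.\<close>

lemma convergent_nonneg_uniform_approx:
  fixes x :: "nat \<Rightarrow> real"
  assumes "\<And>\<epsilon>. \<epsilon> > 0 \<Longrightarrow> \<exists>y l. y \<longlonglongrightarrow> l \<and> l \<ge> 0 \<and> (\<forall>n. \<bar>x n - y n\<bar> \<le> \<epsilon>)"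
  shows "\<exists>l\<ge>0. x \<longlonglongrightarrow> l"
proof -
  have "Cauchy x"
  proof (rule metric_CauchyI)
    fix e :: real assume "e > 0"
    then have "e / 3 > 0" by simp
    then obtain y l where y: "y \<longlonglongrightarrow> l" "\<And>n. \<bar>x n - y n\<bar> \<le> e / 3" using assms[OF \<open>e / 3 > 0\<close>] by (elim exE conjE) auto
    obtain N where N: "\<And>m n. m \<ge> N \<Longrightarrow> n \<ge> N \<Longrightarrow> dist (y m) (y n) < e / 3"
      using LIMSEQ_imp_Cauchy[OF y(1)] \<open>e / 3 > 0\<close> unfolding Cauchy_def by blast
    have "dist (x m) (x n) < e" if "m \<ge> N" "n \<ge> N" for m n
      using N[OF that] y(2)[of m] y(2)[of n] unfolding dist_real_def by linarith
    then show "\<exists>M. \<forall>m\<ge>M. \<forall>n\<ge>M. dist (x m) (x n) < e" by blast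
  qed
  then obtain L where L: "x \<longlonglongrightarrow> L" using Cauchy_convergent_iff convergent_def by blast
  have "L \<ge> - \<epsilon>" if pos: "\<epsilon> > 0" for \<epsilon>
  proof -
    obtain y l where y: "y \<longlonglongrightarrow> l" "l \<ge> 0" "\<And>n. \<bar>x n - y n\<bar> \<le> \<epsilon>" using assms[OF pos] by (elim exE conjE) auto
    have "L - l \<ge> - \<epsilon>"
    proof (rule tendsto_lowerbound[OF tendsto_diff[OF L y(1)]])
      show "\<forall>\<^sub>F n in sequentially. - \<epsilon> \<le> x n - y n"
        using y(3) by (intro always_eventually allI) (metis abs_le_D2 minus_le_iff)
    qed simp
    then show ?thesis using y(2) by linarith
  qed
  \<comment> \<open>For negative \<open>L\<close> this instance would say
    \<open>L \<ge> L / 2\<close>.\<close>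
  from this[of "- L / 2"] have "L \<ge> 0" by linarith
  then show ?thesis using L by blast
qed

section \<open>Correlations under an invariant flow\<close>

locale invariant_flow = finite_measure \<mu> for \<mu> :: "'a measure" +
  fixes \<phi> :: "'a \<Rightarrow> real \<Rightarrow> 'a"
  assumes measurable_pair: "(\<lambda>(m, t). \<phi> m t) \<in> measurable (\<mu> \<Otimes>\<^sub>M lborel) \<mu>"
    and preserving: "distr \<mu> \<mu> (\<lambda>m. \<phi> m t) = \<mu>"
    and flow_plus: "\<phi> m (s + t) = \<phi> (\<phi> m s) t"
begin

definition L2 :: "('a \<Rightarrow> real) set" where
  "L2 = {f \<in> borel_measurable \<mu>. integrable \<mu> (\<lambda>m. (f m)\<^sup>2)}"

definition inner2 :: "('a \<Rightarrow> real) \<Rightarrow> ('a \<Rightarrow> real) \<Rightarrow> real" where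
  "inner2 f g = (LINT m|\<mu>. f m * g m)"

definition corr :: "('a \<Rightarrow> real) \<Rightarrow> ('a \<Rightarrow> real) \<Rightarrow> real \<Rightarrow> real" where
  "corr f g t = inner2 f (\<lambda>m. g (\<phi> m t))"

lemma measurable_flow_at [measurable]: "(\<lambda>m. \<phi> m t) \<in> measurable \<mu> \<mu>"
  using measurable_compose[OF measurable_Pair2'[of t lborel \<mu>] measurable_pair] by simp

lemma L2_measurable: "f \<in> L2 \<Longrightarrow> f \<in> borel_measurable \<mu>"
  by (simp add: L2_def)

lemma integral_flow:
  assumes "f \<in> borel_measurable \<mu>"
  shows "(LINT m|\<mu>. f (\<phi> m t)) = (LINT m|\<mu>. f m :: real)"
    and "integrable \<mu> (\<lambda>m. f (\<phi> m t)) \<longleftrightarrow> integrable \<mu> f"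
  using integral_distr[OF measurable_flow_at[of t] assms] integrable_distr_eq[OF measurable_flow_at[of t] assms]
  by (simp_all add: preserving)

lemma L2_flow: "f \<in> L2 \<Longrightarrow> (\<lambda>m. f (\<phi> m t)) \<in> L2"
  using integral_flow(2)[of "\<lambda>m. (f m)\<^sup>2" t] measurable_compose[OF measurable_flow_at[of t], of f]
  by (auto simp: L2_def)

lemma inner2_flow:
  assumes "f \<in> L2" "g \<in> L2"
  shows "inner2 (\<lambda>m. f (\<phi> m t)) (\<lambda>m. g (\<phi> m t)) = inner2 f g"
  unfolding inner2_def using assms by (intro integral_flow(1)[of "\<lambda>m. f m * g m"]) (auto simp: L2_def)

lemma L2_integrable_mult:
  assumes "f \<in> L2" "g \<in> L2"
  shows "integrable \<mu> (\<lambda>m. f m * g m)"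
proof (rule Bochner_Integration.integrable_bound[where f = "\<lambda>m. (f m)\<^sup>2 + (g m)\<^sup>2"])
  show "AE m in \<mu>. norm (f m * g m) \<le> norm ((f m)\<^sup>2 + (g m)\<^sup>2)"
  proof (rule AE_I2)
    fix m
    have "2 * \<bar>f m * g m\<bar> \<le> (f m)\<^sup>2 + (g m)\<^sup>2"
      using sum_squares_bound[of "\<bar>f m\<bar>" "\<bar>g m\<bar>"] by (simp add: abs_mult)
    then show "norm (f m * g m) \<le> norm ((f m)\<^sup>2 + (g m)\<^sup>2)" by simp
  qed
qed (use assms in \<open>auto simp: L2_def\<close>)

lemma L2_add: "f \<in> L2 \<Longrightarrow> g \<in> L2 \<Longrightarrow> (\<lambda>m. f m + g m) \<in> L2"
  using L2_integrable_mult[of f g] by (auto simp: L2_def power2_sum mult.assoc)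

lemma L2_cmult: "f \<in> L2 \<Longrightarrow> (\<lambda>m. c * f m) \<in> L2"
  by (auto simp: L2_def power_mult_distrib)

lemma L2_diff: "f \<in> L2 \<Longrightarrow> g \<in> L2 \<Longrightarrow> (\<lambda>m. f m - g m) \<in> L2"
  using L2_add[OF _ L2_cmult[of g "-1"]] by simp

lemma L2_bounded: "f \<in> borel_measurable \<mu> \<Longrightarrow> (\<And>m. \<bar>f m\<bar> \<le> C) \<Longrightarrow> f \<in> L2"
proof -
  assume f: "f \<in> borel_measurable \<mu>" "\<And>m. \<bar>f m\<bar> \<le> C"
  have "integrable \<mu> (\<lambda>m. (f m)\<^sup>2)"
  proof (rule integrable_const_bound[where B = "C\<^sup>2"])
    show "AE m in \<mu>. norm ((f m)\<^sup>2) \<le> C\<^sup>2"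
      using f(2) by (intro AE_I2) (metis abs_ge_zero norm_power power_mono real_norm_def)
  qed (use f in auto)
  then show ?thesis using f by (simp add: L2_def)
qed

text \<open>Completing the square with a free weight \<open>k\<close>; a later choice of
  \<open>k\<close> does the work of the Cauchy-Schwarz inequality without square roots.\<close>

lemma inner2_bound:
  assumes "f \<in> L2" "g \<in> L2" "k > 0"
  shows "\<bar>inner2 f g\<bar> \<le> k * inner2 f f + inner2 g g / k"
proof -
  have "\<bar>inner2 f g\<bar> \<le> (LINT m|\<mu>. k * (f m * f m) + (g m * g m) / k)"
    unfolding inner2_def real_norm_def[symmetric]
  proof (intro abs_integral_le)
    fix m
    have "0 \<le> (\<bar>f m\<bar> * k - \<bar>g m\<bar>)\<^sup>2 / k" using assms by simp
    also have "\<dots> = k * (f m * f m) - 2 * \<bar>f m * g m\<bar> + (g m * g m) / k"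
      using assms by (simp add: power2_diff field_simps abs_mult power2_eq_square)
    finally show "norm (f m * g m) \<le> k * (f m * f m) + (g m * g m) / k" by simp
  qed (use L2_integrable_mult assms in auto)
  also have "\<dots> = k * inner2 f f + inner2 g g / k"
    unfolding inner2_def using L2_integrable_mult assms by simp
  finally show ?thesis .
qed

lemma corr_bound: "f \<in> L2 \<Longrightarrow> g \<in> L2 \<Longrightarrow> k > 0 \<Longrightarrow> \<bar>corr f g t\<bar> \<le> k * inner2 f f + inner2 g g / k"
  using inner2_bound[of f "\<lambda>m. g (\<phi> m t)" k] L2_flow[of g t] inner2_flow[of g g t] by (simp add: corr_def)

lemma measurable_flow_pair: "g \<in> borel_measurable \<mu> \<Longrightarrow> (\<lambda>(m, t). g (\<phi> m t)) \<in> borel_measurable (\<mu> \<Otimes>\<^sub>M lborel)"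
  using measurable_compose[OF measurable_pair, of g] by (simp add: case_prod_beta')

lemma measurable_orbit: "g \<in> borel_measurable \<mu> \<Longrightarrow> m \<in> space \<mu> \<Longrightarrow> (\<lambda>t. g (\<phi> m t)) \<in> borel_measurable lborel"
  using measurable_compose[OF measurable_Pair1' measurable_flow_pair] by fastforce

lemma measurable_corr:
  assumes "f \<in> borel_measurable \<mu>" "g \<in> borel_measurable \<mu>"
  shows "corr f g \<in> borel_measurable lborel"
proof -
  have "(\<lambda>(t, m). (m, t)) \<in> measurable (lborel \<Otimes>\<^sub>M \<mu>) (\<mu> \<Otimes>\<^sub>M lborel)"
    by (rule measurable_pair_swap')
  from measurable_compose[OF this measurable_flow_pair[OF assms(2)]]
  have "(\<lambda>(t, m). g (\<phi> m t)) \<in> borel_measurable (lborel \<Otimes>\<^sub>M \<mu>)" by (simp add: case_prod_beta')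
  then have "(\<lambda>(t, m). f m * g (\<phi> m t)) \<in> borel_measurable (lborel \<Otimes>\<^sub>M \<mu>)"
    using assms(1) by (simp add: case_prod_beta')
  then show ?thesis unfolding corr_def[abs_def] inner2_def
    by (rule borel_measurable_lebesgue_integral)
qed

lemma average_measurable:
  assumes "g \<in> borel_measurable \<mu>"
  shows "(\<lambda>m. time_average (\<lambda>t. g (\<phi> m t)) T) \<in> borel_measurable \<mu>"
proof -
  have "(\<lambda>(m, t). indicator {0..T} t *\<^sub>R g (\<phi> m t)) \<in> borel_measurable (\<mu> \<Otimes>\<^sub>M lborel)"
    using measurable_flow_pair[OF assms] by (simp add: case_prod_beta')
  then show ?thesis unfolding time_average_def set_lebesgue_integral_def
    by (intro borel_measurable_times borel_measurable_const lborel.borel_measurable_lebesgue_integral)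
qed

text \<open>Fubini's theorem; since \<open>g\<close> is bounded and \<open>f\<close> integrable, the
  double integral converges absolutely.\<close>

lemma average_corr:
  assumes f: "f \<in> L2" and g: "g \<in> borel_measurable \<mu>" "\<And>m. \<bar>g m\<bar> \<le> C"
  shows "time_average (corr f g) T = (LINT m|\<mu>. f m * time_average (\<lambda>t. g (\<phi> m t)) T)"
proof -
  interpret P: pair_sigma_finite \<mu> lborel ..
  have pull: "(LINT m|\<mu>. f m * (indicator {0..T} t *\<^sub>R g (\<phi> m t))) = indicator {0..T} t * (LINT m|\<mu>. f m * g (\<phi> m t))" for t
    by (subst integral_mult_right_zero[symmetric]) (simp add: mult.left_commute)
  have C: "C \<ge> 0" using g(2)[of undefined] by linarith
  have fm: "f \<in> borel_measurable \<mu>" using f by (rule L2_measurable)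
  have f1: "integrable \<mu> f"
    using L2_integrable_mult[OF f L2_bounded[of "\<lambda>_. 1" 1]] by simp
  let ?F = "\<lambda>(m, t). f m * (indicator {0..T} t *\<^sub>R g (\<phi> m t))"
  have Fm: "?F \<in> borel_measurable (\<mu> \<Otimes>\<^sub>M lborel)"
    using measurable_flow_pair[OF g(1)] fm by (simp add: case_prod_beta')
  have orb: "integrable lborel (\<lambda>t. indicator {0..T} t *\<^sub>R g (\<phi> m t))" if "m \<in> space \<mu>" for m
    by (rule integrable_bounded_interval[OF measurable_orbit[OF g(1) that] g(2)])
  have "integrable (\<mu> \<Otimes>\<^sub>M lborel) ?F"
  proof (rule P.Fubini_integrable[OF Fm])
    show "AE m in \<mu>. integrable lborel (\<lambda>t. ?F (m, t))" using orb by auto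
    show "integrable \<mu> (\<lambda>m. LINT t|lborel. norm (?F (m, t)))"
    proof (rule Bochner_Integration.integrable_bound[where f = "\<lambda>m. C * \<bar>T\<bar> * f m"])
      show "(\<lambda>m. LINT t|lborel. norm (?F (m, t))) \<in> borel_measurable \<mu>"
        using Fm by (intro lborel.borel_measurable_lebesgue_integral) (simp add: case_prod_beta')
      show "AE m in \<mu>. norm (LINT t|lborel. norm (?F (m, t))) \<le> norm (C * \<bar>T\<bar> * f m)"
      proof (rule AE_I2)
        fix m assume m: "m \<in> space \<mu>"
        have "norm (LINT t|lborel. norm (?F (m, t))) = (LINT t|lborel. norm (?F (m, t)))"
          by (simp add: integral_nonneg_AE)
        also have "\<dots> \<le> (LINT t|lborel. \<bar>f m\<bar> * C * indicator {0..T} t)"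
        proof (intro integral_mono)
          fix t
          have "\<bar>f m\<bar> * \<bar>g (\<phi> m t)\<bar> \<le> \<bar>f m\<bar> * C" using g(2) by (intro mult_left_mono) auto
          then show "norm (?F (m, t)) \<le> \<bar>f m\<bar> * C * indicator {0..T} t"
            by (auto simp: indicator_def abs_mult)
        qed (use orb[OF m] interval_const_integral(1)[of "\<bar>f m\<bar> * C" 0 T] in auto)
        also have "\<dots> \<le> \<bar>f m\<bar> * C * \<bar>T\<bar>" using C by (cases "T \<ge> 0") (auto intro!: mult_nonneg_nonpos)
        also have "\<dots> = norm (C * \<bar>T\<bar> * f m)" using C by (simp add: abs_mult)
        finally show "norm (LINT t|lborel. norm (?F (m, t))) \<le> norm (C * \<bar>T\<bar> * f m)" .
      qed
    qed (use f1 in auto)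
  qed
  from P.Fubini_integral[OF this]
  have "(LINT t|lborel. LINT m|\<mu>. f m * (indicator {0..T} t *\<^sub>R g (\<phi> m t))) =
      (LINT m|\<mu>. LINT t|lborel. f m * (indicator {0..T} t *\<^sub>R g (\<phi> m t)))" by simp
  also have "\<dots> = (LINT m|\<mu>. f m * (LINT t|lborel. indicator {0..T} t *\<^sub>R g (\<phi> m t)))" by simp
  finally have "(LINT t|lborel. indicator {0..T} t * (LINT m|\<mu>. f m * g (\<phi> m t))) =
      (LINT m|\<mu>. f m * (LINT t|lborel. indicator {0..T} t *\<^sub>R g (\<phi> m t)))"
    unfolding pull .
  then show ?thesis
    unfolding time_average_def corr_def inner2_def set_lebesgue_integral_def
    by (simp add: mult.left_commute)
qed

end

text \<open>Ergodic regularity as it appears after disintegration: convergence along integer times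
  at almost every point.\<close>

locale ergodic_flow = invariant_flow +
  assumes averages_converge: "B \<in> borel_measurable \<mu> \<Longrightarrow> (\<And>m. \<bar>B m\<bar> \<le> C) \<Longrightarrow>
       AE m in \<mu>. convergent (\<lambda>n. time_average (\<lambda>t. B (\<phi> m t)) (real n))"
begin

text \<open>The limit \<open>\<beta>\<close> of the time averages of \<open>B\<close> is invariant,
  in effect the projection of \<open>B\<close> to the invariant functions. The averages of
  \<open>corr \<beta> B\<close> tend to \<open>inner2 \<beta> \<beta>\<close>, but by invariance
  they are constantly \<open>inner2 \<beta> B\<close>. The limit for \<open>B\<close> itself is this
  same number, hence nonnegative.\<close>

lemma bounded_limit:
  assumes B: "B \<in> borel_measurable \<mu>" "\<And>m. \<bar>B m\<bar> \<le> C"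
  shows "\<exists>l\<ge>0. (\<lambda>n. time_average (corr B B) (real n)) \<longlonglongrightarrow> l"
proof -
  have C: "C \<ge> 0" using B(2)[of undefined] by linarith
  let ?a = "\<lambda>n m. time_average (\<lambda>t. B (\<phi> m t)) (real n)"
  have a_bound: "\<bar>?a n m\<bar> \<le> C" if "m \<in> space \<mu>" for n m
    using measurable_orbit[OF B(1) that] B(2) by (intro time_average_bound) auto
  have a_meas: "?a n \<in> borel_measurable \<mu>" for n by (rule average_measurable[OF B(1)])
  note conv = averages_converge[OF B]
  define \<beta> where "\<beta> m = lim (\<lambda>n. ?a n m)" for m
  have \<beta>_meas: "\<beta> \<in> borel_measurable \<mu>" unfolding \<beta>_def by (rule borel_measurable_lim_metric[OF a_meas])
  have \<beta>_lim: "AE m in \<mu>. (\<lambda>n. ?a n m) \<longlonglongrightarrow> \<beta> m"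
    using conv by eventually_elim (simp add: \<beta>_def convergent_LIMSEQ_iff)
  have \<beta>_bound: "AE m in \<mu>. \<bar>\<beta> m\<bar> \<le> C"
    using \<beta>_lim AE_space
  proof eventually_elim
    case (elim m)
    from tendsto_rabs[OF elim(1)] show ?case
      by (rule tendsto_upperbound) (use a_bound elim in auto)
  qed
  have \<beta>2: "integrable \<mu> (\<lambda>m. (\<beta> m)\<^sup>2)"
  proof (rule integrable_const_bound[where B = "C\<^sup>2"])
    show "AE m in \<mu>. norm ((\<beta> m)\<^sup>2) \<le> C\<^sup>2"
      using \<beta>_bound by eventually_elim (metis abs_power2 power2_abs power_mono abs_ge_zero real_norm_def)
  qed (use \<beta>_meas in auto)
  then have \<beta>_L2: "\<beta> \<in> L2" using \<beta>_meas by (simp add: L2_def)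
  have B_L2: "B \<in> L2" using B by (rule L2_bounded)
  have lim: "(\<lambda>n. time_average (corr f B) (real n)) \<longlonglongrightarrow> inner2 f \<beta>" if f: "f \<in> L2" for f
    unfolding average_corr[OF f B] inner2_def
  proof (rule integral_dominated_convergence[where w = "\<lambda>m. C * \<bar>f m\<bar>"])
    have "integrable \<mu> f" using L2_integrable_mult[OF f L2_bounded[of "\<lambda>_. 1" 1]] by simp
    then show "integrable \<mu> (\<lambda>m. C * \<bar>f m\<bar>)" by simp
    show "AE m in \<mu>. (\<lambda>n. f m * ?a n m) \<longlonglongrightarrow> f m * \<beta> m"
      using \<beta>_lim by eventually_elim (intro tendsto_intros)
    show "AE m in \<mu>. norm (f m * ?a n m) \<le> C * \<bar>f m\<bar>" for n
      using a_bound by (intro AE_I2) (auto simp: abs_mult mult.commute[of C] intro!: mult_left_mono)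
  qed (use L2_measurable[OF f] \<beta>_meas a_meas in auto)
  \<comment> \<open>Convergence at \<open>m\<close> forces convergence at \<open>\<phi> m s\<close>
    to the same value, so no exceptional set has to be moved along the flow.\<close>
  have inv: "AE m in \<mu>. \<beta> (\<phi> m s) = \<beta> m" if s: "s \<ge> 0" for s
    using \<beta>_lim AE_space
  proof eventually_elim
    case (elim m)
    have "(\<lambda>n. ?a n (\<phi> m s) - ?a n m) \<longlonglongrightarrow> 0"
    proof (rule Lim_null_comparison)
      show "(\<lambda>n. 2 * s * C / real n) \<longlonglongrightarrow> 0" by real_asymp
      show "\<forall>\<^sub>F n in sequentially. norm (?a n (\<phi> m s) - ?a n m) \<le> 2 * s * C / real n"
        using eventually_gt_at_top[of 0]
      proof eventually_elim
        case (elim n)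
        then show ?case
          using time_average_shift[OF measurable_orbit[OF B(1) \<open>m \<in> space \<mu>\<close>], of C "real n" s] B(2) s
          by (simp add: flow_plus)
      qed
    qed
    from tendsto_add[OF this elim(1)] have "(\<lambda>n. ?a n (\<phi> m s)) \<longlonglongrightarrow> \<beta> m" by simp
    then show ?case unfolding \<beta>_def[of "\<phi> m s"] by (rule limI)
  qed
  have const: "corr \<beta> B t = inner2 \<beta> B" if "t \<ge> 0" for t
  proof -
    have "corr \<beta> B t = inner2 (\<lambda>m. \<beta> (\<phi> m t)) (\<lambda>m. B (\<phi> m t))"
      unfolding corr_def inner2_def using inv[OF that] L2_measurable[OF \<beta>_L2] L2_measurable[OF B_L2]
        L2_measurable[OF L2_flow[OF \<beta>_L2]] L2_measurable[OF L2_flow[OF B_L2]]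
      by (intro integral_cong_AE) auto
    also have "\<dots> = inner2 \<beta> B" by (rule inner2_flow[OF \<beta>_L2 B_L2])
    finally show ?thesis .
  qed
  have "time_average (corr \<beta> B) (real n) = inner2 \<beta> B" if "n > 0" for n
  proof -
    have "(LINT t:{0..real n}|lborel. corr \<beta> B t) = (LINT t:{0..real n}|lborel. inner2 \<beta> B)"
      by (rule set_lebesgue_integral_cong) (use const in auto)
    then show ?thesis using that by (simp add: time_average_def set_lebesgue_integral_def)
  qed
  then have "\<forall>\<^sub>F n in sequentially. time_average (corr \<beta> B) (real n) = inner2 \<beta> B"
    by (intro eventually_mono[OF eventually_gt_at_top[of 0]])
  then have "(\<lambda>n. time_average (corr \<beta> B) (real n)) \<longlonglongrightarrow> inner2 \<beta> B"
    by (rule tendsto_eventually)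
  then have "inner2 \<beta> B = inner2 \<beta> \<beta>" using LIMSEQ_unique[OF _ lim[OF \<beta>_L2]] by blast
  then have "inner2 B \<beta> \<ge> 0" by (simp add: inner2_def mult.commute)
  then show ?thesis using lim[OF B_L2] by blast
qed

lemma truncation:
  assumes f: "f \<in> L2" and \<epsilon>: "\<epsilon> > 0"
  shows "\<exists>B C. B \<in> borel_measurable \<mu> \<and> (\<forall>m. \<bar>B m\<bar> \<le> C) \<and> (\<forall>m. \<bar>B m\<bar> \<le> \<bar>f m\<bar>) \<and>
     inner2 (\<lambda>m. f m - B m) (\<lambda>m. f m - B m) < \<epsilon>"
proof -
  let ?B = "\<lambda>k m. max (- real k) (min (real k) (f m))"
  have [measurable]: "f \<in> borel_measurable \<mu>" using f by (rule L2_measurable)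
  have "(\<lambda>k. LINT m|\<mu>. (f m - ?B k m) * (f m - ?B k m)) \<longlonglongrightarrow> (LINT m|\<mu>. 0)"
  proof (rule integral_dominated_convergence[where w = "\<lambda>m. (f m)\<^sup>2"])
    show "AE m in \<mu>. (\<lambda>k. (f m - ?B k m) * (f m - ?B k m)) \<longlonglongrightarrow> 0"
    proof (rule AE_I2)
      fix m
      have "\<forall>\<^sub>F k in sequentially. (f m - ?B k m) * (f m - ?B k m) = 0"
        using eventually_ge_at_top[of "nat \<lceil>\<bar>f m\<bar>\<rceil>"]
      proof eventually_elim
        case (elim k)
        then have "\<bar>f m\<bar> \<le> real k" by linarith
        then have "?B k m = f m" by (auto simp: max_def min_def)
        then show ?case by simp
      qed
      then show "(\<lambda>k. (f m - ?B k m) * (f m - ?B k m)) \<longlonglongrightarrow> 0" by (rule tendsto_eventually)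
    qed
    show "AE m in \<mu>. norm ((f m - ?B k m) * (f m - ?B k m)) \<le> (f m)\<^sup>2" for k
    proof (rule AE_I2)
      fix m
      have "\<bar>f m - ?B k m\<bar> \<le> \<bar>f m\<bar>" by (auto simp: max_def min_def)
      then have "(f m - ?B k m)\<^sup>2 \<le> (f m)\<^sup>2" by (simp add: abs_le_square_iff)
      then show "norm ((f m - ?B k m) * (f m - ?B k m)) \<le> (f m)\<^sup>2" by (simp add: power2_eq_square)
    qed
  qed (use f in \<open>auto simp: L2_def\<close>)
  then have "\<forall>\<^sub>F k in sequentially. (LINT m|\<mu>. (f m - ?B k m) * (f m - ?B k m)) < \<epsilon>"
    using \<epsilon> by (intro order_tendstoD(2)) auto
  then obtain k where "(LINT m|\<mu>. (f m - ?B k m) * (f m - ?B k m)) < \<epsilon>"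
    by (auto simp: eventually_sequentially)
  then show ?thesis
    by (intro exI[of _ "?B k"] exI[of _ "real k"]) (auto simp: inner2_def max_def min_def)
qed

lemma corr_diff:
  assumes "f \<in> L2" "g \<in> L2" "h \<in> L2"
  shows "corr f (\<lambda>m. g m - h m) t = corr f g t - corr f h t"
    and "corr (\<lambda>m. g m - h m) f t = corr g f t - corr h f t"
  using L2_integrable_mult[of f "\<lambda>m. g (\<phi> m t)"] L2_integrable_mult[of f "\<lambda>m. h (\<phi> m t)"]
    L2_integrable_mult[of g "\<lambda>m. f (\<phi> m t)"] L2_integrable_mult[of h "\<lambda>m. f (\<phi> m t)"] L2_flow assms
  by (auto simp: corr_def inner2_def right_diff_distrib left_diff_distrib)

lemma time_average_diff:
  assumes "f \<in> borel_measurable lborel" "g \<in> borel_measurable lborel" "\<And>t. \<bar>f t\<bar> \<le> C" "\<And>t. \<bar>g t\<bar> \<le> D"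
  shows "time_average (\<lambda>t. f t - g t) T = time_average f T - time_average g T"
proof -
  show ?thesis
    using integrable_bounded_interval[OF assms(1,3), of 0 T] integrable_bounded_interval[OF assms(2,4), of 0 T]
    by (simp add: time_average_def set_lebesgue_integral_def right_diff_distrib)
qed

lemma autocorrelation_limit:
  assumes f: "f \<in> L2"
  shows "\<exists>l\<ge>0. (\<lambda>n. time_average (corr f f) (real n)) \<longlonglongrightarrow> l"
proof (rule convergent_nonneg_uniform_approx)
  fix \<epsilon> :: real assume \<epsilon>: "\<epsilon> > 0"
  define S where "S = inner2 f f"
  have S: "S \<ge> 0" by (simp add: S_def inner2_def)
  \<comment> \<open>The difference of the two correlations is bounded by four terms, each at most
    \<open>k * S\<close> or \<open>?D / k\<close>. This \<open>k\<close> and the truncation error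
    \<open>k * \<epsilon> / 4\<close> make every one of them at most \<open>\<epsilon> / 4\<close>;
    adding 1 covers \<open>S = 0\<close>.\<close>
  define k where "k = \<epsilon> / 4 / (S + 1)"
  have k: "k > 0" using \<epsilon> S by (simp add: k_def)
  have kS: "k * S \<le> \<epsilon> / 4"
  proof -
    have "k * S \<le> k * (S + 1)" using k by simp
    also have "\<dots> = \<epsilon> / 4" using S by (intro nonzero_eq_divide_eq[THEN iffD1, OF _ k_def]) simp
    finally show ?thesis .
  qed
  obtain B C where B: "B \<in> borel_measurable \<mu>" "\<And>m. \<bar>B m\<bar> \<le> C" "\<And>m. \<bar>B m\<bar> \<le> \<bar>f m\<bar>"
      and D: "inner2 (\<lambda>m. f m - B m) (\<lambda>m. f m - B m) < k * \<epsilon> / 4"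
    using truncation[OF f, of "k * \<epsilon> / 4"] k \<epsilon> by auto
  have BL: "B \<in> L2" by (rule L2_bounded[OF B(1,2)])
  have dL: "(\<lambda>m. f m - B m) \<in> L2" by (rule L2_diff[OF f BL])
  have BS: "inner2 B B \<le> S" unfolding S_def inner2_def
  proof (intro integral_mono L2_integrable_mult BL f)
    fix m show "B m * B m \<le> f m * f m" using B(3)[of m] by (metis abs_le_square_iff power2_eq_square)
  qed
  let ?D = "inner2 (\<lambda>m. f m - B m) (\<lambda>m. f m - B m)"
  have Dk: "?D / k \<le> \<epsilon> / 4" using D k by (simp add: field_simps)
  have close: "\<bar>corr f f t - corr B B t\<bar> \<le> \<epsilon>" for t
  proof -
    have "corr f f t - corr B B t = corr f (\<lambda>m. f m - B m) t + corr (\<lambda>m. f m - B m) B t"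
      using corr_diff[OF f f BL] corr_diff[OF BL f BL] by simp
    moreover have "\<bar>corr f (\<lambda>m. f m - B m) t\<bar> \<le> k * S + ?D / k"
      unfolding S_def by (rule corr_bound[OF f dL k])
    moreover have "\<bar>corr (\<lambda>m. f m - B m) B t\<bar> \<le> 1 / k * ?D + inner2 B B / (1 / k)"
      by (rule corr_bound[OF dL BL]) (use k in simp)
    moreover have "inner2 B B / (1 / k) \<le> k * S" using BS k by (simp add: mult.commute mult_left_mono)
    moreover have "1 / k * ?D = ?D / k" by simp
    ultimately show ?thesis using kS Dk by linarith
  qed
  obtain l where l: "l \<ge> 0" "(\<lambda>n. time_average (corr B B) (real n)) \<longlonglongrightarrow> l"
    using bounded_limit[OF B(1,2)] by blast
  have m: "corr f f \<in> borel_measurable lborel" "corr B B \<in> borel_measurable lborel"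
    by (rule measurable_corr[OF L2_measurable[OF f] L2_measurable[OF f]], rule measurable_corr[OF B(1) B(1)])
  have "\<bar>time_average (corr f f) (real n) - time_average (corr B B) (real n)\<bar> \<le> \<epsilon>" for n
    unfolding time_average_diff[OF m corr_bound[OF f f zero_less_one] corr_bound[OF BL BL zero_less_one], symmetric]
    by (rule time_average_bound) (use m close in auto)
  then show "\<exists>y l. y \<longlonglongrightarrow> l \<and> l \<ge> 0 \<and> (\<forall>n. \<bar>time_average (corr f f) (real n) - y n\<bar> \<le> \<epsilon>)"
    using l by blast
qed

text \<open>Subtracting an invariant \<open>p\<close> changes the autocorrelation by a constant in
  time, and the averaged autocorrelation of the remainder has a nonnegative limit.\<close>

lemma correlation_lower_bound:
  assumes f: "f \<in> L2" and p: "p \<in> L2" "\<And>m t. p (\<phi> m t) = p m"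
    and l: "(time_average (corr f f) \<longlongrightarrow> l) at_top"
  shows "l \<ge> 2 * inner2 f p - inner2 p p"
proof -
  let ?r = "\<lambda>m. f m - p m"
  have r: "?r \<in> L2" by (rule L2_diff[OF f p(1)])
  have pt: "corr f p t = inner2 f p" "corr p p t = inner2 p p" for t by (simp_all add: corr_def p(2))
  \<comment> \<open>Here \<open>f\<close> is the moving factor; invariance lets \<open>p\<close>
    move along with it, and the measure-preserving flow then removes the time.\<close>
  have pf: "corr p f t = inner2 f p" for t
    using inner2_flow[OF p(1) f, of t] by (simp add: corr_def p(2) inner2_def mult.commute)
  have eq: "corr f f t = corr ?r ?r t - (inner2 p p - 2 * inner2 f p)" for t
    using corr_diff[OF r f p(1), of t] corr_diff[OF f f p(1), of t] corr_diff[OF p(1) f p(1), of t]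
    by (simp add: pt pf)
  obtain q where q: "q \<ge> 0" "(\<lambda>n. time_average (corr ?r ?r) (real n)) \<longlonglongrightarrow> q"
    using autocorrelation_limit[OF r] by blast
  let ?K = "inner2 p p - 2 * inner2 f p"
  have "time_average (corr f f) (real n) = time_average (corr ?r ?r) (real n) - ?K" if "n > 0" for n
  proof -
    have "time_average (corr f f) (real n) = time_average (corr ?r ?r) (real n) - time_average (\<lambda>_. ?K) (real n)"
      unfolding eq[abs_def]
      by (rule time_average_diff[OF measurable_corr _ corr_bound[OF r r zero_less_one]])
         (use L2_measurable[OF r] in auto)
    also have "time_average (\<lambda>_. ?K) (real n) = ?K"
      using that by (simp add: time_average_def set_lebesgue_integral_def)
    finally show ?thesis .
  qed
  then have "\<forall>\<^sub>F n in sequentially. time_average (corr ?r ?r) (real n) - ?K = time_average (corr f f) (real n)"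
    by (intro eventually_mono[OF eventually_gt_at_top[of 0]]) simp
  with tendsto_diff[OF q(2) tendsto_const] have "(\<lambda>n. time_average (corr f f) (real n)) \<longlonglongrightarrow> q - ?K"
    by (rule Lim_transform_eventually)
  moreover have "(\<lambda>n. time_average (corr f f) (real n)) \<longlonglongrightarrow> l"
    by (rule filterlim_compose[OF l filterlim_real_sequentially])
  ultimately have "l = q - ?K" using LIMSEQ_unique by blast
  then show ?thesis using q(1) by linarith
qed

lemma correlation_limit_exists:
  assumes f: "f \<in> L2"
  shows "\<exists>l. (time_average (corr f f) \<longlongrightarrow> l) at_top"
proof -
  obtain l where "(\<lambda>n. time_average (corr f f) (real n)) \<longlonglongrightarrow> l"
    using autocorrelation_limit[OF f] by blast
  then show ?thesis
    using time_average_real_limit[OF measurable_corr corr_bound[OF f f zero_less_one]] L2_measurable[OF f] by blast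
qed

end

section \<open>Independence of the monomials and the Gram matrix\<close>

lemma finite_multi_indices: "finite (multi_indices d :: ('k::finite \<Rightarrow> nat) set)"
proof -
  have "n i \<le> d" if "(\<Sum>i\<in>UNIV. n i) \<le> d" for n :: "'k \<Rightarrow> nat" and i
    using member_le_sum[of i UNIV n] that by simp
  then have "multi_indices d \<subseteq> PiE UNIV (\<lambda>_ :: 'k. {..d})"
    by (auto simp: multi_indices_def)
  then show ?thesis by (rule finite_subset) (intro finite_PiE; simp)
qed

text \<open>The weights are the powers of \<open>d + 1\<close>, so that the weighted degree of an exponent vector is
  a number with these digits.\<close>

lemma injective_weights:
  assumes "finite K"
  shows "\<exists>w :: 'k \<Rightarrow> nat. (\<forall>i. w i > 0) \<and>
     (\<forall>n n'. (\<forall>i\<in>K. n i \<le> d) \<longrightarrow> (\<forall>i\<in>K. n' i \<le> d) \<longrightarrow> (\<Sum>i\<in>K. n i * w i) = (\<Sum>i\<in>K. n' i * w i) \<longrightarrow> (\<forall>i\<in>K. n i = n' i))"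
  using assms
proof (induction K rule: finite_induct)
  case empty
  then show ?case by (intro exI[of _ "\<lambda>_. 1"]) simp
next
  case (insert a K)
  then obtain w where w: "\<And>i. w i > 0" "\<And>n n'. (\<forall>i\<in>K. n i \<le> d) \<Longrightarrow> (\<forall>i\<in>K. n' i \<le> d) \<Longrightarrow>
      (\<Sum>i\<in>K. n i * w i) = (\<Sum>i\<in>K. n' i * w i) \<Longrightarrow> \<forall>i\<in>K. n i = n' i" by blast
  define w' where "w' i = (if i = a then 1 else (d + 1) * w i)" for i
  have eq: "(\<Sum>i\<in>insert a K. n i * w' i) = n a + (d + 1) * (\<Sum>i\<in>K. n i * w i)" for n :: "'k \<Rightarrow> nat"
  proof -
    have "(\<Sum>i\<in>K. n i * w' i) = (\<Sum>i\<in>K. (d + 1) * (n i * w i))"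
      using insert.hyps by (intro sum.cong) (auto simp: w'_def algebra_simps)
    then show ?thesis using insert.hyps by (simp only: sum.insert sum_distrib_left[symmetric]) (simp add: w'_def)
  qed
  have "\<forall>i\<in>insert a K. n i = n' i"
    if n: "\<forall>i\<in>insert a K. n i \<le> d" "\<forall>i\<in>insert a K. n' i \<le> d"
      and e: "(\<Sum>i\<in>insert a K. n i * w' i) = (\<Sum>i\<in>insert a K. n' i * w' i)" for n n' :: "'k \<Rightarrow> nat"
  proof -
    have e': "n a + (d + 1) * (\<Sum>i\<in>K. n i * w i) = n' a + (d + 1) * (\<Sum>i\<in>K. n' i * w i)"
      using e unfolding eq .
    have lt: "n a < d + 1" "n' a < d + 1" using n by auto
    have "(n a + (d + 1) * (\<Sum>i\<in>K. n i * w i)) mod (d + 1) = n a"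
      "(n' a + (d + 1) * (\<Sum>i\<in>K. n' i * w i)) mod (d + 1) = n' a"
      using lt by (simp_all only: mod_mult_self2 mod_less)
    then have a: "n a = n' a" using e' by simp
    then have "(d + 1) * (\<Sum>i\<in>K. n i * w i) = (d + 1) * (\<Sum>i\<in>K. n' i * w i)"
      using e' by (simp only: add_left_cancel)
    then have "(\<Sum>i\<in>K. n i * w i) = (\<Sum>i\<in>K. n' i * w i)" by (simp only: mult_cancel1) auto
    then have "\<forall>i\<in>K. n i = n' i" using n by (intro w(2)) auto
    then show ?thesis using a by blast
  qed
  moreover have "\<forall>i. w' i > 0" using w(1) by (simp add: w'_def)
  ultimately show ?case by blast
qed

text \<open>Along every translate of the curve \<open>s \<mapsto> (s ^ w i)\<^sub>i\<close> the polynomial restricts to a nonzero polynomial in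
  \<open>s\<close>; averaging the translates of the zero set over the curve shows that it is a null set.\<close>

lemma polynomial_zeros_null:
  fixes c :: "('k::finite \<Rightarrow> nat) \<Rightarrow> real"
  assumes n0: "n\<^sub>0 \<in> multi_indices d" "c n\<^sub>0 \<noteq> 0"
  shows "{x :: real ^ 'k. (\<Sum>n\<in>multi_indices d. c n * (\<Prod>i\<in>UNIV. x $ i ^ n i)) = 0} \<in> null_sets lborel"
proof -
  let ?I = "multi_indices d :: ('k \<Rightarrow> nat) set"
  let ?P = "\<lambda>x :: real ^ 'k. \<Sum>n\<in>?I. c n * (\<Prod>i\<in>UNIV. x $ i ^ n i)"
  let ?S = "{x. ?P x = 0}"
  obtain w :: "'k \<Rightarrow> nat" where "\<forall>i. w i > 0" and w': "\<forall>n n'. (\<forall>i\<in>UNIV. n i \<le> d) \<longrightarrow> (\<forall>i\<in>UNIV. n' i \<le> d) \<longrightarrow>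
      (\<Sum>i\<in>UNIV. n i * w i) = (\<Sum>i\<in>UNIV. n' i * w i) \<longrightarrow> (\<forall>i\<in>UNIV. n i = n' i)"
    using injective_weights[OF finite_class.finite_UNIV, of d] by (elim exE conjE)
  then have w: "w i > 0" for i by simp
  let ?e = "\<lambda>n. \<Sum>i\<in>UNIV. n i * w i"
  have le: "n i \<le> d" if "n \<in> ?I" for n i
    using member_le_sum[of i UNIV n] that by (auto simp: multi_indices_def)
  have inj: "n = n'" if "n \<in> ?I" "n' \<in> ?I" "?e n = ?e n'" for n n'
    using w'[rule_format, of n n'] le that by auto
  define \<kappa> :: "real \<Rightarrow> real ^ 'k" where "\<kappa> s = (\<chi> i. s ^ w i)" for s
  have fin: "finite {s. ?P (x + \<kappa> s) = 0}" for x
  proof -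
    \<comment> \<open>The monomial with exponents \<open>n\<close> along the translated curve. As
      the weights are positive, the constants \<open>x $ i\<close> leave the leading terms alone, so
      \<open>M n\<close> is monic of degree \<open>?e n\<close>.\<close>
    define M where "M n = (\<Prod>i\<in>UNIV. ([:x $ i:] + monom 1 (w i)) ^ n i)" for n :: "'k \<Rightarrow> nat"
    have deg: "degree ([:x $ i:] + monom 1 (w i)) = w i" "lead_coeff ([:x $ i:] + monom 1 (w i)) = 1" for i
    proof -
      show d: "degree ([:x $ i:] + monom 1 (w i)) = w i"
        using w[of i] by (subst degree_add_eq_right) (auto simp: degree_monom_eq)
      show "lead_coeff ([:x $ i:] + monom 1 (w i)) = 1"
        unfolding d using w[of i] by (simp add: coeff_pCons split: nat.split)
    qed
    have nz: "[:x $ i:] + monom 1 (w i) \<noteq> 0" for i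
    proof
      assume "[:x $ i:] + monom 1 (w i) = 0"
      then show False using deg(2)[of i] by (metis leading_coeff_0_iff zero_neq_one)
    qed
    have M: "degree (M n) = ?e n" "lead_coeff (M n) = 1" for n
    proof -
      have "degree (M n) = (\<Sum>i\<in>UNIV. degree (([:x $ i:] + monom 1 (w i)) ^ n i))"
        unfolding M_def by (rule degree_prod_eq_sum_degree) (use nz in auto)
      also have "\<dots> = ?e n" by (intro sum.cong refl) (simp only: degree_power_eq[OF nz] deg)
      finally show "degree (M n) = ?e n" .
      show "lead_coeff (M n) = 1" unfolding M_def lead_coeff_prod lead_coeff_power deg(2) by simp
    qed
    define q where "q = (\<Sum>n\<in>?I. smult (c n) (M n))"
    have poly: "poly q s = ?P (x + \<kappa> s)" for s
      by (simp add: q_def M_def poly_sum poly_prod poly_monom \<kappa>_def)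
    let ?J = "{n \<in> ?I. c n \<noteq> 0}"
    have "finite ?J" by (rule finite_subset[OF _ finite_multi_indices[of d]]) auto
    then have J: "finite (?e ` ?J)" "?e ` ?J \<noteq> {}" using n0 by auto
    \<comment> \<open>Weighted degrees are distinct, so the leading term of the monomial with the
      largest one cannot cancel.\<close>
    obtain n where n: "n \<in> ?J" "?e n = Max (?e ` ?J)" using Max_in[OF J] by (metis (no_types, lifting) imageE)
    have "coeff q (?e n) = (\<Sum>n'\<in>?I. c n' * coeff (M n') (?e n))" by (simp add: q_def coeff_sum)
    also have "\<dots> = (\<Sum>n'\<in>?I. if n' = n then c n else 0)"
    proof (rule sum.cong[OF refl])
      fix n' assume n': "n' \<in> ?I"
      show "c n' * coeff (M n') (?e n) = (if n' = n then c n else 0)"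
      proof (cases "n' = n")
        case True
        then show ?thesis using M[of n] by simp
      next
        case False
        have "c n' = 0 \<or> ?e n' < ?e n"
        proof (cases "c n' = 0")
          case False
          then have "?e n' \<le> ?e n" unfolding n(2) using J n' by (intro Max_ge) auto
          moreover have "?e n' \<noteq> ?e n" using inj[OF n', of n] n \<open>n' \<noteq> n\<close> by auto
          ultimately show ?thesis by linarith
        qed simp
        then show ?thesis using False M(1)[of n'] by (auto simp: coeff_eq_0)
      qed
    qed
    also have "\<dots> = c n" using n by (simp add: finite_multi_indices)
    finally have "q \<noteq> 0" using n by auto
    then have "finite {s. poly q s = 0}" by (rule poly_roots_finite)
    then show ?thesis unfolding poly .
  qed
  have P: "continuous_on UNIV ?P" by (intro continuous_intros)
  have S: "?S \<in> sets borel"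
    by (intro borel_closed closed_Collect_eq P continuous_intros)
  have k: "continuous_on UNIV (\<lambda>p. fst p + \<kappa> (snd p))"
    unfolding \<kappa>_def by (intro continuous_intros)
  let ?f = "\<lambda>p. indicator ?S (fst p + \<kappa> (snd p)) * indicator {0..1} (snd p) :: ennreal"
  have "(\<lambda>p. fst p + \<kappa> (snd p)) \<in> borel_measurable (borel \<Otimes>\<^sub>M borel)"
    unfolding borel_prod by (rule borel_measurable_continuous_onI[OF k])
  from measurable_compose[OF this borel_measurable_indicator[OF S]]
  have "?f \<in> borel_measurable (borel \<Otimes>\<^sub>M borel)"
    by (intro borel_measurable_times_ennreal measurable_compose[OF measurable_snd borel_measurable_indicator]) simp_all
  moreover have "measurable (borel \<Otimes>\<^sub>M borel) N = measurable (lborel \<Otimes>\<^sub>M lborel) N" for N :: "ennreal measure"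
    by (intro measurable_cong_sets sets_pair_measure_cong) simp_all
  ultimately have f: "?f \<in> borel_measurable (lborel \<Otimes>\<^sub>M lborel)" by simp
  have transl: "(\<integral>\<^sup>+x. indicator ?S (x + a) \<partial>lborel) = emeasure lborel ?S" for a :: "real ^ 'k"
  proof -
    have "emeasure lborel ?S = (\<integral>\<^sup>+x. indicator ?S x \<partial>distr lborel borel ((+) a))"
      using S by (simp add: lborel_distr_plus)
    also have "\<dots> = (\<integral>\<^sup>+x. indicator ?S (a + x) \<partial>lborel)"
      using S by (subst nn_integral_distr) auto
    finally show ?thesis by (simp add: add.commute)
  qed
  \<comment> \<open>The length 1 of the unit interval is inserted as a factor; by translation
    invariance each slice has the measure of \<open>?S\<close>.\<close>
  have "emeasure lborel ?S = (\<integral>\<^sup>+s\<in>{0..1::real}. emeasure lborel ?S \<partial>lborel)"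
    by (subst nn_integral_cmult_indicator) auto
  also have "\<dots> = (\<integral>\<^sup>+s. \<integral>\<^sup>+x. ?f (x, s) \<partial>lborel \<partial>lborel)"
  proof (intro nn_integral_cong)
    fix s :: real
    have "(\<lambda>x. indicator ?S (x + \<kappa> s) :: ennreal) \<in> borel_measurable lborel"
      using S by measurable
    then show "emeasure lborel ?S * indicator {0..1} s = (\<integral>\<^sup>+x. ?f (x, s) \<partial>lborel)"
      by (simp add: nn_integral_multc transl)
  qed
  also have "\<dots> = (\<integral>\<^sup>+x. \<integral>\<^sup>+s. ?f (x, s) \<partial>lborel \<partial>lborel)"
    by (rule lborel_pair.Fubini[OF f])
  also have "\<dots> = (\<integral>\<^sup>+(x :: real ^ 'k). 0 \<partial>lborel)"
  proof (intro nn_integral_cong)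
    fix x :: "real ^ 'k"
    have "AE s in lborel. s \<notin> {s. ?P (x + \<kappa> s) = 0}"
      using fin[of x] by (intro AE_not_in finite_imp_null_set_lborel)
    then show "(\<integral>\<^sup>+s. ?f (x, s) \<partial>lborel) = 0"
      by (subst nn_integral_cong_AE[where v = "\<lambda>_. 0"]) (auto simp: indicator_def)
  qed
  finally show ?thesis using S by (simp add: null_sets_def)
qed

text \<open>Block elimination, one index at a time. Definiteness passes to the smaller index set by
  extending vectors with 0. The Schur complement \<open>s\<close> is nonzero, since otherwise the
  vector with entry 1 at \<open>a\<close> and \<open>- y\<close> on \<open>I\<close> would give the
  quadratic form the value 0.\<close>

lemma positive_definite_solvable:
  fixes G :: "'i \<Rightarrow> 'i \<Rightarrow> real"
  assumes "finite I"
    and pos: "\<And>x. (\<Sum>l\<in>I. \<Sum>n\<in>I. x l * G l n * x n) \<le> 0 \<Longrightarrow> \<forall>l\<in>I. x l = 0"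
  shows "\<exists>x. \<forall>l\<in>I. (\<Sum>j\<in>I. G l j * x j) = b l"
  using assms
proof (induction I arbitrary: b rule: finite_induct)
  case (insert a I)
  have ext: "(\<Sum>l\<in>insert a I. \<Sum>n\<in>insert a I. x l * G l n * x n) = x a * (G a a * x a + (\<Sum>n\<in>I. G a n * x n))
      + (\<Sum>l\<in>I. x l * (G l a * x a + (\<Sum>n\<in>I. G l n * x n)))" for x
    using insert.hyps by (simp add: sum.insert sum.distrib sum_distrib_left algebra_simps)
  have "\<forall>l\<in>I. x l = 0" if "(\<Sum>l\<in>I. \<Sum>n\<in>I. x l * G l n * x n) \<le> 0" for x
  proof -
    let ?x = "x(a := 0)"
    have "(\<Sum>l\<in>I. ?x l * (\<Sum>n\<in>I. G l n * ?x n)) = (\<Sum>l\<in>I. \<Sum>n\<in>I. x l * G l n * x n)"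
      unfolding sum_distrib_left using insert.hyps by (intro sum.cong) (auto simp: mult.assoc)
    then have "\<forall>l\<in>insert a I. ?x l = 0" using that by (intro insert.prems) (subst ext, simp)
    then show ?thesis using insert.hyps by (auto split: if_splits)
  qed
  note IH = insert.IH[OF this]
  obtain x where x: "\<And>l. l \<in> I \<Longrightarrow> (\<Sum>j\<in>I. G l j * x j) = b l" using IH by blast
  obtain y where y: "\<And>l. l \<in> I \<Longrightarrow> (\<Sum>j\<in>I. G l j * y j) = G l a" using IH[of "\<lambda>l. G l a"] by blast
  define s where "s = G a a - (\<Sum>j\<in>I. G a j * y j)"
  have "s \<noteq> 0"
  proof
    assume s0: "s = 0"
    let ?z = "\<lambda>j. if j = a then 1 else - y j"
    have z: "(\<Sum>n\<in>I. G l n * ?z n) = - (\<Sum>j\<in>I. G l j * y j)" for l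
      unfolding sum_negf[symmetric] using insert.hyps by (intro sum.cong) auto
    have "(\<Sum>l\<in>insert a I. \<Sum>n\<in>insert a I. ?z l * G l n * ?z n) = 0"
      unfolding ext z using y s0 by (simp add: s_def)
    then have "\<forall>l\<in>insert a I. ?z l = 0" by (intro insert.prems) simp
    then show False by simp
  qed
  \<comment> \<open>The row of \<open>a\<close> determines \<open>t\<close>; the rows of
    \<open>I\<close> hold for every \<open>t\<close> by the choice of \<open>x\<close> and
    \<open>y\<close>.\<close>
  define t where "t = (b a - (\<Sum>j\<in>I. G a j * x j)) / s"
  let ?u = "\<lambda>j. if j = a then t else x j - t * y j"
  have u: "(\<Sum>j\<in>insert a I. G l j * ?u j) = G l a * t + (\<Sum>j\<in>I. G l j * x j) - t * (\<Sum>j\<in>I. G l j * y j)" for l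
  proof -
    have "(\<Sum>j\<in>I. G l j * ?u j) = (\<Sum>j\<in>I. G l j * x j - t * (G l j * y j))"
      using insert.hyps by (intro sum.cong) (auto simp: algebra_simps)
    then show ?thesis using insert.hyps by (simp add: sum_subtractf sum_distrib_left)
  qed
  have "t * s = b a - (\<Sum>j\<in>I. G a j * x j)" using \<open>s \<noteq> 0\<close> by (simp add: t_def)
  then have "\<forall>l\<in>insert a I. (\<Sum>j\<in>insert a I. G l j * ?u j) = b l"
    unfolding u using x y by (auto simp: s_def right_diff_distrib mult.commute[of "G _ _" t])
  then show ?case by (intro exI[of _ ?u])
qed simp

lemma is_inverse_on_unique:
  assumes I: "finite I" and K: "is_inverse_on I G K" "is_inverse_on I G K'"
  shows "K = K'"
proof (intro ext)
  fix l n
  show "K l n = K' l n"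
  proof (cases "l \<in> I \<and> n \<in> I")
    case True
    then have ln: "l \<in> I" "n \<in> I" by auto
    have "K l n = (\<Sum>j\<in>I. K l j * (if j = n then 1 else 0))"
      using I ln by (simp add: if_distrib[of "\<lambda>a. _ * a"] cong: if_cong)
    also have "\<dots> = (\<Sum>j\<in>I. K l j * (\<Sum>i\<in>I. G j i * K' i n))"
      using K(2) ln by (intro sum.cong) (auto simp: is_inverse_on_def)
    also have "\<dots> = (\<Sum>i\<in>I. (\<Sum>j\<in>I. K l j * G j i) * K' i n)"
      unfolding sum_distrib_left sum_distrib_right by (subst sum.swap) (simp add: mult.assoc)
    also have "\<dots> = (\<Sum>i\<in>I. (if l = i then 1 else 0) * K' i n)"
      using K(1) ln by (intro sum.cong) (auto simp: is_inverse_on_def)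
    also have "\<dots> = K' l n" using I ln by (simp add: if_distrib[of "\<lambda>a. a * _"] cong: if_cong)
    finally show ?thesis .
  next
    case False
    then show ?thesis using K by (auto simp: is_inverse_on_def)
  qed
qed

text \<open>\<open>inverse_on\<close> is a definite description, so existence and uniqueness are
  both due. Solving for the columns gives a right inverse \<open>K\<close>; \<open>G\<close>
  annihilates each column of the difference between the product of \<open>K\<close> with
  \<open>G\<close> and the identity, so definiteness makes \<open>K\<close> a left inverse
  too.\<close>

lemma inverse_on_positive_definite:
  fixes G :: "'i \<Rightarrow> 'i \<Rightarrow> real"
  assumes I: "finite I"
    and pos: "\<And>x. (\<Sum>l\<in>I. \<Sum>n\<in>I. x l * G l n * x n) \<le> 0 \<Longrightarrow> \<forall>l\<in>I. x l = 0"
  shows "is_inverse_on I G (inverse_on I G)"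
proof -
  have "\<forall>n. \<exists>x. \<forall>l\<in>I. (\<Sum>j\<in>I. G l j * x j) = (if l = n then 1 else 0)"
    by (intro allI positive_definite_solvable[OF I] pos)
  then obtain X where X: "\<And>l n. l \<in> I \<Longrightarrow> (\<Sum>j\<in>I. G l j * X n j) = (if l = n then 1 else 0)" by metis
  define K where "K l n = (if l \<in> I \<and> n \<in> I then X n l else 0)" for l n
  have right: "(\<Sum>j\<in>I. G l j * K j n) = (if l = n then 1 else 0)" if "l \<in> I" "n \<in> I" for l n
    using X[OF that(1), of n] that(2) by (simp add: K_def)
  have left: "(\<Sum>j\<in>I. K l j * G j n) = (if l = n then 1 else 0)" if "l \<in> I" "n \<in> I" for l n
  proof -
    let ?x = "\<lambda>l. (\<Sum>j\<in>I. K l j * G j n) - (if l = n then 1 else 0)"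
    have "(\<Sum>i\<in>I. G l i * ?x i) = 0" if l: "l \<in> I" for l
    proof -
      have "(\<Sum>i\<in>I. G l i * (\<Sum>j\<in>I. K i j * G j n)) = (\<Sum>j\<in>I. (\<Sum>i\<in>I. G l i * K i j) * G j n)"
        unfolding sum_distrib_left sum_distrib_right by (subst sum.swap) (simp add: mult.assoc)
      also have "\<dots> = (\<Sum>j\<in>I. (if l = j then 1 else 0) * G j n)"
        using right[OF l] by (intro sum.cong) auto
      also have "\<dots> = G l n" using I l by (simp add: if_distrib[of "\<lambda>a. a * _"] cong: if_cong)
      finally show ?thesis using I \<open>n \<in> I\<close>
        by (simp add: right_diff_distrib sum_subtractf if_distrib[of "\<lambda>a. _ * a"] cong: if_cong)
    qed
    then have "(\<Sum>l\<in>I. \<Sum>i\<in>I. ?x l * G l i * ?x i) = 0"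
      unfolding mult.assoc sum_distrib_left[symmetric] by simp
    then have "\<forall>l\<in>I. ?x l = 0" by (intro pos) simp
    then show ?thesis using that by simp
  qed
  have "is_inverse_on I G K" unfolding is_inverse_on_def using right left by (auto simp: K_def)
  then show ?thesis unfolding inverse_on_def
    using is_inverse_on_unique[OF I] by (intro theI[where P = "is_inverse_on I G" and a = K])
qed

section \<open>Disintegration and independence of the monomials\<close>

lemma monomial_moment_map: "monomial Hs n m = (\<Prod>i\<in>UNIV. moment_map Hs m $ i ^ n i)"
  by (simp add: monomial_def moment_map_def)

text \<open>On the level set of \<alpha> the polynomial in the conserved quantities has the constant
  value \<open>?P \<alpha>\<close>, nonzero for almost every \<alpha>. If it vanishes almost
  everywhere on the manifold, almost every level set has mass 0, and hence so has the
  manifold.\<close>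

lemma monomials_independent:
  fixes Hs :: "'k::finite \<Rightarrow> 'm::topological_space \<Rightarrow> real"
  assumes mc: "microcanonical_measures dm Hs mc" and sets: "sets dm = sets borel"
    and meas: "\<And>n. monomial Hs n \<in> borel_measurable borel"
    and ae: "AE m in dm. (\<Sum>n\<in>multi_indices d. c n * monomial Hs n m) = 0"
    and n0: "n\<^sub>0 \<in> multi_indices d" "c n\<^sub>0 \<noteq> 0"
  shows "emeasure dm UNIV = 0"
proof -
  let ?R = "range (moment_map Hs)"
  let ?P = "\<lambda>x :: real ^ 'k. \<Sum>n\<in>multi_indices d. c n * (\<Prod>i\<in>UNIV. x $ i ^ n i)"
  have P: "(\<Sum>n\<in>multi_indices d. c n * monomial Hs n m) = ?P (moment_map Hs m)" for m
    by (simp add: monomial_moment_map)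
  let ?N = "{m. ?P (moment_map Hs m) \<noteq> 0}"
  have "(\<lambda>m. \<Sum>n\<in>multi_indices d. c n * monomial Hs n m) \<in> borel_measurable borel"
    using meas by measurable
  from measurable_sets[OF this, of "- {0}"] have N: "?N \<in> sets borel"
    unfolding P by (simp add: vimage_def Collect_neg_eq)
  have dis: "(\<lambda>\<alpha>. (\<integral>\<^sup>+m. F m \<partial>mc \<alpha>) * indicator ?R \<alpha>) \<in> borel_measurable lborel"
     "(\<integral>\<^sup>+m. F m \<partial>dm) = (\<integral>\<^sup>+\<alpha>\<in>?R. (\<integral>\<^sup>+m. F m \<partial>mc \<alpha>) \<partial>lborel)" if "F \<in> borel_measurable borel" for F
    using mc that unfolding microcanonical_measures_def by blast+
  have space: "space (mc \<alpha>) = level_set Hs \<alpha>" if "\<alpha> \<in> ?R" for \<alpha>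
  proof -
    have "sets (mc \<alpha>) = sets (restrict_space borel (level_set Hs \<alpha>))"
      using mc that unfolding microcanonical_measures_def by blast
    from sets_eq_imp_space_eq[OF this] show ?thesis by (simp add: space_restrict_space)
  qed
  have "(\<integral>\<^sup>+m. indicator ?N m \<partial>dm) = (\<integral>\<^sup>+m. 0 \<partial>dm)"
    using ae unfolding P by (intro nn_integral_cong_AE) (auto simp: indicator_def)
  then have "(\<integral>\<^sup>+\<alpha>\<in>?R. (\<integral>\<^sup>+m. indicator ?N m \<partial>mc \<alpha>) \<partial>lborel) = 0"
    using dis(2)[of "indicator ?N"] N by simp
  then have "AE \<alpha> in lborel. (\<integral>\<^sup>+m. indicator ?N m \<partial>mc \<alpha>) * indicator ?R \<alpha> = 0"
    using dis(1)[of "indicator ?N"] N by (simp add: nn_integral_0_iff_AE)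
  moreover have "AE \<alpha> in lborel. ?P \<alpha> \<noteq> 0"
    using AE_not_in[OF polynomial_zeros_null[OF n0(1), of c, OF n0(2)]] by simp
  ultimately have "AE \<alpha> in lborel. (\<integral>\<^sup>+m. 1 \<partial>mc \<alpha>) * indicator ?R \<alpha> = 0"
  proof eventually_elim
    case (elim \<alpha>)
    show ?case
    proof (cases "\<alpha> \<in> ?R")
      case True
      have "(\<integral>\<^sup>+m. indicator ?N m \<partial>mc \<alpha>) = (\<integral>\<^sup>+m. 1 \<partial>mc \<alpha>)"
        using space[OF True] elim(2) by (intro nn_integral_cong) (auto simp: level_set_def)
      then show ?thesis using elim(1) by simp
    qed simp
  qed
  then have "(\<integral>\<^sup>+\<alpha>\<in>?R. (\<integral>\<^sup>+m. 1 \<partial>mc \<alpha>) \<partial>lborel) = (\<integral>\<^sup>+(\<alpha> :: real ^ 'k). 0 \<partial>lborel)"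
    by (rule nn_integral_cong_AE)
  then have "(\<integral>\<^sup>+m. 1 \<partial>dm) = 0" using dis(2)[of "\<lambda>_. 1"] by simp
  moreover have "space dm = UNIV" using sets_eq_imp_space_eq[OF sets] by simp
  ultimately show ?thesis by simp
qed

section \<open>The lower bound\<close>

lemma gibbs_measure:
  fixes H :: "'m \<Rightarrow> real" and \<beta> :: real
  assumes [measurable]: "H \<in> borel_measurable dm"
  defines "\<mu> \<equiv> density dm (\<lambda>m. ennreal (exp (- \<beta> * H m)))"
  shows gibbs_integral: "f \<in> borel_measurable dm \<Longrightarrow> integral\<^sup>L \<mu> f = (LINT m|dm. f m * exp (- \<beta> * H m))"
    and gibbs_integrable: "f \<in> borel_measurable dm \<Longrightarrow> integrable \<mu> f \<longleftrightarrow> integrable dm (\<lambda>m. f m * exp (- \<beta> * H m))"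
    and gibbs_AE: "(AE m in \<mu>. P m) \<longleftrightarrow> (AE m in dm. P m)"
proof -
  show "f \<in> borel_measurable dm \<Longrightarrow> integral\<^sup>L \<mu> f = (LINT m|dm. f m * exp (- \<beta> * H m))"
    unfolding \<mu>_def by (subst integral_density) (auto simp: mult.commute)
  show "f \<in> borel_measurable dm \<Longrightarrow> integrable \<mu> f \<longleftrightarrow> integrable dm (\<lambda>m. f m * exp (- \<beta> * H m))"
    unfolding \<mu>_def by (subst integrable_density) (auto simp: mult.commute)
  show "(AE m in \<mu>. P m) \<longleftrightarrow> (AE m in dm. P m)"
    unfolding \<mu>_def by (subst AE_density) auto
qed

text \<open>Converts "almost every level, almost every point on it" into almost everywhere on the
  manifold; measurability of \<open>P\<close> admits its exceptional set to the disintegration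
  formula.\<close>

lemma microcanonical_AE:
  fixes Hs :: "'k::finite \<Rightarrow> 'm::topological_space \<Rightarrow> real"
  assumes mc: "microcanonical_measures dm Hs mc" and sets: "sets dm = sets borel"
    and P: "Measurable.pred borel P"
    and ae: "AE \<alpha> in lborel. \<alpha> \<in> range (moment_map Hs) \<longrightarrow> (AE m in mc \<alpha>. P m)"
  shows "AE m in dm. P m"
proof -
  let ?N = "{m. \<not> P m}"
  have N: "?N \<in> sets borel" using P by measurable
  have "(\<integral>\<^sup>+m. indicator ?N m \<partial>dm) = (\<integral>\<^sup>+\<alpha>\<in>range (moment_map Hs). (\<integral>\<^sup>+m. indicator ?N m \<partial>mc \<alpha>) \<partial>lborel)"
    using mc N unfolding microcanonical_measures_def by (meson borel_measurable_indicator)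
  also have "\<dots> = (\<integral>\<^sup>+(\<alpha> :: real ^ 'k). 0 \<partial>lborel)"
  proof (rule nn_integral_cong_AE)
    show "AE \<alpha> in lborel. (\<integral>\<^sup>+m. indicator ?N m \<partial>mc \<alpha>) * indicator (range (moment_map Hs)) \<alpha> = 0"
      using ae
    proof eventually_elim
      case (elim \<alpha>)
      show ?case
      proof (cases "\<alpha> \<in> range (moment_map Hs)")
        case True
        then have "AE m in mc \<alpha>. P m" using elim by blast
        then have "(\<integral>\<^sup>+m. indicator ?N m \<partial>mc \<alpha>) = (\<integral>\<^sup>+m. 0 \<partial>mc \<alpha>)"
          by (intro nn_integral_cong_AE) auto
        then show ?thesis by simp
      qed simp
    qed
  qed
  finally have "emeasure dm ?N = 0" using N sets by simp
  then show ?thesis using N sets sets_eq_imp_space_eq[OF sets] by (intro AE_I[of _ _ ?N]) auto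
qed

context hamiltonian_system
begin

text \<open>Liouville's theorem together with conservation of energy, which makes the Gibbs weight
  constant along orbits.\<close>

lemma invariant_flow:
  assumes [measurable]: "H \<in> borel_measurable borel" and inv: "\<And>m t. H (\<gamma> m t) = H m"
    and int: "integrable dm (\<lambda>m. exp (- \<beta> * H m))"
  shows "invariant_flow (density dm (\<lambda>m. ennreal (exp (- \<beta> * H m)))) \<gamma>"
proof -
  let ?w = "\<lambda>m. ennreal (exp (- \<beta> * H m))"
  let ?\<mu> = "density dm ?w"
  note [measurable_cong] = sets_dm
  have w [measurable]: "?w \<in> borel_measurable borel" by measurable
  have pair: "(\<lambda>(m, t). \<gamma> m t) \<in> measurable (borel \<Otimes>\<^sub>M borel) borel"
    unfolding borel_prod by (rule borel_measurable_continuous_onI[OF continuous_flow_pair])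
  have flow [measurable]: "(\<lambda>m. \<gamma> m t) \<in> measurable borel borel" for t by (rule measurable_flow)
  have dm_inv: "distr dm borel (\<lambda>m. \<gamma> m t) = dm" for t
  proof (rule measure_eqI)
    fix B assume "B \<in> sets (distr dm borel (\<lambda>m. \<gamma> m t))"
    then have "B \<in> sets borel" by simp
    then show "emeasure (distr dm borel (\<lambda>m. \<gamma> m t)) B = emeasure dm B"
      using flow_measure_preserving[of B t] sets_eq_imp_space_eq[OF sets_dm] by (simp add: emeasure_distr)
  qed (simp add: sets_dm)
  show ?thesis
  proof (intro invariant_flow.intro invariant_flow_axioms.intro finite_measureI)
    have "emeasure ?\<mu> (space ?\<mu>) = (\<integral>\<^sup>+m. ?w m \<partial>dm)"
      by (subst emeasure_density) (auto intro!: nn_integral_cong simp: indicator_def)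
    also have "\<dots> = ennreal (LINT m|dm. exp (- \<beta> * H m))"
      by (rule nn_integral_eq_integral[OF int]) simp
    finally show "emeasure ?\<mu> (space ?\<mu>) \<noteq> \<infinity>" by simp
    show "(\<lambda>(m, t). \<gamma> m t) \<in> measurable (?\<mu> \<Otimes>\<^sub>M lborel) ?\<mu>"
      using pair by (simp add: sets_dm cong: measurable_cong_sets sets_pair_measure_cong)
    show "\<gamma> m (s + t) = \<gamma> (\<gamma> m s) t" for m s t by (rule flow_add)
    show "distr ?\<mu> ?\<mu> (\<lambda>m. \<gamma> m t) = ?\<mu>" for t
    proof (rule measure_eqI)
      fix B assume "B \<in> sets (distr ?\<mu> ?\<mu> (\<lambda>m. \<gamma> m t))"
      then have B [measurable]: "B \<in> sets borel" by (simp add: sets_dm)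
      have m: "(\<lambda>m. \<gamma> m t) \<in> measurable ?\<mu> ?\<mu>" using flow by (simp add: sets_dm cong: measurable_cong_sets)
      have pre: "(\<lambda>m. \<gamma> m t) -` B \<in> sets dm" using measurable_sets[OF flow B] by (simp add: sets_dm)
      have "emeasure (distr ?\<mu> ?\<mu> (\<lambda>m. \<gamma> m t)) B = emeasure ?\<mu> ((\<lambda>m. \<gamma> m t) -` B)"
        using B sets_eq_imp_space_eq[OF sets_dm] by (subst emeasure_distr[OF m]) (auto simp: sets_dm)
      also have "\<dots> = (\<integral>\<^sup>+m. ?w m * indicator ((\<lambda>m. \<gamma> m t) -` B) m \<partial>dm)"
        using pre by (intro emeasure_density) auto
      also have "\<dots> = (\<integral>\<^sup>+m. ?w (\<gamma> m t) * indicator B (\<gamma> m t) \<partial>dm)"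
        by (intro nn_integral_cong) (simp add: inv indicator_def)
      also have "\<dots> = (\<integral>\<^sup>+m. ?w m * indicator B m \<partial>distr dm borel (\<lambda>m. \<gamma> m t))"
        by (subst nn_integral_distr) auto
      also have "\<dots> = emeasure ?\<mu> B"
        unfolding dm_inv using B by (intro emeasure_density[symmetric]) (auto simp: sets_dm)
      finally show "emeasure (distr ?\<mu> ?\<mu> (\<lambda>m. \<gamma> m t)) B = emeasure ?\<mu> B" .
    qed simp
  qed
qed

end

lemma integral_null_measure:
  assumes "emeasure M (space M) = 0"
  shows "integral\<^sup>L M f = (0 :: real)"
proof -
  have "AE x in M. f x = 0" using assms by (intro AE_I[of _ _ "space M"]) auto
  then show ?thesis by (rule integral_eq_zero_AE)
qed

theorem theorem2:
  fixes atlas :: "('m::{t2_space, second_countable_topology}, 'n::finite) chart set"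
    and \<omega> :: "('m, 'n) two_form"
    and r d :: nat
    and H A :: "'m \<Rightarrow> real"
    and \<gamma> :: "'m \<Rightarrow> real \<Rightarrow> 'm"
    and dm :: "'m measure"
    and i\<^sub>1 :: "'k::finite"
    and Hs :: "'k \<Rightarrow> 'm \<Rightarrow> real"
    and mc :: "real ^ 'k \<Rightarrow> 'm measure"
    and \<beta> :: real
  assumes "hamiltonian_system atlas \<omega> r H \<gamma> dm"
    and "conserved_quantities atlas H \<gamma> i\<^sub>1 Hs"
    and "microcanonical_measures dm Hs mc"
    and "\<And>b. b > 0 \<Longrightarrow> integrable dm (\<lambda>m. exp (- b * H m))"
    and "\<beta> > 0"
    and "ergodically_regular dm H \<beta> \<gamma> Hs mc"
    and "\<And>n. monomial Hs n \<in> Lp_gibbs dm H \<beta> 2"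
    and "A \<in> Lp_gibbs dm H \<beta> 1 \<inter> Lp_gibbs dm H \<beta> 2"
    and "d > 0"
  shows "\<exists>C. (time_average (autocorrelation dm H \<beta> \<gamma> A) \<longlongrightarrow> C) at_top \<and>
    C \<ge> (\<Sum>l\<in>multi_indices d. \<Sum>n\<in>multi_indices d.
            gibbs_inner dm H \<beta> A (monomial Hs l)
            * inverse_on (multi_indices d) (gram dm H \<beta> Hs) l n
            * gibbs_inner dm H \<beta> A (monomial Hs n))"
proof -
  interpret hamiltonian_system atlas \<omega> r H \<gamma> dm by (rule assms(1))
  note [measurable_cong] = sets_dm
  have space_dm [simp]: "space dm = UNIV" using sets_eq_imp_space_eq[OF sets_dm] by simp
  have dm_borel: "measurable dm N = measurable borel N" for N :: "real measure"
    by (rule measurable_cong_sets[OF sets_dm refl])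
  have mono_meas: "monomial Hs n \<in> borel_measurable borel" for n
    using assms(7)[of n] by (simp add: Lp_gibbs_def dm_borel)
  have HsH: "Hs i\<^sub>1 = H" and conserved: "\<And>i m t. Hs i (\<gamma> m t) = Hs i m"
    using assms(2) by (auto simp: conserved_quantities_def)
  \<comment> \<open>The Hamiltonian is itself a monomial, so its Borel measurability can be read off
    from that of the monomials.\<close>
  have "monomial Hs (\<lambda>i. if i = i\<^sub>1 then 1 else 0) = H"
  proof
    fix m
    have "monomial Hs (\<lambda>i. if i = i\<^sub>1 then 1 else 0) m = (\<Prod>i\<in>UNIV. if i = i\<^sub>1 then H m else 1)"
      unfolding monomial_def by (intro prod.cong) (auto simp: HsH)
    then show "monomial Hs (\<lambda>i. if i = i\<^sub>1 then 1 else 0) m = H m" by simp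
  qed
  then have H_borel [measurable]: "H \<in> borel_measurable borel"
    using mono_meas by metis
  then have H_meas [measurable]: "H \<in> borel_measurable dm" by (simp add: dm_borel)
  have H_inv: "H (\<gamma> m t) = H m" for m t using conserved[of i\<^sub>1] by (simp add: HsH)
  define Z where "Z = partition_function dm H \<beta>"
  define \<mu> where "\<mu> = density dm (\<lambda>m. ennreal (exp (- \<beta> * H m)))"
  note expint = assms(4)[OF assms(5)]
  interpret invariant_flow \<mu> \<gamma> unfolding \<mu>_def by (rule invariant_flow[OF H_borel H_inv expint])
  have sets_\<mu>: "sets \<mu> = sets borel" by (simp add: \<mu>_def sets_dm)
  have \<mu>_borel: "measurable \<mu> N = measurable borel N" for N :: "real measure"
    by (rule measurable_cong_sets[OF sets_\<mu> refl])
  interpret ergodic_flow \<mu> \<gamma>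
  proof
    fix B :: "'m \<Rightarrow> real" and C assume B: "B \<in> borel_measurable \<mu>" "\<And>m. \<bar>B m\<bar> \<le> C"
    have B' [measurable]: "B \<in> borel_measurable dm" using B(1) by (simp add: dm_borel \<mu>_borel)
    \<comment> \<open>Finiteness of the partition function makes bounded observables integrable for
      the Gibbs weight.\<close>
    have "integrable dm (\<lambda>m. \<bar>B m\<bar> powr 1 * exp (- \<beta> * H m))"
    proof (rule Bochner_Integration.integrable_bound[where f = "\<lambda>m. C * exp (- \<beta> * H m)"])
      show "AE m in dm. norm (\<bar>B m\<bar> powr 1 * exp (- \<beta> * H m)) \<le> norm (C * exp (- \<beta> * H m))"
        using B(2) by (intro AE_I2) (simp add: abs_mult powr_one_gt_zero_iff order_trans[OF _ abs_ge_self])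
    qed (use expint in auto)
    then have "B \<in> Lp_gibbs dm H \<beta> 1" by (simp add: Lp_gibbs_def)
    then have er: "AE \<alpha> in lborel. \<alpha> \<in> range (moment_map Hs) \<longrightarrow> (AE m in mc \<alpha>.
          (time_average (\<lambda>t. B (\<gamma> m t)) \<longlongrightarrow>
             1 / measure (mc \<alpha>) (level_set Hs \<alpha>) * (LINT m'|mc \<alpha>. B m')) at_top)"
      using assms(6) unfolding ergodically_regular_def by blast
    let ?P = "\<lambda>m. convergent (\<lambda>n. time_average (\<lambda>t. B (\<gamma> m t)) (real n))"
    have "(\<lambda>m. time_average (\<lambda>t. B (\<gamma> m t)) T) \<in> borel_measurable borel" for T
      using average_measurable[OF B(1), of T] by (simp add: \<mu>_borel)
    \<comment> \<open>For real sequences convergence is the Cauchy property, a countable condition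
      on measurable functions.\<close>
    then have P: "Measurable.pred borel ?P"
      unfolding Cauchy_convergent_iff[symmetric] pred_def by (rule sets_Collect_Cauchy)
    have "AE m in dm. ?P m"
    proof (rule microcanonical_AE[OF assms(3) sets_dm P])
      show "AE \<alpha> in lborel. \<alpha> \<in> range (moment_map Hs) \<longrightarrow> (AE m in mc \<alpha>. ?P m)"
        using er
      proof eventually_elim
        case (elim \<alpha>)
        show ?case
        proof
          assume "\<alpha> \<in> range (moment_map Hs)"
          with elim have "AE m in mc \<alpha>. (time_average (\<lambda>t. B (\<gamma> m t)) \<longlongrightarrow>
             1 / measure (mc \<alpha>) (level_set Hs \<alpha>) * (LINT m'|mc \<alpha>. B m')) at_top" by blast
          then show "AE m in mc \<alpha>. ?P m"
            by eventually_elim (rule convergentI, rule filterlim_compose[OF _ filterlim_real_sequentially])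
        qed
      qed
    qed
    then show "AE m in \<mu>. ?P m" unfolding \<mu>_def by (simp only: gibbs_AE[OF H_meas])
  qed
  have inner: "gibbs_inner dm H \<beta> F G = 1 / Z * inner2 F G" if "F \<in> borel_measurable dm" "G \<in> borel_measurable dm" for F G
  proof -
    have "integral\<^sup>L \<mu> (\<lambda>m. F m * G m) = (LINT m|dm. F m * G m * exp (- \<beta> * H m))"
      unfolding \<mu>_def using that by (intro gibbs_integral[OF H_meas]) simp
    then show ?thesis by (simp add: gibbs_inner_def inner2_def Z_def)
  qed
  have L2: "F \<in> L2" if "F \<in> Lp_gibbs dm H \<beta> 2" for F
  proof -
    have F: "F \<in> borel_measurable dm" "integrable dm (\<lambda>m. \<bar>F m\<bar> powr 2 * exp (- \<beta> * H m))"
      using that by (auto simp: Lp_gibbs_def)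
    have "(\<lambda>m. \<bar>F m\<bar> powr 2 * exp (- \<beta> * H m)) = (\<lambda>m. (F m)\<^sup>2 * exp (- \<beta> * H m))"
      by (auto simp: fun_eq_iff)
    then have "integrable \<mu> (\<lambda>m. (F m)\<^sup>2)"
      unfolding \<mu>_def using F by (subst gibbs_integrable) auto
    then show ?thesis using F by (simp add: L2_def \<mu>_borel dm_borel)
  qed
  have AL: "A \<in> L2" using assms(8) by (intro L2) auto
  have mL: "monomial Hs n \<in> L2" for n by (rule L2[OF assms(7)])
  have L2dm: "F \<in> borel_measurable dm" if "F \<in> L2" for F
    using L2_measurable[OF that] by (simp add: \<mu>_borel dm_borel)
  have auto: "autocorrelation dm H \<beta> \<gamma> A = (\<lambda>t. 1 / Z * corr A A t)"
    unfolding autocorrelation_def corr_def using inner[OF L2dm[OF AL] L2dm[OF L2_flow[OF AL]]] by auto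
  obtain c where c: "(time_average (corr A A) \<longlongrightarrow> c) at_top"
    using correlation_limit_exists[OF AL] by blast
  have "time_average (\<lambda>t. 1 / Z * corr A A t) = (\<lambda>T. 1 / Z * time_average (corr A A) T)"
    by (simp add: fun_eq_iff time_average_def)
  then have lim: "(time_average (autocorrelation dm H \<beta> \<gamma> A) \<longlongrightarrow> 1 / Z * c) at_top"
    unfolding auto using tendsto_mult[OF tendsto_const c, of "1 / Z"] by simp
  let ?I = "multi_indices d :: ('k \<Rightarrow> nat) set"
  let ?G = "gram dm H \<beta> Hs" and ?a = "\<lambda>n. gibbs_inner dm H \<beta> A (monomial Hs n)"
  define K where "K = inverse_on ?I ?G"
  have G: "?G l n = 1 / Z * inner2 (monomial Hs l) (monomial Hs n)" for l n
    unfolding gram_def by (rule inner) (auto intro: L2dm mL)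
  have a: "?a n = 1 / Z * inner2 A (monomial Hs n)" for n
    by (rule inner) (auto intro: L2dm mL AL)
  define P where "P x m = (\<Sum>n\<in>?I. x n * monomial Hs n m)" for x m
  have PL: "P x \<in> L2" for x
  proof -
    have "(\<lambda>m. \<Sum>n\<in>J. x n * monomial Hs n m) \<in> L2" for J
      by (induction J rule: infinite_finite_induct) (auto intro: L2_add L2_cmult[OF mL] L2_bounded[of _ 0])
    then show ?thesis unfolding P_def .
  qed
  have iP: "inner2 F (P x) = (\<Sum>n\<in>?I. x n * inner2 F (monomial Hs n))" if "F \<in> L2" for F x
  proof -
    have "inner2 F (P x) = (LINT m|\<mu>. (\<Sum>n\<in>?I. x n * (F m * monomial Hs n m)))"
      by (simp add: inner2_def P_def sum_distrib_left mult.left_commute)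
    also have "\<dots> = (\<Sum>n\<in>?I. x n * inner2 F (monomial Hs n))"
      unfolding inner2_def using L2_integrable_mult[OF that mL] by (subst Bochner_Integration.integral_sum) auto
    finally show ?thesis .
  qed
  \<comment> \<open>The Gram matrix represents the squared norm on polynomials, so its definiteness
    amounts to independence of the monomials.\<close>
  have GP: "(\<Sum>l\<in>?I. \<Sum>n\<in>?I. x l * ?G l n * x n) = 1 / Z * inner2 (P x) (P x)" for x
  proof -
    have "inner2 (P x) (P x) = (\<Sum>l\<in>?I. x l * inner2 (P x) (monomial Hs l))" by (rule iP[OF PL])
    also have "\<dots> = (\<Sum>l\<in>?I. x l * inner2 (monomial Hs l) (P x))" by (simp add: inner2_def mult.commute)
    also have "\<dots> = (\<Sum>l\<in>?I. \<Sum>n\<in>?I. x l * x n * inner2 (monomial Hs l) (monomial Hs n))"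
      by (simp add: iP[OF mL] sum_distrib_left mult.assoc)
    finally show ?thesis by (simp add: G sum_distrib_left mult_ac)
  qed
  show ?thesis
  proof (cases "emeasure dm UNIV = 0")
    \<comment> \<open>Here \<open>Z = 0\<close>, and the convention \<open>1 / 0 = 0\<close> makes
      the limit 0; every inner product in the sum is 0 as well, whatever value
      \<open>inverse_on\<close> takes.\<close>
    case True
    then have "gibbs_inner dm H \<beta> F F' = 0" for F F'
      using integral_null_measure[of dm] by (simp add: gibbs_inner_def)
    moreover have "Z = 0" using integral_null_measure[of dm] True by (simp add: Z_def partition_function_def)
    ultimately show ?thesis using lim by (intro exI[of _ 0]) simp
  next
    case False
    have Z: "Z > 0"
    proof -
      have "Z \<ge> 0" by (simp add: Z_def partition_function_def)
      moreover have "Z \<noteq> 0"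
      proof
        assume "Z = 0"
        then have "AE m in dm. exp (- \<beta> * H m) = 0"
          using integral_nonneg_eq_0_iff_AE[OF expint] by (simp add: Z_def partition_function_def)
        then have "AE m in dm. False" by simp
        then show False 
          using False AE_iff_measurable[of UNIV dm "\<lambda>_. False"] sets.top[of dm] by simp
      qed
      ultimately show ?thesis by simp
    qed
    have "is_inverse_on ?I ?G K" unfolding K_def
    proof (rule inverse_on_positive_definite[OF finite_multi_indices])
      fix x assume "(\<Sum>l\<in>?I. \<Sum>n\<in>?I. x l * ?G l n * x n) \<le> 0"
      then have "inner2 (P x) (P x) \<le> 0" unfolding GP using Z by (simp add: field_simps)
      moreover have "inner2 (P x) (P x) \<ge> 0" by (simp add: inner2_def)
      ultimately have "inner2 (P x) (P x) = 0" by linarith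
      then have "AE m in \<mu>. P x m * P x m = 0"
        using integral_nonneg_eq_0_iff_AE[OF L2_integrable_mult[OF PL PL], of x x] by (simp add: inner2_def)
      then have ae: "AE m in dm. P x m = 0" unfolding \<mu>_def by (simp add: gibbs_AE[OF H_meas])
      show "\<forall>l\<in>?I. x l = 0"
      proof (rule ccontr)
        assume "\<not> (\<forall>l\<in>?I. x l = 0)"
        then obtain n where "n \<in> ?I" "x n \<noteq> 0" by blast
        with monomials_independent[OF assms(3) sets_dm mono_meas ae[unfolded P_def]] False show False by blast
      qed
    qed
    then have GK: "(\<Sum>j\<in>?I. ?G l j * K j n) = (if l = n then 1 else 0)" if "l \<in> ?I" "n \<in> ?I" for l n
      using that by (simp add: is_inverse_on_def)
    \<comment> \<open>The coefficients of the orthogonal projection of \<open>A\<close> to the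
      polynomials; \<open>Gx\<close> below states the normal equations.\<close>
    define x where "x l = (\<Sum>n\<in>?I. K l n * ?a n)" for l
    have Gx: "(\<Sum>n\<in>?I. ?G l n * x n) = ?a l" if l: "l \<in> ?I" for l
    proof -
      have "(\<Sum>n\<in>?I. ?G l n * x n) = (\<Sum>n\<in>?I. (\<Sum>j\<in>?I. ?G l j * K j n) * ?a n)"
        unfolding x_def sum_distrib_left sum_distrib_right by (subst sum.swap) (simp add: mult.assoc)
      also have "\<dots> = (\<Sum>n\<in>?I. (if l = n then 1 else 0) * ?a n)"
        using GK[OF l] by (intro sum.cong) auto
      also have "\<dots> = ?a l"
        using l by (simp add: finite_multi_indices if_distrib[of "\<lambda>a. a * _"] cong: if_cong)
      finally show ?thesis .
    qed
    have inv: "P x (\<gamma> m t) = P x m" for m t by (simp add: P_def monomial_def conserved)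
    have "c \<ge> 2 * inner2 A (P x) - inner2 (P x) (P x)"
      by (rule correlation_lower_bound[OF AL PL inv c])
    then have "1 / Z * c \<ge> 1 / Z * (2 * inner2 A (P x) - inner2 (P x) (P x))"
      using Z by (intro mult_left_mono) auto
    also have "1 / Z * (2 * inner2 A (P x) - inner2 (P x) (P x)) =
        2 * (1 / Z * inner2 A (P x)) - 1 / Z * inner2 (P x) (P x)" by (simp add: right_diff_distrib)
    \<comment> \<open>For the projection the inner products of \<open>P x\<close> with
      \<open>A\<close> and with itself coincide, so twice the first minus the second is their common
      value, the quadratic form of the inverse Gram matrix.\<close>
    also have "1 / Z * inner2 A (P x) = (\<Sum>l\<in>?I. x l * ?a l)"
      unfolding iP[OF AL] a by (simp add: sum_distrib_left mult.left_commute)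
    also have "1 / Z * inner2 (P x) (P x) = (\<Sum>l\<in>?I. x l * ?a l)"
      unfolding GP[symmetric] using Gx by (simp add: mult.assoc sum_distrib_left[symmetric])
    also have "2 * (\<Sum>l\<in>?I. x l * ?a l) - (\<Sum>l\<in>?I. x l * ?a l) = (\<Sum>l\<in>?I. \<Sum>n\<in>?I. ?a l * K l n * ?a n)"
      by (simp add: x_def sum_distrib_left sum_distrib_right mult_ac)
    finally show ?thesis using lim unfolding K_def by blast
  qed
qed

end
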